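(* Let $\tilde{\Delta}$ be the partial differential operator $$\tilde{\Delta}=-4(1-|z|^2)\left[(1-|z|^2)\frac{\partial^2}{\partial z\,\partial\overline{z}}-2\overline{z}\frac{\partial}{\partial\overline{z}}\right]$$ acting on the Hilbert space $L^2(\mathbb{D},d\lambda(z))$ with the dense domain $$D(\tilde{\Delta})=\left\{F\in L^2(\mathbb{D},d\lambda(z)):\ \tilde{\Delta}F\in L^2(\mathbb{D},d\lambda(z))\ \text{and}\ \frac{\partial F}{\partial z}\in L^2(\mathbb{D},d\lambda(z))\right\}.$$ Then: (i) The operator $\tilde{\Delta}$ is closable and admits a self-adjoint extension. (ii) The operator $\tilde{\Delta}$ is an unbounded non-self-adjoint operator. (iii) $0$ belongs to the point spectrum of $\tilde{\Delta}$.
   Context: $\mathbb{D}$ is the open unit disk in $\mathbb{C}$, $d\lambda$ is Lebesgue area measure, and $\partial/\partial z$, $\partial/\partial\overline{z}$ are the Wirtinger derivatives, with derivatives of $L^2$ functions taken in the sense of distributions. The point spectrum is the set of eigenvalues. *)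

theory Defs
  imports "HOL-Analysis.Analysis"
begin

text \<open>
  Restricting \<open>lborel\<close> means that representatives are Borel measurable. Every Lebesgue measurable
  function is almost everywhere equal to a Borel one, so the space of classes is the usual
  \<open>L\<^sup>2\<close> space.
\<close>

abbreviation unit_disk :: "complex set" where
  "unit_disk \<equiv> ball 0 1"

definition area :: "complex measure" where
  "area = restrict_space lborel unit_disk"

definition square_integrable :: "(complex \<Rightarrow> complex) \<Rightarrow> bool" where
  "square_integrable f \<longleftrightarrow>
     f \<in> borel_measurable area \<and> integrable area (\<lambda>z. (cmod (f z))\<^sup>2)"

definition l2_rel :: "(complex \<Rightarrow> complex) \<Rightarrow> (complex \<Rightarrow> complex) \<Rightarrow> bool" where
  "l2_rel f g \<longleftrightarrow> square_integrable f \<and> square_integrable g \<and> (AE z in area. f z = g z)"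

lemma square_integrable_zero: "square_integrable (\<lambda>z. 0)"
  by (simp add: square_integrable_def)

lemma square_integrable_scale:
  assumes "square_integrable f"
  shows "square_integrable (\<lambda>z. c * f z)"
  using assms by (auto simp: square_integrable_def norm_mult power_mult_distrib)

lemma square_integrable_add:
  assumes "square_integrable f" "square_integrable g"
  shows "square_integrable (\<lambda>z. f z + g z)"
proof -
  have [measurable]: "f \<in> borel_measurable area" "g \<in> borel_measurable area"
    using assms by (auto simp: square_integrable_def)
  have *: "integrable area (\<lambda>z. 2 * (cmod (f z))\<^sup>2 + 2 * (cmod (g z))\<^sup>2)"
    using assms by (auto simp: square_integrable_def)
  have "(cmod (f z + g z))\<^sup>2 \<le> 2 * (cmod (f z))\<^sup>2 + 2 * (cmod (g z))\<^sup>2" for z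
  proof -
    have "(cmod (f z + g z))\<^sup>2 \<le> (cmod (f z) + cmod (g z))\<^sup>2"
      by (intro power_mono norm_triangle_ineq) auto
    also have "\<dots> \<le> 2 * (cmod (f z))\<^sup>2 + 2 * (cmod (g z))\<^sup>2"
      using sum_squares_bound[of "cmod (f z)" "cmod (g z)"] by (simp add: power2_sum)
    finally show ?thesis .
  qed
  then have "integrable area (\<lambda>z. (cmod (f z + g z))\<^sup>2)"
    by (intro Bochner_Integration.integrable_bound[OF *]) auto
  then show ?thesis by (simp add: square_integrable_def)
qed

lemma square_integrable_mult_cnj:
  assumes "square_integrable f" "square_integrable g"
  shows "integrable area (\<lambda>z. f z * cnj (g z))"
proof -
  have [measurable]: "f \<in> borel_measurable area" "g \<in> borel_measurable area"
    using assms by (auto simp: square_integrable_def)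
  have *: "integrable area (\<lambda>z. (cmod (f z))\<^sup>2 + (cmod (g z))\<^sup>2)"
    using assms by (auto simp: square_integrable_def)
  have "cmod (f z) * cmod (g z) \<le> (cmod (f z))\<^sup>2 + (cmod (g z))\<^sup>2" for z
  proof -
    have "0 \<le> cmod (f z) * cmod (g z)" by simp
    then show ?thesis
      using sum_squares_bound[of "cmod (f z)" "cmod (g z)"] by linarith
  qed
  then have "cmod (f z * cnj (g z)) \<le> norm ((cmod (f z))\<^sup>2 + (cmod (g z))\<^sup>2 :: real)" for z
    by (simp add: norm_mult abs_of_nonneg)
  moreover have "(\<lambda>z. f z * cnj (g z)) \<in> borel_measurable area"
  proof -
    have [measurable]: "cnj \<in> borel_measurable borel"
      by (intro borel_measurable_continuous_onI continuous_intros)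
    show ?thesis by measurable
  qed
  ultimately show ?thesis
    by (intro Bochner_Integration.integrable_bound[OF *]) (auto simp: norm_mult)
qed

lemma part_equivp_l2_rel: "part_equivp l2_rel"
proof (rule part_equivpI)
  show "\<exists>f. l2_rel f f"
    using square_integrable_zero by (auto simp: l2_rel_def)
  show "symp l2_rel"
    by (rule sympI) (auto simp: l2_rel_def elim: eventually_mono)
  show "transp l2_rel"
    by (rule transpI) (auto simp: l2_rel_def elim: eventually_elim2)
qed

quotient_type disk_L2 = "complex \<Rightarrow> complex" / partial: l2_rel
  morphisms rep_L2 abs_L2
  by (rule part_equivp_l2_rel)

lift_definition scaleC_L2 :: "complex \<Rightarrow> disk_L2 \<Rightarrow> disk_L2" is "\<lambda>c f z. c * f z"
  by (auto simp: l2_rel_def square_integrable_scale elim: eventually_mono)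

lift_definition inner_L2 :: "disk_L2 \<Rightarrow> disk_L2 \<Rightarrow> complex"
  is "\<lambda>f g. LINT z|area. f z * cnj (g z)"
proof -
  fix f f' g g' assume "l2_rel f f'" "l2_rel g g'"
  then have si: "square_integrable f" "square_integrable f'" "square_integrable g"
      "square_integrable g'"
    and ae: "AE z in area. f z = f' z" "AE z in area. g z = g' z"
    by (auto simp: l2_rel_def)
  show "(LINT z|area. f z * cnj (g z)) = (LINT z|area. f' z * cnj (g' z))"
    using ae square_integrable_mult_cnj[OF si(1,3)] square_integrable_mult_cnj[OF si(2,4)]
    by (intro integral_cong_AE) (auto dest: borel_measurable_integrable elim: eventually_elim2)
qed

instantiation disk_L2 :: real_inner
begin

lift_definition zero_disk_L2 :: disk_L2 is "\<lambda>z. 0"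
  by (simp add: l2_rel_def square_integrable_zero)

lift_definition plus_disk_L2 :: "disk_L2 \<Rightarrow> disk_L2 \<Rightarrow> disk_L2" is "\<lambda>f g z. f z + g z"
  by (auto simp: l2_rel_def square_integrable_add elim: eventually_elim2)

definition scaleR_disk_L2 :: "real \<Rightarrow> disk_L2 \<Rightarrow> disk_L2" where
  "scaleR_disk_L2 r F = scaleC_L2 (of_real r) F"

definition uminus_disk_L2 :: "disk_L2 \<Rightarrow> disk_L2" where
  "uminus_disk_L2 F = scaleC_L2 (- 1) F"

definition minus_disk_L2 :: "disk_L2 \<Rightarrow> disk_L2 \<Rightarrow> disk_L2" where
  "minus_disk_L2 F G = F + (- G)"

definition inner_disk_L2 :: "disk_L2 \<Rightarrow> disk_L2 \<Rightarrow> real" where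
  "inner_disk_L2 F G = Re (inner_L2 F G)"

definition norm_disk_L2 :: "disk_L2 \<Rightarrow> real" where
  "norm_disk_L2 F = sqrt (inner F F)"

definition dist_disk_L2 :: "disk_L2 \<Rightarrow> disk_L2 \<Rightarrow> real" where
  "dist_disk_L2 F G = norm (F - G)"

definition sgn_disk_L2 :: "disk_L2 \<Rightarrow> disk_L2" where
  "sgn_disk_L2 F = inverse (norm F) *\<^sub>R F"

definition uniformity_disk_L2 :: "(disk_L2 \<times> disk_L2) filter" where
  "uniformity_disk_L2 = (INF e\<in>{0<..}. principal {(F, G). dist F G < e})"

definition open_disk_L2 :: "disk_L2 set \<Rightarrow> bool" where
  "open_disk_L2 U \<longleftrightarrow> (\<forall>F\<in>U. eventually (\<lambda>(F', G). F' = F \<longrightarrow> G \<in> U) uniformity)"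

instance
proof
  fix F G H :: disk_L2 and a b r :: real
  show "F + G + H = F + (G + H)"
    by transfer (auto simp: l2_rel_def add.assoc intro!: square_integrable_add)
  show "F + G = G + F"
    by transfer (auto simp: l2_rel_def add.commute intro!: square_integrable_add)
  show "0 + F = F"
    by transfer (auto simp: l2_rel_def)
  show "- F + F = 0"
    unfolding uminus_disk_L2_def
    by transfer (auto simp: l2_rel_def square_integrable_zero)
  show "F - G = F + - G"
    by (rule minus_disk_L2_def)
  show "a *\<^sub>R (F + G) = a *\<^sub>R F + a *\<^sub>R G"
    unfolding scaleR_disk_L2_def
    by transfer (auto simp: l2_rel_def distrib_left intro!: square_integrable_add
        square_integrable_scale)
  show "(a + b) *\<^sub>R F = a *\<^sub>R F + b *\<^sub>R F"
    unfolding scaleR_disk_L2_def of_real_add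
    by transfer (auto simp: l2_rel_def distrib_right intro!: square_integrable_add
        square_integrable_scale)
  show "a *\<^sub>R b *\<^sub>R F = (a * b) *\<^sub>R F"
    unfolding scaleR_disk_L2_def of_real_mult
    by transfer (auto simp: l2_rel_def mult.assoc intro!: square_integrable_scale)
  show "1 *\<^sub>R F = F"
    unfolding scaleR_disk_L2_def of_real_1
    by transfer (auto simp: l2_rel_def)
  show "dist F G = norm (F - G)"
    by (rule dist_disk_L2_def)
  show "sgn F = inverse (norm F) *\<^sub>R F"
    by (rule sgn_disk_L2_def)
  show "uniformity = (INF e\<in>{0<..}. principal {(F :: disk_L2, G). dist F G < e})"
    by (rule uniformity_disk_L2_def)
  show "open U \<longleftrightarrow> (\<forall>F\<in>U. \<forall>\<^sub>F (F', G) in uniformity. F' = F \<longrightarrow> G \<in> U)" for U :: "disk_L2 set"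
    by (rule open_disk_L2_def)
  show "inner F G = inner G F"
  proof -
    have "inner_L2 F G = cnj (inner_L2 G F)"
      by transfer (simp add: mult.commute Bochner_Integration.integral_cnj[symmetric])
    then show ?thesis by (simp add: inner_disk_L2_def)
  qed
  show "inner (F + G) H = inner F H + inner G H"
  proof -
    have "inner_L2 (F + G) H = inner_L2 F H + inner_L2 G H"
      by transfer (simp add: l2_rel_def distrib_right square_integrable_mult_cnj)
    then show ?thesis by (simp add: inner_disk_L2_def)
  qed
  show "inner (r *\<^sub>R F) G = r * inner F G"
  proof -
    have "inner_L2 (scaleC_L2 (of_real r) F) G = of_real r * inner_L2 F G"
      by transfer (simp add: mult.assoc)
    then show ?thesis by (simp add: inner_disk_L2_def scaleR_disk_L2_def)
  qed
  have eq: "f z * cnj (f z) = complex_of_real ((cmod (f z))\<^sup>2)" for f :: "complex \<Rightarrow> complex" and z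
    by (rule complex_norm_square[symmetric])
  show "0 \<le> inner F F"
    unfolding inner_disk_L2_def
    by transfer (simp add: eq del: of_real_power)
  show "inner F F = 0 \<longleftrightarrow> F = 0"
    unfolding inner_disk_L2_def
  proof transfer
    fix f assume "l2_rel f f"
    then have f: "square_integrable f" by (simp add: l2_rel_def)
    then have "Re (LINT z|area. f z * cnj (f z)) = 0 \<longleftrightarrow> (LINT z|area. (cmod (f z))\<^sup>2) = 0"
      by (simp add: eq del: of_real_power)
    also have "\<dots> \<longleftrightarrow> (AE z in area. (cmod (f z))\<^sup>2 = 0)"
      using f by (intro integral_nonneg_eq_0_iff_AE) (auto simp: square_integrable_def)
    also have "\<dots> \<longleftrightarrow> l2_rel f (\<lambda>z. 0)"
      using f by (simp add: l2_rel_def square_integrable_zero)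
    finally show "Re (LINT z|area. f z * cnj (f z)) = 0 \<longleftrightarrow> l2_rel f (\<lambda>z. 0)" .
  qed
  show "norm F = sqrt (inner F F)"
    by (rule norm_disk_L2_def)
qed

end


text \<open>
  An operator is identified with its graph, so that \<open>Domain T\<close> is its domain and
  \<open>S \<subseteq> T\<close> says that \<open>T\<close> extends \<open>S\<close>.
\<close>

type_synonym L2_graph = "(disk_L2 \<times> disk_L2) set"

definition linear_operator :: "L2_graph \<Rightarrow> bool" where
  "linear_operator T \<longleftrightarrow> single_valued T \<and> (0, 0) \<in> T \<and>
     (\<forall>(F, G) \<in> T. \<forall>(F', G') \<in> T. (F + F', G + G') \<in> T) \<and>
     (\<forall>c. \<forall>(F, G) \<in> T. (scaleC_L2 c F, scaleC_L2 c G) \<in> T)"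

definition densely_defined :: "L2_graph \<Rightarrow> bool" where
  "densely_defined T \<longleftrightarrow> closure (Domain T) = UNIV"

definition closable :: "L2_graph \<Rightarrow> bool" where
  "closable T \<longleftrightarrow> (\<exists>S. linear_operator S \<and> closed S \<and> T \<subseteq> S)"

definition bounded_operator :: "L2_graph \<Rightarrow> bool" where
  "bounded_operator T \<longleftrightarrow> (\<exists>C. \<forall>(F, G) \<in> T. norm G \<le> C * norm F)"

definition adjoint_graph :: "L2_graph \<Rightarrow> L2_graph" where
  "adjoint_graph T = {(H, K). \<forall>(F, G) \<in> T. inner_L2 G H = inner_L2 F K}"

definition self_adjoint :: "L2_graph \<Rightarrow> bool" where
  "self_adjoint T \<longleftrightarrow> linear_operator T \<and> densely_defined T \<and> adjoint_graph T = T"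

definition point_spectrum :: "L2_graph \<Rightarrow> complex set" where
  "point_spectrum T = {c. \<exists>F. F \<noteq> 0 \<and> (F, scaleC_L2 c F) \<in> T}"


definition partial_x :: "(complex \<Rightarrow> complex) \<Rightarrow> complex \<Rightarrow> complex" where
  "partial_x f z = frechet_derivative f (at z) 1"

definition partial_y :: "(complex \<Rightarrow> complex) \<Rightarrow> complex \<Rightarrow> complex" where
  "partial_y f z = frechet_derivative f (at z) \<i>"

definition wirtinger :: "(complex \<Rightarrow> complex) \<Rightarrow> complex \<Rightarrow> complex" where
  "wirtinger f z = (partial_x f z - \<i> * partial_y f z) / 2"

definition wirtinger_bar :: "(complex \<Rightarrow> complex) \<Rightarrow> complex \<Rightarrow> complex" where
  "wirtinger_bar f z = (partial_x f z + \<i> * partial_y f z) / 2"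

text \<open>Differentiability is over the reals here: \<open>frechet_derivative\<close> is only real linear.\<close>

primrec Ck :: "nat \<Rightarrow> (complex \<Rightarrow> complex) \<Rightarrow> bool" where
  "Ck 0 f \<longleftrightarrow> continuous_on UNIV f"
| "Ck (Suc k) f \<longleftrightarrow> (\<forall>z. f differentiable (at z)) \<and> Ck k (partial_x f) \<and> Ck k (partial_y f)"

text \<open>Test functions on the disk, extended by zero to the plane.\<close>

definition test_function :: "(complex \<Rightarrow> complex) \<Rightarrow> bool" where
  "test_function \<phi> \<longleftrightarrow> (\<forall>k. Ck k \<phi>) \<and> closure {z. \<phi> z \<noteq> 0} \<subseteq> unit_disk"

text \<open>
  Distributions are functionals on functions, of which only the values at test functions matter.
  Continuity is not imposed: only functionals obtained from \<open>L\<^sup>2\<close> functions by the operations below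
  are ever considered.
\<close>

type_synonym distr = "(complex \<Rightarrow> complex) \<Rightarrow> complex"

text \<open>
  For measurable \<open>\<phi>\<close>, the integral does not depend on the representative chosen by \<open>rep_L2\<close>.
\<close>

definition distr_of :: "disk_L2 \<Rightarrow> distr" where
  "distr_of F \<phi> = (LINT z|area. rep_L2 F z * \<phi> z)"

definition distr_mult :: "(complex \<Rightarrow> complex) \<Rightarrow> distr \<Rightarrow> distr" where
  "distr_mult a T \<phi> = T (\<lambda>z. a z * \<phi> z)"

definition distr_diff :: "distr \<Rightarrow> distr \<Rightarrow> distr" where
  "distr_diff S T \<phi> = S \<phi> - T \<phi>"

definition distr_dz :: "distr \<Rightarrow> distr" where
  "distr_dz T \<phi> = - T (wirtinger \<phi>)"

definition distr_dzbar :: "distr \<Rightarrow> distr" where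
  "distr_dzbar T \<phi> = - T (wirtinger_bar \<phi>)"

definition represents :: "disk_L2 \<Rightarrow> distr \<Rightarrow> bool" where
  "represents G T \<longleftrightarrow> (\<forall>\<phi>. test_function \<phi> \<longrightarrow> distr_of G \<phi> = T \<phi>)"


definition Delta_distr :: "distr \<Rightarrow> distr" where
  "Delta_distr T =
     distr_mult (\<lambda>z. - 4 * (1 - of_real ((cmod z)\<^sup>2)))
       (distr_diff
         (distr_mult (\<lambda>z. 1 - of_real ((cmod z)\<^sup>2)) (distr_dz (distr_dzbar T)))
         (distr_mult (\<lambda>z. 2 * cnj z) (distr_dzbar T)))"

definition Delta_domain :: "disk_L2 set" where
  "Delta_domain = {F. (\<exists>G. represents G (Delta_distr (distr_of F))) \<and>
                      (\<exists>H. represents H (distr_dz (distr_of F)))}"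

definition Delta_tilde :: L2_graph where
  "Delta_tilde = {(F, G). F \<in> Delta_domain \<and> represents G (Delta_distr (distr_of F))}"

end

theory Submission
  imports Defs
begin

text \<open>
  With \<open>\<rho> = 1 - |z|\<^sup>2\<close> the operator is \<open>F \<mapsto> - 4 \<partial>(\<rho>\<^sup>2 \<partial>\<^sub>b F)\<close>, where \<open>\<partial>\<close> and \<open>\<partial>\<^sub>b\<close> are the two Wirtinger
  derivatives. Because \<open>\<rho>\<^sup>2\<close> vanishes to second order on the circle, an element of the maximal
  distributional operator can be tested against every function that is smooth up to the boundary,
  not only against compactly supported ones. On smooth functions \<open>\<Delta>\<close> is nonnegative, and the range of
  \<open>\<Delta> + 8\<close> contains \<open>\<rho>\<^sup>2\<close> times every polynomial in \<open>z\<close> and its conjugate, hence is dense. So smooth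
  functions are a core and the maximal operator is self-adjoint, without any elliptic regularity.
  The given domain is strictly smaller: \<open>exp (1 / (z - 1))\<close> is bounded and holomorphic but its
  derivative is not square integrable, and a self-adjoint operator has no proper self-adjoint
  restriction. Unboundedness is seen on the powers of \<open>\<rho>\<close>, and constants lie in the kernel.
\<close>

section \<open>Wirtinger calculus\<close>

text \<open>Three points carry the weight of the proof. (1) On
  \<open>z ^ a * cnj z ^ b * rho z ^ s\<close> the operator returns the same monomial, its product
  with \<open>rho\<close>, and a monomial of lower degree in z and its conjugate with two more
  factors \<open>rho\<close>. Solving for the middle term is a recursion, and this is what makes the
  range of \<Delta> + 8 computable. (2) The bound 8 |p| \<le> |(\<Delta> + 8) p| is proved on smooth
  p only, where the quadratic form is 4 |rho dbar p|^2. It reaches an arbitrary pair of the maximal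
  operator by duality, pairing F with the dense range. No boundary term appears: every integration
  by parts is translation invariance applied to a C^1 function vanishing off the disk, and the
  square is the first integer power of the weight whose extension by zero is C^1. (3) A hypothetical
  L^2 derivative H of the singular function cannot be compared in L^2 with the classical derivative,
  which does not belong to the space. After multiplication by rho^2 both do, and their difference G
  satisfies (0, G) in the maximal operator, which forces G = 0.\<close>

definition has_wirtinger :: "(complex \<Rightarrow> complex) \<Rightarrow> complex \<Rightarrow> complex \<Rightarrow> complex \<Rightarrow> bool" where
  "has_wirtinger f a b z \<longleftrightarrow> (f has_derivative (\<lambda>h. a * h + b * cnj h)) (at z)"

lemma has_wirtinger_imp:
  assumes "has_wirtinger f a b z"
  shows "partial_x f z = a + b" "partial_y f z = \<i> * (a - b)"
    "wirtinger f z = a" "wirtinger_bar f z = b" "f differentiable (at z)"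
proof -
  have d: "(f has_derivative (\<lambda>h. a * h + b * cnj h)) (at z)"
    using assms by (simp add: has_wirtinger_def)
  then have *: "frechet_derivative f (at z) = (\<lambda>h. a * h + b * cnj h)"
    by (metis frechet_derivative_at)
  show x: "partial_x f z = a + b" and y: "partial_y f z = \<i> * (a - b)"
    unfolding partial_x_def partial_y_def * by (simp_all add: algebra_simps)
  show "wirtinger f z = a" "wirtinger_bar f z = b"
    unfolding wirtinger_def wirtinger_bar_def x y by (simp_all add: algebra_simps)
  show "f differentiable (at z)"
    using d by (auto simp: differentiable_def)
qed

text \<open>A real linear map of the plane is determined by its values at 1 and \<i>, and the maps h
  and cnj h span all such maps over the complex numbers. Hence real differentiability always yields
  a pair of Wirtinger coefficients.\<close>

lemma differentiable_has_wirtinger: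
  assumes "f differentiable (at z)"
  shows "has_wirtinger f (wirtinger f z) (wirtinger_bar f z) z"
proof -
  let ?D = "frechet_derivative f (at z)"
  have d: "(f has_derivative ?D) (at z)"
    using assms by (simp add: frechet_derivative_works)
  then interpret bounded_linear ?D by (rule has_derivative_bounded_linear)
  have "?D h = wirtinger f z * h + wirtinger_bar f z * cnj h" for h
  proof -
    have "h = Re h *\<^sub>R 1 + Im h *\<^sub>R \<i>"
      by (simp add: complex_eq_iff)
    then have "?D h = Re h *\<^sub>R ?D 1 + Im h *\<^sub>R ?D \<i>"
      by (metis add scaleR)
    then show ?thesis
      unfolding wirtinger_def wirtinger_bar_def partial_x_def partial_y_def
      by (simp add: complex_eq_iff algebra_simps add_divide_distrib diff_divide_distrib)
  qed
  then show ?thesis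
    using d unfolding has_wirtinger_def by (metis (no_types, lifting) ext)
qed

lemma has_wirtinger_eq:
  "has_wirtinger f a b z \<Longrightarrow> a = a' \<Longrightarrow> b = b' \<Longrightarrow> has_wirtinger f a' b' z"
  by simp

lemma has_wirtinger_const: "has_wirtinger (\<lambda>z. c) 0 0 z"
  by (simp add: has_wirtinger_def)

lemma has_wirtinger_ident: "has_wirtinger (\<lambda>z. z) 1 0 z"
  by (simp add: has_wirtinger_def)

lemma has_wirtinger_cnj:
  assumes "has_wirtinger f a b z"
  shows "has_wirtinger (\<lambda>z. cnj (f z)) (cnj b) (cnj a) z"
proof -
  have "((\<lambda>z. cnj (f z)) has_derivative (\<lambda>h. cnj (a * h + b * cnj h))) (at z)"
    using assms unfolding has_wirtinger_def by (rule has_derivative_cnj)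
  then show ?thesis
    by (simp add: has_wirtinger_def add.commute)
qed

lemma has_wirtinger_add:
  assumes "has_wirtinger f a b z" "has_wirtinger g a' b' z"
  shows "has_wirtinger (\<lambda>z. f z + g z) (a + a') (b + b') z"
proof -
  have "((\<lambda>z. f z + g z) has_derivative (\<lambda>h. (a * h + b * cnj h) + (a' * h + b' * cnj h))) (at z)"
    using assms unfolding has_wirtinger_def by (rule has_derivative_add)
  then show ?thesis
    by (simp add: has_wirtinger_def algebra_simps)
qed

lemma has_wirtinger_mult:
  assumes "has_wirtinger f a b z" "has_wirtinger g a' b' z"
  shows "has_wirtinger (\<lambda>z. f z * g z) (a * g z + f z * a') (b * g z + f z * b') z"
proof -
  have "((\<lambda>z. f z * g z) has_derivative
      (\<lambda>h. f z * (a' * h + b' * cnj h) + (a * h + b * cnj h) * g z)) (at z)"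
    using assms unfolding has_wirtinger_def by (rule has_derivative_mult)
  then show ?thesis
    by (simp add: has_wirtinger_def algebra_simps)
qed

lemma has_wirtinger_cmult:
  "has_wirtinger f a b z \<Longrightarrow> has_wirtinger (\<lambda>z. c * f z) (c * a) (c * b) z"
  using has_wirtinger_mult[OF has_wirtinger_const[of c z]] by (auto intro: has_wirtinger_eq)

lemma has_wirtinger_diff:
  assumes "has_wirtinger f a b z" "has_wirtinger g a' b' z"
  shows "has_wirtinger (\<lambda>z. f z - g z) (a - a') (b - b') z"
  using has_wirtinger_add[OF assms(1) has_wirtinger_cmult[OF assms(2), of "-1"]] by simp

lemma has_wirtinger_power:
  assumes "has_wirtinger f a b z"
  shows "has_wirtinger (\<lambda>z. f z ^ n) (of_nat n * f z ^ (n - 1) * a) (of_nat n * f z ^ (n - 1) * b) z"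
proof (induction n)
  case 0
  then show ?case by (simp add: has_wirtinger_const)
next
  case (Suc n)
  have e: "of_nat n * f z ^ (n - 1) * f z = of_nat n * f z ^ n"
    by (cases n) auto
  show ?case
    unfolding power_Suc
  proof (rule has_wirtinger_eq[OF has_wirtinger_mult[OF assms Suc.IH]])
    have "a * f z ^ n + f z * (of_nat n * f z ^ (n - 1) * a)
        = a * f z ^ n + (of_nat n * f z ^ (n - 1) * f z) * a" by (simp only: mult_ac)
    then show "a * f z ^ n + f z * (of_nat n * f z ^ (n - 1) * a) = of_nat (Suc n) * f z ^ (Suc n - 1) * a"
      unfolding e by (simp add: algebra_simps)
    have "b * f z ^ n + f z * (of_nat n * f z ^ (n - 1) * b)
        = b * f z ^ n + (of_nat n * f z ^ (n - 1) * f z) * b" by (simp only: mult_ac)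
    then show "b * f z ^ n + f z * (of_nat n * f z ^ (n - 1) * b) = of_nat (Suc n) * f z ^ (Suc n - 1) * b"
      unfolding e by (simp add: algebra_simps)
  qed
qed

lemma has_wirtinger_real_chain:
  assumes "(g has_real_derivative d) (at (u z))" "has_wirtinger (\<lambda>z. complex_of_real (u z)) a b z"
  shows "has_wirtinger (\<lambda>z. complex_of_real (g (u z))) (of_real d * a) (of_real d * b) z"
proof -
  have "((\<lambda>z. Re (complex_of_real (u z))) has_derivative (\<lambda>h. Re (a * h + b * cnj h))) (at z)"
    using assms(2) unfolding has_wirtinger_def by (rule has_derivative_Re)
  then have u: "(u has_derivative (\<lambda>h. Re (a * h + b * cnj h))) (at z)" by simp
  have "((\<lambda>z. complex_of_real (u z)) has_derivative (\<lambda>h. complex_of_real (Re (a * h + b * cnj h)))) (at z)"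
    using u by (rule has_derivative_of_real)
  moreover have "((\<lambda>z. complex_of_real (u z)) has_derivative (\<lambda>h. a * h + b * cnj h)) (at z)"
    using assms(2) unfolding has_wirtinger_def .
  \<comment> \<open>Since u is real valued, uniqueness of the derivative forces the form a h + b cnj
    h to be real. This is what allows a real derivative of g to be multiplied in.\<close>
  ultimately have re: "complex_of_real (Re (a * h + b * cnj h)) = a * h + b * cnj h" for h
    using has_derivative_unique by (metis (no_types, lifting))
  have "(g has_derivative (\<lambda>h. d * h)) (at (u z))"
    using assms(1) by (simp add: has_field_derivative_def)
  then have "((\<lambda>z. g (u z)) has_derivative (\<lambda>h. d * Re (a * h + b * cnj h))) (at z)"
    using u has_derivative_compose by blast
  then have "((\<lambda>z. complex_of_real (g (u z))) has_derivative
      (\<lambda>h. complex_of_real (d * Re (a * h + b * cnj h)))) (at z)"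
    by (rule has_derivative_of_real)
  then show ?thesis
    unfolding has_wirtinger_def of_real_mult re by (simp add: algebra_simps)
qed

section \<open>Smoothness in terms of Wirtinger derivatives\<close>

lemma Ck_0_of_Ck: "Ck k f \<Longrightarrow> continuous_on UNIV f"
  by (cases k) (auto intro: differentiable_imp_continuous_within simp: continuous_on_eq_continuous_within)

lemma Ck_Suc_imp: "Ck (Suc k) f \<Longrightarrow> Ck k f"
proof (induction k arbitrary: f)
  case 0
  show ?case using Ck_0_of_Ck[OF 0] by simp
next
  case (Suc k)
  from Suc.prems have d: "\<forall>z. f differentiable (at z)"
    and "Ck (Suc k) (partial_x f)" "Ck (Suc k) (partial_y f)"
    unfolding Ck.simps(2)[of "Suc k"] by blast+
  then have "Ck k (partial_x f)" "Ck k (partial_y f)"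
    using Suc.IH by blast+
  with d show ?case by (simp only: Ck.simps(2) simp_thms)
qed

lemma Ck_const: "Ck k (\<lambda>z. c)"
proof (induction k arbitrary: c)
  case (Suc k)
  have "partial_x (\<lambda>z. c) = (\<lambda>z. 0)" "partial_y (\<lambda>z. c) = (\<lambda>z. 0)"
    using has_wirtinger_imp[OF has_wirtinger_const] by auto
  with Suc show ?case by simp
qed simp

lemma partial_add:
  assumes "\<And>z. f differentiable (at z)" "\<And>z. g differentiable (at z)"
  shows "partial_x (\<lambda>z. f z + g z) = (\<lambda>z. partial_x f z + partial_x g z)"
    "partial_y (\<lambda>z. f z + g z) = (\<lambda>z. partial_y f z + partial_y g z)"
proof -
  have f: "has_wirtinger f (wirtinger f z) (wirtinger_bar f z) z"
    and g: "has_wirtinger g (wirtinger g z) (wirtinger_bar g z) z" for z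
    using assms by (auto intro: differentiable_has_wirtinger)
  note fg = has_wirtinger_add[OF f g]
  show "partial_x (\<lambda>z. f z + g z) = (\<lambda>z. partial_x f z + partial_x g z)"
    "partial_y (\<lambda>z. f z + g z) = (\<lambda>z. partial_y f z + partial_y g z)"
    unfolding has_wirtinger_imp(1)[OF f] has_wirtinger_imp(1)[OF g] has_wirtinger_imp(1)[OF fg]
      has_wirtinger_imp(2)[OF f] has_wirtinger_imp(2)[OF g] has_wirtinger_imp(2)[OF fg]
    by (auto simp: algebra_simps)
qed

lemma partial_mult:
  assumes "\<And>z. f differentiable (at z)" "\<And>z. g differentiable (at z)"
  shows "partial_x (\<lambda>z. f z * g z) = (\<lambda>z. partial_x f z * g z + f z * partial_x g z)"
    "partial_y (\<lambda>z. f z * g z) = (\<lambda>z. partial_y f z * g z + f z * partial_y g z)"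
proof -
  have f: "has_wirtinger f (wirtinger f z) (wirtinger_bar f z) z"
    and g: "has_wirtinger g (wirtinger g z) (wirtinger_bar g z) z" for z
    using assms by (auto intro: differentiable_has_wirtinger)
  note fg = has_wirtinger_mult[OF f g]
  show "partial_x (\<lambda>z. f z * g z) = (\<lambda>z. partial_x f z * g z + f z * partial_x g z)"
    "partial_y (\<lambda>z. f z * g z) = (\<lambda>z. partial_y f z * g z + f z * partial_y g z)"
    unfolding has_wirtinger_imp(1)[OF f] has_wirtinger_imp(1)[OF g] has_wirtinger_imp(1)[OF fg]
      has_wirtinger_imp(2)[OF f] has_wirtinger_imp(2)[OF g] has_wirtinger_imp(2)[OF fg]
    by (auto simp: algebra_simps)
qed

lemma Ck_add: "Ck k f \<Longrightarrow> Ck k g \<Longrightarrow> Ck k (\<lambda>z. f z + g z)"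
proof (induction k arbitrary: f g)
  case 0
  then show ?case by (auto intro: continuous_intros)
next
  case (Suc k)
  then show ?case by (auto simp: partial_add)
qed

lemma Ck_mult: "Ck k f \<Longrightarrow> Ck k g \<Longrightarrow> Ck k (\<lambda>z. f z * g z)"
proof (induction k arbitrary: f g)
  case 0
  then show ?case by (auto intro: continuous_intros)
next
  case (Suc k)
  have d: "Ck k f" "Ck k g" using Suc.prems by (auto intro: Ck_Suc_imp simp del: Ck.simps)
  show ?case using Suc d by (auto simp: partial_mult intro!: Ck_add)
qed

lemma Ck_SucI:
  assumes "\<And>z. has_wirtinger f (a z) (b z) z" "Ck k a" "Ck k b"
  shows "Ck (Suc k) f"
proof -
  have x: "partial_x f = (\<lambda>z. a z + b z)" and y: "partial_y f = (\<lambda>z. \<i> * (a z + (-1) * b z))"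
    using has_wirtinger_imp(1,2)[OF assms(1)] by auto
  show ?thesis
    using assms has_wirtinger_imp(5)[OF assms(1)]
    by (simp only: Ck.simps x y) (intro conjI allI Ck_add Ck_mult Ck_const; simp)
qed

lemma Ck_SucD:
  assumes "Ck (Suc k) f"
  shows "has_wirtinger f (wirtinger f z) (wirtinger_bar f z) z" "Ck k (wirtinger f)"
    "Ck k (wirtinger_bar f)"
proof -
  show "has_wirtinger f (wirtinger f z) (wirtinger_bar f z) z"
    using assms by (auto intro: differentiable_has_wirtinger)
  have "Ck k (\<lambda>z. (1/2) * (partial_x f z + (-\<i>) * partial_y f z))"
    "Ck k (\<lambda>z. (1/2) * (partial_x f z + \<i> * partial_y f z))"
    using assms by (intro Ck_mult Ck_add Ck_const; simp)+
  moreover have "wirtinger f = (\<lambda>z. (1/2) * (partial_x f z + (-\<i>) * partial_y f z))"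
    "wirtinger_bar f = (\<lambda>z. (1/2) * (partial_x f z + \<i> * partial_y f z))"
    by (auto simp: wirtinger_def wirtinger_bar_def)
  ultimately show "Ck k (wirtinger f)" "Ck k (wirtinger_bar f)" by simp_all
qed

definition smooth :: "(complex \<Rightarrow> complex) \<Rightarrow> bool" where
  "smooth f \<longleftrightarrow> (\<forall>k. Ck k f)"

lemma smooth_const: "smooth (\<lambda>z. c)"
  and smooth_add: "smooth f \<Longrightarrow> smooth g \<Longrightarrow> smooth (\<lambda>z. f z + g z)"
  and smooth_mult: "smooth f \<Longrightarrow> smooth g \<Longrightarrow> smooth (\<lambda>z. f z * g z)"
  by (auto simp: smooth_def intro: Ck_const Ck_add Ck_mult)

lemma smooth_cmult: "smooth f \<Longrightarrow> smooth (\<lambda>z. c * f z)"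
  by (intro smooth_mult smooth_const)

lemma smooth_has_wirtinger: "smooth f \<Longrightarrow> has_wirtinger f (wirtinger f z) (wirtinger_bar f z) z"
  unfolding smooth_def by (metis Ck_SucD(1))

lemma smooth_wirtinger: "smooth f \<Longrightarrow> smooth (wirtinger f)"
  and smooth_wirtinger_bar: "smooth f \<Longrightarrow> smooth (wirtinger_bar f)"
  unfolding smooth_def by (metis Ck_SucD(2), metis Ck_SucD(3))

lemma smooth_continuous: "smooth f \<Longrightarrow> continuous_on A f"
  unfolding smooth_def by (metis Ck_0_of_Ck continuous_on_subset subset_UNIV)

lemma smooth_power: "smooth f \<Longrightarrow> smooth (\<lambda>z. f z ^ n)"
  by (induction n) (auto intro: smooth_mult smooth_const)

text \<open>Order k + 1 follows from order k of both coefficients, and the extra order is then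
  dropped. This replaces an induction over iterated partial derivatives in applications.\<close>

lemma smoothI:
  assumes "\<And>z. has_wirtinger f (a z) (b z) z" "smooth a" "smooth b"
  shows "smooth f"
  unfolding smooth_def
proof
  fix k
  show "Ck k f"
    by (rule Ck_Suc_imp, rule Ck_SucI[OF assms(1)]) (use assms in \<open>auto simp: smooth_def\<close>)
qed

lemma smooth_ident: "smooth (\<lambda>z. z)"
  by (rule smoothI[OF has_wirtinger_ident smooth_const smooth_const])

lemma Ck_cnj: "Ck k f \<Longrightarrow> Ck k (\<lambda>z. cnj (f z))"
proof (induction k arbitrary: f)
  case 0
  then show ?case by (auto intro: continuous_intros)
next
  case (Suc k)
  show ?case
    by (rule Ck_SucI[OF has_wirtinger_cnj[OF Ck_SucD(1)[OF Suc.prems]]])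
       (intro Suc.IH Ck_SucD[OF Suc.prems])+
qed

lemma smooth_cnj: "smooth f \<Longrightarrow> smooth (\<lambda>z. cnj (f z))"
  by (auto simp: smooth_def Ck_cnj)

section \<open>The weight and the formal operator in divergence form\<close>

definition rho :: "complex \<Rightarrow> complex" where
  "rho z = 1 - z * cnj z"

lemma rho_of_real: "rho z = of_real (1 - (cmod z)\<^sup>2)"
  using complex_norm_square[of z] by (simp add: rho_def)

lemma cnj_rho [simp]: "cnj (rho z) = rho z"
  by (simp add: rho_def mult.commute)

lemma has_wirtinger_rho: "has_wirtinger rho (- cnj z) (- z) z"
  unfolding rho_def[abs_def]
  by (rule has_wirtinger_eq[OF has_wirtinger_diff[OF has_wirtinger_const
        has_wirtinger_mult[OF has_wirtinger_ident has_wirtinger_cnj[OF has_wirtinger_ident]]]]) auto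

lemma smooth_rho: "smooth rho"
proof (rule smoothI[OF has_wirtinger_rho])
  show "smooth (\<lambda>z. - cnj z)" "smooth (\<lambda>z. - z)"
    using smooth_cmult[OF smooth_cnj[OF smooth_ident], of "-1"] smooth_cmult[OF smooth_ident, of "-1"]
    by simp_all
qed

lemma has_wirtinger_rho_power2: "has_wirtinger (\<lambda>z. (rho z)\<^sup>2) (- 2 * rho z * cnj z) (- 2 * rho z * z) z"
  by (rule has_wirtinger_eq[OF has_wirtinger_power[OF has_wirtinger_rho]]) auto

text \<open>As the z derivative of rho^2 is - 2 rho cnj z, expanding the product gives the second
  and first order terms of the given operator together.\<close>

definition Delta :: "(complex \<Rightarrow> complex) \<Rightarrow> complex \<Rightarrow> complex" where
  "Delta f z = - 4 * wirtinger (\<lambda>z. (rho z)\<^sup>2 * wirtinger_bar f z) z"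

text \<open>This is the transpose for the bilinear pairing of f and g by the integral of f g,
  without conjugation: two integrations by parts exchange the order of the two derivatives and leave
  the sign unchanged.\<close>

definition Delta_transpose :: "(complex \<Rightarrow> complex) \<Rightarrow> complex \<Rightarrow> complex" where
  "Delta_transpose f z = - 4 * wirtinger_bar (\<lambda>z. (rho z)\<^sup>2 * wirtinger f z) z"

lemma smooth_Delta: "smooth f \<Longrightarrow> smooth (Delta f)"
  unfolding Delta_def[abs_def]
  by (intro smooth_cmult smooth_wirtinger smooth_mult smooth_power smooth_rho smooth_wirtinger_bar)

lemma smooth_Delta_transpose: "smooth f \<Longrightarrow> smooth (Delta_transpose f)"
  unfolding Delta_transpose_def[abs_def]
  by (intro smooth_cmult smooth_wirtinger smooth_mult smooth_power smooth_rho smooth_wirtinger_bar)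

lemma wirtinger_cnj:
  assumes "smooth f"
  shows "wirtinger (\<lambda>z. cnj (f z)) = (\<lambda>z. cnj (wirtinger_bar f z))"
    "wirtinger_bar (\<lambda>z. cnj (f z)) = (\<lambda>z. cnj (wirtinger f z))"
  using has_wirtinger_imp(3,4)[OF has_wirtinger_cnj[OF smooth_has_wirtinger[OF assms]]] by auto

text \<open>Conjugation exchanges the two Wirtinger derivatives and fixes \<open>rho\<close>. So the
  transpose for the bilinear pairing becomes \<open>Delta\<close> itself for the inner product,
  which is the formal symmetry of the operator.\<close>

lemma Delta_transpose_cnj:
  assumes "smooth f"
  shows "Delta_transpose (\<lambda>z. cnj (f z)) z = cnj (Delta f z)"
proof -
  have "smooth (\<lambda>z. (rho z)\<^sup>2 * wirtinger_bar f z)"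
    using assms by (intro smooth_mult smooth_power smooth_rho smooth_wirtinger_bar)
  from wirtinger_cnj(2)[OF this] show ?thesis
    unfolding Delta_transpose_def Delta_def wirtinger_cnj(1)[OF assms] by simp
qed

lemma wirtinger_add:
  assumes "smooth f" "smooth g"
  shows "wirtinger (\<lambda>z. f z + g z) = (\<lambda>z. wirtinger f z + wirtinger g z)"
    "wirtinger_bar (\<lambda>z. f z + g z) = (\<lambda>z. wirtinger_bar f z + wirtinger_bar g z)"
  using has_wirtinger_imp(3,4)[OF has_wirtinger_add[OF assms[THEN smooth_has_wirtinger]]] by auto

lemma wirtinger_cmult:
  assumes "smooth f"
  shows "wirtinger (\<lambda>z. c * f z) = (\<lambda>z. c * wirtinger f z)"
    "wirtinger_bar (\<lambda>z. c * f z) = (\<lambda>z. c * wirtinger_bar f z)"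
  using has_wirtinger_imp(3,4)[OF has_wirtinger_cmult[OF smooth_has_wirtinger[OF assms]]] by auto

lemma Delta_add:
  assumes "smooth f" "smooth g"
  shows "Delta (\<lambda>z. f z + g z) z = Delta f z + Delta g z"
proof -
  have *: "smooth (\<lambda>z. (rho z)\<^sup>2 * wirtinger_bar h z)" if "smooth h" for h
    using that by (intro smooth_mult smooth_power smooth_rho smooth_wirtinger_bar)
  show ?thesis
    unfolding Delta_def wirtinger_add(2)[OF assms] distrib_left
    by (simp add: wirtinger_add(1)[OF assms[THEN *]] distrib_left)
qed

lemma Delta_cmult:
  assumes "smooth f"
  shows "Delta (\<lambda>z. c * f z) z = c * Delta f z"
proof -
  have *: "smooth (\<lambda>z. (rho z)\<^sup>2 * wirtinger_bar f z)"
    using assms by (intro smooth_mult smooth_power smooth_rho smooth_wirtinger_bar)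
  have "(\<lambda>z. (rho z)\<^sup>2 * (c * wirtinger_bar f z)) = (\<lambda>z. c * ((rho z)\<^sup>2 * wirtinger_bar f z))"
    by (simp add: mult_ac)
  then show ?thesis
    unfolding Delta_def wirtinger_cmult(2)[OF assms] by (simp add: wirtinger_cmult(1)[OF *])
qed

section \<open>The Hilbert space\<close>

lemma disk_in_sets: "unit_disk \<inter> space lborel \<in> sets lborel"
  by simp

lemma space_area [simp]: "space area = unit_disk"
  by (simp add: area_def space_restrict_space)

lemma measurable_area: "f \<in> borel_measurable borel \<Longrightarrow> f \<in> borel_measurable area"
  unfolding area_def by (rule measurable_restrict_space1) simp

lemma finite_measure_area: "finite_measure area"
proof (rule finite_measureI)
  have "emeasure lborel unit_disk < \<infinity>"
    by (intro emeasure_bounded_finite bounded_ball)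
  then show "emeasure area (space area) \<noteq> \<infinity>"
    by (simp add: area_def emeasure_restrict_space space_restrict_space)
qed

interpretation area: finite_measure area
  by (rule finite_measure_area)

lemma integral_area:
  fixes f :: "complex \<Rightarrow> 'b::{banach, second_countable_topology}"
  shows "integral\<^sup>L area f = (LINT z|lborel. indicator unit_disk z *\<^sub>R f z)"
  unfolding area_def by (rule integral_restrict_space[OF disk_in_sets])

lemma AE_area_iff: "(AE z in area. P z) \<longleftrightarrow> (AE z in lborel. z \<in> unit_disk \<longrightarrow> P z)"
  unfolding area_def by (rule AE_restrict_space_iff[OF disk_in_sets])

lemma square_integrable_bounded:
  assumes "f \<in> borel_measurable area" "\<And>z. z \<in> unit_disk \<Longrightarrow> cmod (f z) \<le> B"
  shows "square_integrable f"
proof -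
  have [measurable]: "f \<in> borel_measurable area" by fact
  have "integrable area (\<lambda>z. (cmod (f z))\<^sup>2)"
  proof (rule area.integrable_const_bound[where B = "B\<^sup>2"])
    show "AE z in area. norm ((cmod (f z))\<^sup>2) \<le> B\<^sup>2"
      using assms(2) by (intro AE_I2) (auto intro!: power_mono)
  qed measurable
  then show ?thesis by (simp add: square_integrable_def)
qed

lemma continuous_bounded_on_disk:
  fixes f :: "complex \<Rightarrow> complex"
  assumes "continuous_on UNIV f"
  obtains B where "\<And>z. z \<in> unit_disk \<Longrightarrow> cmod (f z) \<le> B"
proof -
  have "compact (f ` cball 0 1)"
    by (intro compact_continuous_image continuous_on_subset[OF assms]) auto
  then obtain B where "\<forall>x\<in>f ` cball 0 1. norm x \<le> B"
    using compact_imp_bounded bounded_iff by blast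
  then show thesis by (intro that[of B]) (auto simp: dist_norm)
qed

lemma square_integrable_continuous:
  assumes "continuous_on UNIV f"
  shows "square_integrable f"
proof -
  obtain B where "\<And>z. z \<in> unit_disk \<Longrightarrow> cmod (f z) \<le> B"
    using continuous_bounded_on_disk[OF assms] by blast
  with assms show ?thesis
    by (intro square_integrable_bounded measurable_area borel_measurable_continuous_onI)
qed

lemma square_integrable_smooth: "smooth f \<Longrightarrow> square_integrable f"
  by (intro square_integrable_continuous smooth_continuous)

lemma square_integrable_cnj: "square_integrable f \<Longrightarrow> square_integrable (\<lambda>z. cnj (f z))"
proof -
  assume f: "square_integrable f"
  have [measurable]: "cnj \<in> borel_measurable borel"
    by (intro borel_measurable_continuous_onI continuous_intros)
  have [measurable]: "f \<in> borel_measurable area"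
    using f by (simp add: square_integrable_def)
  have "(\<lambda>z. cnj (f z)) \<in> borel_measurable area" by measurable
  with f show ?thesis by (simp add: square_integrable_def)
qed

lemma square_integrable_diff:
  assumes "square_integrable f" "square_integrable g"
  shows "square_integrable (\<lambda>z. f z - g z)"
  using square_integrable_add[OF assms(1) square_integrable_scale[OF assms(2), of "-1"]] by simp

lemma square_integrable_rep: "square_integrable (rep_L2 F)"
  using Quotient3_rep_reflp[OF Quotient3_disk_L2, of F] by (auto simp: l2_rel_def)

lemma abs_L2_rep: "abs_L2 (rep_L2 F) = F"
  by (rule Quotient3_abs_rep[OF Quotient3_disk_L2])

lemma l2_rel_refl: "square_integrable f \<Longrightarrow> l2_rel f f"
  by (simp add: l2_rel_def)

lemma abs_L2_eq_iff:
  assumes "square_integrable f" "square_integrable g"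
  shows "abs_L2 f = abs_L2 g \<longleftrightarrow> (AE z in area. f z = g z)"
  using Quotient3_rel_abs[OF Quotient3_disk_L2, of f g] Quotient3_rel[OF Quotient3_disk_L2, of f g] assms
  by (auto simp: l2_rel_def)

lemma inner_L2_abs:
  assumes "square_integrable f" "square_integrable g"
  shows "inner_L2 (abs_L2 f) (abs_L2 g) = (LINT z|area. f z * cnj (g z))"
  using assms by (simp add: inner_L2.abs_eq l2_rel_refl)

lemma plus_abs:
  "square_integrable f \<Longrightarrow> square_integrable g \<Longrightarrow> abs_L2 f + abs_L2 g = abs_L2 (\<lambda>z. f z + g z)"
  by (simp add: plus_disk_L2.abs_eq l2_rel_refl)

lemma scaleC_abs: "square_integrable f \<Longrightarrow> scaleC_L2 c (abs_L2 f) = abs_L2 (\<lambda>z. c * f z)"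
  by (simp add: scaleC_L2.abs_eq l2_rel_refl)

lemma zero_abs: "0 = abs_L2 (\<lambda>z. 0)"
  by (simp add: zero_disk_L2.abs_eq)

lemma minus_abs:
  "square_integrable f \<Longrightarrow> square_integrable g \<Longrightarrow> abs_L2 f - abs_L2 g = abs_L2 (\<lambda>z. f z - g z)"
  using plus_abs[OF _ square_integrable_scale, of f g "-1"]
  by (simp add: minus_disk_L2_def uminus_disk_L2_def scaleC_abs)

lemma scaleR_eq_scaleC: "r *\<^sub>R F = scaleC_L2 (of_real r) F"
  by (rule scaleR_disk_L2_def)

lemma minus_eq_scaleC: "- F = scaleC_L2 (- 1) F"
  by (rule uminus_disk_L2_def)

lemma inner_L2_add_left: "inner_L2 (F + G) H = inner_L2 F H + inner_L2 G H"
  by transfer (simp add: l2_rel_def distrib_right square_integrable_mult_cnj)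

lemma inner_L2_scaleC_left: "inner_L2 (scaleC_L2 c F) H = c * inner_L2 F H"
  by transfer (simp add: mult.assoc)

lemma cnj_inner_L2: "cnj (inner_L2 F G) = inner_L2 G F"
  by transfer (simp add: mult.commute Bochner_Integration.integral_cnj[symmetric])

lemma inner_L2_add_right: "inner_L2 H (F + G) = inner_L2 H F + inner_L2 H G"
  by (metis cnj_inner_L2 complex_cnj_add inner_L2_add_left)

lemma inner_L2_scaleC_right: "inner_L2 H (scaleC_L2 c F) = cnj c * inner_L2 H F"
  by (metis cnj_inner_L2 complex_cnj_mult inner_L2_scaleC_left)

text \<open>The real inner product recovers the complex one, so continuity of
  \<open>inner_L2\<close> is inherited from the real inner product space.\<close>

lemma inner_L2_eq_inner:
  "inner_L2 F G = Complex (inner F G) (inner F (scaleC_L2 \<i> G))"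
  by (simp add: inner_disk_L2_def inner_L2_scaleC_right complex_eq_iff)

lemma tendsto_inner_L2_left:
  assumes "(f \<longlongrightarrow> F) A"
  shows "((\<lambda>n. inner_L2 (f n) G) \<longlongrightarrow> inner_L2 F G) A"
  unfolding inner_L2_eq_inner by (intro tendsto_Complex tendsto_inner assms tendsto_const)

lemma continuous_on_inner_L2_left: "continuous_on A (\<lambda>F. inner_L2 F G)"
  unfolding continuous_on_def by (intro ballI tendsto_inner_L2_left tendsto_ident_at)

lemma norm_abs:
  assumes "square_integrable f"
  shows "(norm (abs_L2 f))\<^sup>2 = (LINT z|area. (cmod (f z))\<^sup>2)"
proof -
  have eq: "f z * cnj (f z) = complex_of_real ((cmod (f z))\<^sup>2)" for z
    by (rule complex_norm_square[symmetric])
  have "(norm (abs_L2 f))\<^sup>2 = Re (inner_L2 (abs_L2 f) (abs_L2 f))"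
    by (simp add: power2_norm_eq_inner inner_disk_L2_def)
  also have "\<dots> = (LINT z|area. (cmod (f z))\<^sup>2)"
    unfolding inner_L2_abs[OF assms assms] eq by (simp del: of_real_power)
  finally show ?thesis .
qed

lemma norm_scaleC_L2: "norm (scaleC_L2 c F) = cmod c * norm F"
proof -
  have "(norm (scaleC_L2 c F))\<^sup>2 = (cmod c * norm F)\<^sup>2"
  proof -
    have "(norm (scaleC_L2 c F))\<^sup>2 = Re (c * cnj c * inner_L2 F F)"
      by (simp add: power2_norm_eq_inner inner_disk_L2_def inner_L2_scaleC_left inner_L2_scaleC_right mult_ac)
    also have "c * cnj c = of_real ((cmod c)\<^sup>2)"
      by (simp only: complex_norm_square)
    finally show ?thesis
      by (simp add: power_mult_distrib power2_norm_eq_inner inner_disk_L2_def del: of_real_power)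
  qed
  then show ?thesis by (simp add: power2_eq_iff_nonneg)
qed

text \<open>Dominated convergence in the mean square. Both f n and its limit are dominated by h,
  hence the squared difference by 4 |h|^2, which is integrable.\<close>

lemma abs_L2_tendsto:
  assumes f: "\<And>n. f n \<in> borel_measurable area" and g: "g \<in> borel_measurable area"
    and h: "square_integrable h"
    and lim: "AE z in area. (\<lambda>n. f n z) \<longlonglongrightarrow> g z"
    and bound: "\<And>n. AE z in area. cmod (f n z) \<le> cmod (h z)"
  shows "\<And>n. square_integrable (f n)" "square_integrable g" "(\<lambda>n. abs_L2 (f n)) \<longlonglongrightarrow> abs_L2 g"
proof -
  have [measurable]: "h \<in> borel_measurable area" "\<And>n. f n \<in> borel_measurable area"
      "g \<in> borel_measurable area"
    and hi: "integrable area (\<lambda>z. (cmod (h z))\<^sup>2)"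
    using h f g by (auto simp: square_integrable_def)
  have si: "square_integrable k" if "k \<in> borel_measurable area" "AE z in area. cmod (k z) \<le> cmod (h z)" for k
  proof -
    have [measurable]: "k \<in> borel_measurable area" by fact
    have "integrable area (\<lambda>z. (cmod (k z))\<^sup>2)"
      using that(2) by (intro Bochner_Integration.integrable_bound[OF hi]) (auto elim!: eventually_mono intro!: power_mono)
    then show ?thesis by (simp add: square_integrable_def)
  qed
  show sf: "square_integrable (f n)" for n by (intro si f bound)
  have gb: "AE z in area. cmod (g z) \<le> cmod (h z)"
  proof -
    have "AE z in area. \<forall>n. cmod (f n z) \<le> cmod (h z)"
      using bound by (simp add: AE_all_countable)
    with lim show ?thesis
    proof eventually_elim
      case (elim z)
      show ?case
        by (rule LIMSEQ_le_const2[OF tendsto_norm[OF elim(1)]]) (use elim(2) in auto)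
    qed
  qed
  then show sg: "square_integrable g" by (intro si g)
  have "(\<lambda>n. LINT z|area. (cmod (f n z - g z))\<^sup>2) \<longlonglongrightarrow> (LINT z|area. 0)"
  proof (rule integral_dominated_convergence[where w = "\<lambda>z. 4 * (cmod (h z))\<^sup>2"])
    show "AE z in area. (\<lambda>n. (cmod (f n z - g z))\<^sup>2) \<longlonglongrightarrow> 0"
      using lim
    proof eventually_elim
      case (elim z)
      then have "(\<lambda>n. cmod (f n z - g z)) \<longlonglongrightarrow> 0"
        by (simp add: LIM_zero tendsto_norm_zero)
      then show ?case by (auto intro: tendsto_eq_intros)
    qed
    show "AE z in area. norm ((cmod (f n z - g z))\<^sup>2) \<le> 4 * (cmod (h z))\<^sup>2" for n
      using bound[of n] gb
    proof eventually_elim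
      case (elim z)
      then have "cmod (f n z - g z) \<le> 2 * cmod (h z)"
        using norm_triangle_ineq4[of "f n z" "g z"] by linarith
      then have "(cmod (f n z - g z))\<^sup>2 \<le> (2 * cmod (h z))\<^sup>2"
        by (intro power_mono) auto
      then show ?case by (simp add: power_mult_distrib)
    qed
  qed (use hi in auto)
  then have "(\<lambda>n. (norm (abs_L2 (f n) - abs_L2 g))\<^sup>2) \<longlonglongrightarrow> 0"
    by (simp add: minus_abs sf sg norm_abs square_integrable_diff)
  then have "(\<lambda>n. sqrt ((norm (abs_L2 (f n) - abs_L2 g))\<^sup>2)) \<longlonglongrightarrow> sqrt 0"
    by (rule tendsto_real_sqrt)
  then show "(\<lambda>n. abs_L2 (f n)) \<longlonglongrightarrow> abs_L2 g"
    by (simp add: tendsto_iff dist_norm)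
qed

text \<open>The distributional pairing is bilinear and the inner product is conjugate linear in its
  second argument, so the test function enters conjugated. This form is independent of the chosen
  representative and makes linearity in F visible.\<close>

lemma distr_of_eq_inner:
  assumes "square_integrable \<phi>"
  shows "distr_of F \<phi> = inner_L2 F (abs_L2 (\<lambda>z. cnj (\<phi> z)))"
  using inner_L2_abs[OF square_integrable_rep[of F] square_integrable_cnj[OF assms]]
  by (simp add: abs_L2_rep distr_of_def)

lemma distr_of_abs:
  assumes "square_integrable f" "square_integrable \<phi>"
  shows "distr_of (abs_L2 f) \<phi> = (LINT z|area. f z * \<phi> z)"
  by (simp add: distr_of_eq_inner assms inner_L2_abs square_integrable_cnj)

lemma distr_of_add:
  assumes "square_integrable \<phi>" "square_integrable \<psi>"
  shows "distr_of F (\<lambda>z. \<phi> z + \<psi> z) = distr_of F \<phi> + distr_of F \<psi>"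
  using assms
  by (simp add: distr_of_eq_inner square_integrable_add flip: plus_abs inner_L2_add_right
      add: square_integrable_cnj)

lemma distr_of_cmult: "distr_of F (\<lambda>z. c * \<phi> z) = c * distr_of F \<phi>"
  by (simp add: distr_of_def mult.left_commute)

text \<open>
  \<open>Delta_distr\<close> is given with a separate first order term, which \<open>Delta_transpose\<close> absorbs by
  putting the weight inside the derivative.
\<close>

lemma Delta_distr_eq:
  assumes "smooth \<phi>"
  shows "Delta_distr (distr_of F) \<phi> = distr_of F (Delta_transpose \<phi>)"
proof -
  note hw = has_wirtinger_mult has_wirtinger_cmult has_wirtinger_rho has_wirtinger_cnj
    has_wirtinger_ident smooth_has_wirtinger[OF assms]
  have r: "(1 - of_real ((cmod z)\<^sup>2)) = rho z" for z
    by (simp add: rho_of_real)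
  have f1: "wirtinger (\<lambda>z. rho z * (- 4 * rho z * \<phi> z))
      = (\<lambda>z. 8 * cnj z * rho z * \<phi> z - 4 * (rho z)\<^sup>2 * wirtinger \<phi> z)" (is "?L = ?R")
  proof
    fix z
    have "has_wirtinger (\<lambda>z. rho z * (- 4 * rho z * \<phi> z))
      (- cnj z * (- 4 * rho z * \<phi> z) + rho z * (- 4 * (- cnj z) * \<phi> z + - 4 * rho z * wirtinger \<phi> z))
      (- z * (- 4 * rho z * \<phi> z) + rho z * (- 4 * (- z) * \<phi> z + - 4 * rho z * wirtinger_bar \<phi> z)) z"
      by (intro hw)
    from has_wirtinger_imp(3)[OF this] show "?L z = ?R z"
      by (simp add: algebra_simps power2_eq_square)
  qed
  \<comment> \<open>A is what the product rule yields when the derivative falls on the weight. It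
    reappears with the opposite sign in the first order term of the operator, and the two
    contributions cancel.\<close>
  define A where "A = (\<lambda>z. 8 * cnj z * rho z * \<phi> z)"
  define B where "B = (\<lambda>z. (rho z)\<^sup>2 * wirtinger \<phi> z)"
  have sA: "smooth A" and sB: "smooth B"
    unfolding A_def B_def using assms
    by (intro smooth_mult smooth_const smooth_cnj smooth_ident smooth_rho smooth_power smooth_wirtinger; simp)+
  have e1: "(\<lambda>z. 8 * cnj z * rho z * \<phi> z - 4 * (rho z)\<^sup>2 * wirtinger \<phi> z) = (\<lambda>z. A z + (-4) * B z)"
    by (simp add: A_def B_def mult.assoc)
  have e2: "(\<lambda>z. 2 * cnj z * (- 4 * rho z * \<phi> z)) = (\<lambda>z. (-1) * A z)"
    by (simp add: A_def mult.assoc)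
  have sB': "smooth (\<lambda>z. (-4) * B z)" using sB by (rule smooth_cmult)
  have 1: "wirtinger_bar (wirtinger (\<lambda>z. rho z * (- 4 * rho z * \<phi> z))) = (\<lambda>z. wirtinger_bar A z + (-4) * wirtinger_bar B z)"
    unfolding f1 e1 wirtinger_add(2)[OF sA sB'] wirtinger_cmult(2)[OF sB] ..
  have 2: "wirtinger_bar (\<lambda>z. 2 * cnj z * (- 4 * rho z * \<phi> z)) = (\<lambda>z. (-1) * wirtinger_bar A z)"
    unfolding e2 by (rule wirtinger_cmult[OF sA])
  have "smooth (wirtinger_bar A)" "smooth (\<lambda>z. (-4) * wirtinger_bar B z)"
    using sA sB by (intro smooth_wirtinger_bar smooth_cmult; simp)+
  note si = this[THEN square_integrable_smooth]
  have "Delta_distr (distr_of F) \<phi> = distr_of F (wirtinger_bar (wirtinger (\<lambda>z. rho z * (- 4 * rho z * \<phi> z))))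
      + distr_of F (wirtinger_bar (\<lambda>z. 2 * cnj z * (- 4 * rho z * \<phi> z)))"
    unfolding Delta_distr_def distr_mult_def distr_diff_def distr_dz_def distr_dzbar_def r by simp
  also have "\<dots> = distr_of F (\<lambda>z. (-4) * wirtinger_bar B z)"
    unfolding 1 2 distr_of_add[OF si] distr_of_cmult
    by simp
  finally show ?thesis
    unfolding Delta_transpose_def[abs_def] B_def .
qed

section \<open>Integration by parts\<close>

lemma integrable_area_continuous:
  assumes "continuous_on UNIV f"
  shows "integrable area (f :: complex \<Rightarrow> complex)"
proof -
  obtain B where "\<And>z. z \<in> unit_disk \<Longrightarrow> cmod (f z) \<le> B"
    using continuous_bounded_on_disk[OF assms] by blast
  with assms show ?thesis
    by (intro area.integrable_const_bound[where B = B] AE_I2 measurable_area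
        borel_measurable_continuous_onI) auto
qed

text \<open>On the open exterior f is locally zero, so both coefficients vanish there. Their
  continuity extends this to the unit circle.\<close>

lemma has_wirtinger_zero_outside:
  assumes "\<And>z. has_wirtinger f (a z) (b z) z" "continuous_on UNIV a" "continuous_on UNIV b"
    and "\<And>z. z \<notin> unit_disk \<Longrightarrow> f z = 0" "z \<notin> unit_disk"
  shows "a z = 0" "b z = 0"
proof -
  have *: "a y = 0 \<and> b y = 0" if "y \<in> - cball 0 1" for y
  proof -
    have "has_wirtinger f 0 0 y"
      unfolding has_wirtinger_def
    proof (rule has_derivative_transform_within_open[where s = "- cball 0 1"])
      show "((\<lambda>z. 0) has_derivative (\<lambda>h. 0 * h + 0 * cnj h)) (at y)" by simp
    qed (use that assms(4) in auto)
    from has_wirtinger_imp(3,4)[OF this] has_wirtinger_imp(3,4)[OF assms(1)[of y]]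
    show ?thesis by simp
  qed
  have cl: "- unit_disk = closure (- cball 0 (1::real) :: complex set)"
    by (simp add: closure_complement)
  have "closure (- cball 0 (1::real)) \<subseteq> {y. a y = 0}" "closure (- cball 0 (1::real)) \<subseteq> {y. b y = 0}"
    using * assms(2,3) by (intro closure_minimal; auto intro!: closed_Collect_eq)+
  with assms(5) show "a z = 0" "b z = 0"
    unfolding cl[symmetric] by auto
qed

text \<open>By translation invariance the difference quotients have integral zero.\<close>

lemma integral_directional_derivative_eq_0:
  assumes f: "\<And>z. has_wirtinger f (a z) (b z) z"
    and a: "continuous_on UNIV a" and b: "continuous_on UNIV b"
    and f0: "\<And>z. z \<notin> unit_disk \<Longrightarrow> f z = 0" and v: "cmod v = 1"
  shows "(LINT z|area. a z * v + b z * cnj v) = 0"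
proof -
  let ?g = "\<lambda>z. a z * v + b z * cnj v"
  define h where "h n = inverse (real (Suc n))" for n
  have h: "h n > 0" "h n \<le> 1" for n
    by (auto simp: h_def field_simps)
  define s where "s n z = (f (of_real (h n) * v + z) - f z) /\<^sub>R h n" for n z
  have cf: "continuous_on UNIV f"
    using has_wirtinger_imp(5)[OF f]
    by (auto simp: continuous_on_eq_continuous_within intro: differentiable_imp_continuous_within)
  have fi: "integrable lborel f"
  proof -
    have "integrable lborel (\<lambda>z. indicator (cball 0 1) z *\<^sub>R f z)"
      by (intro borel_integrable_compact continuous_on_subset[OF cf]) auto
    moreover have "(\<lambda>z. indicator (cball 0 1) z *\<^sub>R f z) = f"
      using f0 by (auto simp: indicator_def)
    ultimately show ?thesis by simp
  qed
  have tr: "integrable lborel (\<lambda>z. f (c + z))" "(LINT z|lborel. f (c + z)) = (LINT z|lborel. f z)" for c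
  proof -
    have [measurable]: "f \<in> borel_measurable borel"
      using cf by (rule borel_measurable_continuous_onI)
    show "integrable lborel (\<lambda>z. f (c + z))"
      using fi by (subst (asm) lborel_distr_plus[of c, symmetric]) (simp add: integrable_distr_eq)
    show "(LINT z|lborel. f (c + z)) = (LINT z|lborel. f z)"
      by (subst (2) lborel_distr_plus[of c, symmetric]) (simp add: integral_distr)
  qed
  have s0: "(LINT z|lborel. s n z) = 0" for n
    unfolding s_def by (simp add: tr fi)
  have lim: "(\<lambda>n. s n z) \<longlonglongrightarrow> ?g z" for z
  proof -
    have "(f has_derivative (\<lambda>h. a z * h + b z * cnj h)) (at z)"
      using f[of z] by (simp add: has_wirtinger_def)
    then have 1: "((\<lambda>k. norm (f (z + k) - f z - (a z * k + b z * cnj k)) / norm k) \<longlongrightarrow> 0) (at 0)"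
      by (simp add: has_derivative_at)
    have "h \<longlonglongrightarrow> 0"
      unfolding h_def by (rule LIMSEQ_inverse_real_of_nat)
    then have "(\<lambda>n. of_real (h n) * v) \<longlonglongrightarrow> 0"
      by (intro tendsto_eq_intros) auto
    moreover have nz: "of_real (h n) * v \<noteq> 0" for n
      using h[of n] v by auto
    ultimately have "filterlim (\<lambda>n. of_real (h n) * v) (at 0) sequentially"
      by (auto simp: filterlim_at)
    from filterlim_compose[OF 1 this]
    have "(\<lambda>n. norm (s n z - ?g z)) \<longlonglongrightarrow> 0"
    proof (rule filterlim_cong[THEN iffD1, OF refl refl, rotated])
      have "norm (f (z + of_real (h n) * v) - f z - (a z * (of_real (h n) * v) + b z * cnj (of_real (h n) * v)))
          / norm (of_real (h n) * v) = norm (s n z - ?g z)" for n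
      proof -
        have "s n z - ?g z = (f (z + of_real (h n) * v) - f z
            - (a z * (of_real (h n) * v) + b z * cnj (of_real (h n) * v))) /\<^sub>R h n"
          using h[of n] unfolding s_def by (simp add: scaleR_conv_of_real field_simps)
        then show ?thesis
          using h[of n] v by (simp add: norm_mult divide_inverse mult.commute)
      qed
      then show "\<forall>\<^sub>F n in sequentially. norm (f (z + of_real (h n) * v) - f z - (a z * (of_real (h n) * v)
          + b z * cnj (of_real (h n) * v))) / norm (of_real (h n) * v) = norm (s n z - ?g z)"
        by simp
    qed
    then show ?thesis
      by (simp add: tendsto_norm_zero_iff LIM_zero_iff)
  qed
  \<comment> \<open>Radius 3 covers both points of a difference quotient at |z| \<le> 2, as the
    shift has length at most 1. For |z| > 2 both points lie outside the disk and the quotient is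
    zero.\<close>
  obtain A where "\<forall>y\<in>a ` cball 0 3. cmod y \<le> A"
    using compact_imp_bounded[OF compact_continuous_image[OF continuous_on_subset[OF a subset_UNIV] compact_cball[of 0 3]]]
    unfolding bounded_iff by blast
  then have A: "\<And>z. z \<in> cball 0 3 \<Longrightarrow> cmod (a z) \<le> A" by blast
  obtain B where "\<forall>y\<in>b ` cball 0 3. cmod y \<le> B"
    using compact_imp_bounded[OF compact_continuous_image[OF continuous_on_subset[OF b subset_UNIV] compact_cball[of 0 3]]]
    unfolding bounded_iff by blast
  then have B: "\<And>z. z \<in> cball 0 3 \<Longrightarrow> cmod (b z) \<le> B" by blast
  have AB: "0 \<le> A" "0 \<le> B"
    using A[of 0] B[of 0] by (auto intro: order_trans[OF norm_ge_zero])
  have bound: "norm (s n z) \<le> indicator (cball 0 2) z *\<^sub>R (A + B)" for n z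
  proof (cases "z \<in> cball 0 2")
    case True
    have hv: "cmod (of_real (h n) * v) \<le> 1"
      using h[of n] v by (simp add: norm_mult)
    have "norm (f (of_real (h n) * v + z) - f z) \<le> (A + B) * norm (of_real (h n) * v + z - z)"
    proof (rule differentiable_bound[where S = "cball 0 3"])
      show "(f has_derivative (\<lambda>k. a y * k + b y * cnj k)) (at y within cball 0 3)" for y
        using f[of y] by (auto simp: has_wirtinger_def intro: has_derivative_at_withinI)
      show "onorm (\<lambda>k. a y * k + b y * cnj k) \<le> A + B" if "y \<in> cball 0 3" for y
      proof (rule onorm_le)
        fix k
        have "norm (a y * k + b y * cnj k) \<le> norm (a y) * norm k + norm (b y) * norm k"
          by (metis complex_mod_cnj norm_mult norm_triangle_ineq)
        also have "\<dots> \<le> (A + B) * norm k"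
          using A[OF that] B[OF that] by (simp add: distrib_right add_mono mult_right_mono)
        finally show "norm (a y * k + b y * cnj k) \<le> (A + B) * norm k" .
      qed
      show "of_real (h n) * v + z \<in> cball 0 3"
        using norm_triangle_ineq[of "of_real (h n) * v" z] hv True by simp
    qed (use True in auto)
    then have "norm (f (of_real (h n) * v + z) - f z) \<le> (A + B) * h n"
      using h[of n] v by (simp add: norm_mult)
    then show ?thesis
      using True h[of n] unfolding s_def norm_scaleR by (simp add: divide_simps mult.commute)
  next
    case False
    have "cmod z \<le> cmod (of_real (h n) * v + z) + cmod (of_real (h n) * v)"
      using norm_triangle_ineq4[of "of_real (h n) * v + z" "of_real (h n) * v"] by simp
    moreover have "cmod (of_real (h n) * v) \<le> 1"
      using h[of n] v by (simp add: norm_mult)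
    ultimately have "f (of_real (h n) * v + z) = 0" "f z = 0"
      using False by (intro f0; simp)+
    then show ?thesis using False by (simp add: s_def)
  qed
  have "(\<lambda>n. LINT z|lborel. s n z) \<longlonglongrightarrow> (LINT z|lborel. ?g z)"
  proof (rule integral_dominated_convergence)
    show "integrable lborel (\<lambda>z. indicator (cball 0 2) z *\<^sub>R (A + B))"
      by (intro borel_integrable_compact continuous_intros) auto
    show "?g \<in> borel_measurable lborel"
      using a b by (auto intro!: borel_measurable_continuous_onI continuous_intros)
    show "s n \<in> borel_measurable lborel" for n
      unfolding s_def using fi tr by (auto intro!: borel_measurable_integrable)
  qed (use bound lim in auto)
  then have "(LINT z|lborel. ?g z) = 0"
    by (simp add: s0 LIMSEQ_const_iff)
  moreover have "indicator unit_disk z *\<^sub>R ?g z = ?g z" for z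
    using has_wirtinger_zero_outside[OF f a b f0, of z] by (cases "z \<in> unit_disk") auto
  ultimately show ?thesis
    by (simp add: integral_area)
qed

lemma integral_wirtinger_eq_0:
  assumes f: "\<And>z. has_wirtinger f (a z) (b z) z"
    and a: "continuous_on UNIV a" and b: "continuous_on UNIV b"
    and f0: "\<And>z. z \<notin> unit_disk \<Longrightarrow> f z = 0"
  shows "(LINT z|area. a z) = 0" "(LINT z|area. b z) = 0"
proof -
  note ia = integrable_area_continuous[OF a] and ib = integrable_area_continuous[OF b]
  \<comment> \<open>The directions 1 and \<i> give the sum and the difference of the two
    integrals.\<close>
  have "(LINT z|area. a z) + (LINT z|area. b z) = 0"
    using integral_directional_derivative_eq_0[OF assms, of 1] ia ib by simp
  moreover have "\<i> * ((LINT z|area. a z) - (LINT z|area. b z)) = 0"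
    using integral_directional_derivative_eq_0[OF assms, of \<i>] ia ib
    by (simp add: algebra_simps)
  ultimately show "(LINT z|area. a z) = 0" "(LINT z|area. b z) = 0"
    by (auto simp: add_eq_0_iff)
qed

lemma test_functionD:
  assumes "test_function \<phi>"
  shows "smooth \<phi>" "z \<notin> unit_disk \<Longrightarrow> \<phi> z = 0" "z \<notin> unit_disk \<Longrightarrow> wirtinger \<phi> z = 0"
proof -
  show s: "smooth \<phi>"
    using assms by (simp add: test_function_def smooth_def)
  show z: "\<phi> z = 0" if "z \<notin> unit_disk" for z
    using assms that closure_subset[of "{z. \<phi> z \<noteq> 0}"] by (auto simp: test_function_def)
  show "z \<notin> unit_disk \<Longrightarrow> wirtinger \<phi> z = 0"
    using has_wirtinger_zero_outside(1)[OF smooth_has_wirtinger[OF s]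
        smooth_continuous[OF smooth_wirtinger[OF s]] smooth_continuous[OF smooth_wirtinger_bar[OF s]] z]
    by blast
qed

lemma integral_wirtinger_test:
  assumes f: "smooth f" and \<phi>: "test_function \<phi>"
  shows "(LINT z|area. wirtinger f z * \<phi> z) = - (LINT z|area. f z * wirtinger \<phi> z)"
proof -
  note s = test_functionD(1)[OF \<phi>]
  have c: "continuous_on UNIV (\<lambda>z. wirtinger f z * \<phi> z)" "continuous_on UNIV (\<lambda>z. f z * wirtinger \<phi> z)"
    "continuous_on UNIV (\<lambda>z. wirtinger_bar f z * \<phi> z)" "continuous_on UNIV (\<lambda>z. f z * wirtinger_bar \<phi> z)"
    by (intro smooth_continuous smooth_mult smooth_wirtinger smooth_wirtinger_bar f s)+
  have "(LINT z|area. wirtinger f z * \<phi> z + f z * wirtinger \<phi> z) = 0"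
    by (rule integral_wirtinger_eq_0(1)[OF has_wirtinger_mult[OF smooth_has_wirtinger[OF f] smooth_has_wirtinger[OF s]]])
       (auto intro!: continuous_on_add c simp: test_functionD(2)[OF \<phi>])
  then show ?thesis
    by (simp add: integrable_area_continuous c eq_neg_iff_add_eq_0)
qed

text \<open>Two integrations by parts, without boundary terms because \<phi> and its derivative
  vanish off the disk. Between them the weight rho^2 is moved from the derivative of f to the
  derivative of \<phi>.\<close>

lemma integral_Delta_test:
  assumes f: "smooth f" and \<phi>: "test_function \<phi>"
  shows "(LINT z|area. Delta f z * \<phi> z) = (LINT z|area. f z * Delta_transpose \<phi> z)"
proof -
  note s = test_functionD(1)[OF \<phi>]
  define u where "u = (\<lambda>z. (rho z)\<^sup>2 * wirtinger_bar f z)"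
  define w where "w = (\<lambda>z. (rho z)\<^sup>2 * wirtinger \<phi> z)"
  have su: "smooth u" and sw: "smooth w"
    unfolding u_def w_def
    by (intro smooth_mult smooth_power smooth_rho smooth_wirtinger smooth_wirtinger_bar f s)+
  have w0: "w z = 0" if "z \<notin> unit_disk" for z
    using test_functionD(3)[OF \<phi> that] by (simp add: w_def)
  have "(LINT z|area. wirtinger_bar f z * w z + f z * wirtinger_bar w z) = 0"
    by (rule integral_wirtinger_eq_0(2)[OF has_wirtinger_mult[OF smooth_has_wirtinger[OF f] smooth_has_wirtinger[OF sw]]])
       (auto intro!: smooth_continuous smooth_add smooth_mult smooth_wirtinger smooth_wirtinger_bar f sw simp: w0)
  then have 1: "(LINT z|area. wirtinger_bar f z * w z) = - (LINT z|area. f z * wirtinger_bar w z)"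
    by (subst (asm) Bochner_Integration.integral_add)
       (auto intro!: integrable_area_continuous smooth_continuous smooth_mult smooth_wirtinger smooth_wirtinger_bar
          f sw simp: eq_neg_iff_add_eq_0)
  have 2: "wirtinger_bar f z * w z = u z * wirtinger \<phi> z" for z
    by (simp add: u_def w_def)
  have "(LINT z|area. Delta f z * \<phi> z) = - 4 * (LINT z|area. wirtinger u z * \<phi> z)"
    unfolding Delta_def u_def by (simp add: mult.assoc)
  also have "\<dots> = - 4 * (LINT z|area. f z * wirtinger_bar w z)"
    unfolding integral_wirtinger_test[OF su \<phi>] 2[symmetric] 1 by simp
  also have "\<dots> = (LINT z|area. f z * (- 4 * wirtinger_bar w z))"
    unfolding mult.left_commute[of _ "- 4"] by simp
  finally show ?thesis
    unfolding Delta_transpose_def w_def .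
qed

section \<open>The maximal operator, without the condition on the z derivative\<close>

definition Delta_max :: L2_graph where
  "Delta_max = {(F, G). represents G (Delta_distr (distr_of F))}"

lemma Delta_max_iff:
  "(F, G) \<in> Delta_max \<longleftrightarrow> (\<forall>\<phi>. test_function \<phi> \<longrightarrow> distr_of G \<phi> = distr_of F (Delta_transpose \<phi>))"
  by (auto simp: Delta_max_def represents_def Delta_distr_eq test_functionD(1))

lemma Delta_tilde_iff:
  "(F, G) \<in> Delta_tilde \<longleftrightarrow> (F, G) \<in> Delta_max \<and> (\<exists>H. represents H (distr_dz (distr_of F)))"
  by (auto simp: Delta_tilde_def Delta_domain_def Delta_max_def)

lemma smooth_in_Delta_tilde:
  assumes "smooth f"
  shows "(abs_L2 f, abs_L2 (Delta f)) \<in> Delta_tilde"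
proof -
  have "represents (abs_L2 (wirtinger f)) (distr_dz (distr_of (abs_L2 f)))"
    unfolding represents_def distr_dz_def
    using assms integral_wirtinger_test[OF assms]
    by (simp add: distr_of_abs square_integrable_smooth smooth_wirtinger test_functionD(1))
  moreover have "(abs_L2 f, abs_L2 (Delta f)) \<in> Delta_max"
    unfolding Delta_max_iff using assms integral_Delta_test[OF assms]
    by (simp add: distr_of_abs square_integrable_smooth smooth_Delta smooth_Delta_transpose test_functionD(1))
  ultimately show ?thesis
    by (auto simp: Delta_tilde_iff)
qed

lemma smooth_in_Delta_max: "smooth f \<Longrightarrow> (abs_L2 f, abs_L2 (Delta f)) \<in> Delta_max"
  using smooth_in_Delta_tilde Delta_tilde_iff by blast

section \<open>Cutoff functions\<close>

text \<open>The powers of 1/x are included so that the family is closed under differentiation up to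
  linear combinations. Index 0 is the usual flat function.\<close>

definition bump :: "nat \<Rightarrow> real \<Rightarrow> real" where
  "bump k x = (if x > 0 then exp (- (1 / x)) / x ^ k else 0)"

text \<open>A single term of the exponential series is at most its sum. With y = 1/x this bounds
  \<open>bump k\<close> by k!, uniformly in x.\<close>

lemma power_le_fact_exp:
  fixes y :: real
  assumes "0 \<le> y"
  shows "y ^ k \<le> fact k * exp y"
proof -
  have "sum (\<lambda>n. y ^ n /\<^sub>R fact n) {k} \<le> (\<Sum>n. y ^ n /\<^sub>R fact n)"
    using assms by (intro sum_le_suminf summable_exp_generic) auto
  then show ?thesis
    by (simp add: exp_def divide_simps mult.commute)
qed

lemma bump_nonneg: "0 \<le> bump k x"
  by (simp add: bump_def)

lemma bump_le_fact: "bump k x \<le> fact k"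
proof (cases "x > 0")
  case True
  have "(1 / x) ^ k \<le> fact k * exp (1 / x)"
    using True by (intro power_le_fact_exp) auto
  then show ?thesis
    using True by (simp add: bump_def exp_minus field_simps)
qed (simp add: bump_def)

lemma abs_bump_le_fact: "\<bar>bump k x\<bar> \<le> fact k"
  using bump_nonneg[of k x] bump_le_fact[of k x] by simp

lemma times_bump_Suc: "x * bump (Suc k) x = bump k x"
  by (simp add: bump_def)

text \<open>\<open>bump k\<close> is x times the bounded function
  \<open>bump (Suc k)\<close>.\<close>

lemma isCont_bump_0: "isCont (bump k) 0"
proof -
  have "(\<lambda>x. x * bump (Suc k) x) \<midarrow>0\<rightarrow> 0"
  proof (rule Lim_null_comparison)
    show "\<forall>\<^sub>F x in at 0. norm (x * bump (Suc k) x) \<le> \<bar>x\<bar> * fact (Suc k)"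
      using abs_bump_le_fact[of "Suc k"] by (intro always_eventually) (auto simp: abs_mult intro!: mult_left_mono simp del: fact_Suc)
    show "((\<lambda>x::real. \<bar>x\<bar> * fact (Suc k)) \<longlongrightarrow> 0) (at 0)"
      by (auto intro!: tendsto_eq_intros)
  qed
  then have "bump k \<midarrow>0\<rightarrow> 0"
    by (simp only: times_bump_Suc)
  then show ?thesis
    by (simp add: isCont_def bump_def[of k 0])
qed

lemma bump_has_derivative:
  "(bump k has_real_derivative (bump (k + 2) x - real k * bump (k + 1) x)) (at x)"
proof -
  consider "x > 0" | "x < 0" | "x = 0" by linarith
  then show ?thesis
  proof cases
    case 1
    have "((\<lambda>y. exp (- (1 / y)) * inverse (y ^ k)) has_real_derivative (bump (k + 2) x - real k * bump (k + 1) x)) (at x)"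
    proof -
      show ?thesis
        using 1
        apply (auto intro!: derivative_eq_intros simp: bump_def)
        apply (cases k)
         apply (simp_all add: field_simps)
        done
    qed
    then show ?thesis
      by (rule has_field_derivative_transform_within_open[where S = "{0<..}"])
         (use 1 in \<open>auto simp: bump_def divide_inverse\<close>)
  next
    case 2
    have "((\<lambda>y. 0) has_real_derivative (bump (k + 2) x - real k * bump (k + 1) x)) (at x)"
      using 2 by (auto simp: bump_def)
    then show ?thesis
      by (rule has_field_derivative_transform_within_open[where S = "{..<0}"])
         (use 2 in \<open>auto simp: bump_def\<close>)
  next
    case 3
    \<comment> \<open>At 0 the difference quotient of \<open>bump k\<close> is exactly
      \<open>bump (Suc k)\<close>, whose limit is already known.\<close>
    have "((\<lambda>h. (bump k (0 + h) - bump k 0) / h) \<longlongrightarrow> 0) (at 0)"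
    proof (rule Lim_transform_eventually)
      show "(bump (Suc k) \<longlongrightarrow> 0) (at 0)"
        using isCont_bump_0[of "Suc k"] by (simp add: isCont_def bump_def)
      have "bump (Suc k) h = (bump k (0 + h) - bump k 0) / h" if "h \<noteq> 0" for h
        using that times_bump_Suc[of h k] by (simp add: bump_def[of k 0] field_simps)
      then show "\<forall>\<^sub>F h in at 0. bump (Suc k) h = (bump k (0 + h) - bump k 0) / h"
        by (auto simp: eventually_at_filter)
    qed
    then show ?thesis
      using 3 by (simp add: DERIV_def bump_def)
  qed
qed

lemma bump_tendsto: "(bump k \<longlongrightarrow> (if k = 0 then 1 else 0)) at_top"
proof -
  have i: "((\<lambda>x::real. 1 / x) \<longlongrightarrow> 0) at_top"
    using tendsto_inverse_0_at_top[OF filterlim_ident] by (simp add: inverse_eq_divide)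
  have "((\<lambda>x::real. exp (- (1 / x)) * (1 / x) ^ k) \<longlongrightarrow> exp (- 0) * 0 ^ k) at_top"
    by (intro tendsto_intros i)
  then have "((\<lambda>x::real. exp (- (1 / x)) * (1 / x) ^ k) \<longlongrightarrow> (if k = 0 then 1 else 0)) at_top"
    by (cases k) auto
  then show ?thesis
    by (rule Lim_transform_eventually)
       (use eventually_gt_at_top[of "0::real"] in \<open>eventually_elim, simp add: bump_def divide_inverse power_inverse\<close>)
qed

text \<open>The argument n rho - 1 is positive only where rho > 1/n, which keeps the support compact
  inside the disk, and it tends to infinity at every point of the disk. Index 0 is the actual
  cutoff; higher indices describe its derivatives.\<close>

definition cutoff :: "nat \<Rightarrow> nat \<Rightarrow> complex \<Rightarrow> complex" where
  "cutoff n k z = of_real (bump k (of_nat n * (1 - (cmod z)\<^sup>2) - 1))"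

lemma has_wirtinger_cutoff:
  "has_wirtinger (cutoff n k)
    ((cutoff n (k + 2) z - of_nat k * cutoff n (k + 1) z) * (- (of_nat n * cnj z)))
    ((cutoff n (k + 2) z - of_nat k * cutoff n (k + 1) z) * (- (of_nat n * z))) z"
proof -
  have "has_wirtinger (\<lambda>z. of_nat n * rho z - 1) (of_nat n * (- cnj z) - 0) (of_nat n * (- z) - 0) z"
    by (intro has_wirtinger_diff has_wirtinger_cmult has_wirtinger_rho has_wirtinger_const)
  then have "has_wirtinger (\<lambda>z. complex_of_real (of_nat n * (1 - (cmod z)\<^sup>2) - 1))
      (- (of_nat n * cnj z)) (- (of_nat n * z)) z"
    by (simp add: rho_of_real)
  from has_wirtinger_real_chain[OF bump_has_derivative this, of k] show ?thesis
    unfolding cutoff_def[abs_def] by simp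
qed

text \<open>A derivative only raises the index k and brings in polynomial factors, so the order of
  differentiability is increased for all k simultaneously.\<close>

lemma smooth_cutoff: "smooth (cutoff n k)"
  unfolding smooth_def
proof
  fix m
  show "Ck m (cutoff n k)"
  proof (induction m arbitrary: k)
    case 0
    have "continuous (at z) (cutoff n k)" for z
      using has_wirtinger_imp(5)[OF has_wirtinger_cutoff] by (rule differentiable_imp_continuous_within)
    then show ?case by (simp add: continuous_on_eq_continuous_within)
  next
    case (Suc m)
    have id: "Ck m (\<lambda>z. z)" "Ck m (\<lambda>z. cnj z)"
      using smooth_ident smooth_cnj[OF smooth_ident] by (auto simp: smooth_def)
    have "Ck m (\<lambda>z. (cutoff n (k + 2) z + (- of_nat k) * cutoff n (k + 1) z) * ((- of_nat n) * cnj z))"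
      "Ck m (\<lambda>z. (cutoff n (k + 2) z + (- of_nat k) * cutoff n (k + 1) z) * ((- of_nat n) * z))"
      by (intro Ck_mult Ck_add Ck_const Suc.IH id)+
    then show ?case
      by (intro Ck_SucI[OF has_wirtinger_cutoff]) simp_all
  qed
qed

lemma test_function_mult_cutoff:
  assumes "smooth p"
  shows "test_function (\<lambda>z. p z * cutoff n 0 z)"
proof -
  have "closure {z. p z * cutoff n 0 z \<noteq> 0} \<subseteq> {z. 1 \<le> real n * (1 - (cmod z)\<^sup>2)}"
    by (intro closure_minimal closed_Collect_le continuous_intros)
       (auto simp: cutoff_def bump_def split: if_splits)
  also have "\<dots> \<subseteq> unit_disk"
  proof
    fix z assume "z \<in> {z. 1 \<le> real n * (1 - (cmod z)\<^sup>2)}"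
    then have "0 < real n * (1 - (cmod z)\<^sup>2)" by simp
    then have "(cmod z)\<^sup>2 < 1"
      by (auto simp: zero_less_mult_iff)
    then show "z \<in> unit_disk" by (simp add: power2_less_1_iff abs_square_less_1)
  qed
  finally show ?thesis
    using smooth_mult[OF assms smooth_cutoff[of n 0]] by (auto simp: test_function_def smooth_def)
qed

text \<open>With x = n rho - 1 one has n rho = x + 1, and multiplication by x lowers the index of
  the bump by one. So a factor n accompanied by a factor \<open>rho\<close> leaves functions bounded
  independently of n.\<close>

lemma rho_times_cutoff_Suc:
  "of_nat n * rho z * cutoff n (Suc k) z = cutoff n k z + cutoff n (Suc k) z"
proof -
  let ?x = "real n * (1 - (cmod z)\<^sup>2) - 1"
  have "real n * (1 - (cmod z)\<^sup>2) * bump (Suc k) ?x = ?x * bump (Suc k) ?x + bump (Suc k) ?x"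
    by (simp add: algebra_simps)
  then have "real n * (1 - (cmod z)\<^sup>2) * bump (Suc k) ?x = bump k ?x + bump (Suc k) ?x"
    by (simp only: times_bump_Suc)
  then show ?thesis
    unfolding cutoff_def rho_of_real by (metis of_real_add of_real_mult of_real_of_nat_eq)
qed

text \<open>
  Each derivative of the cutoff costs a factor \<open>n\<close>, which the weight \<open>\<rho>\<^sup>2\<close> absorbs; this is
  where the degeneracy of the operator at the boundary enters.
\<close>

lemma Delta_transpose_mult_cutoff:
  assumes p: "smooth p"
  shows "Delta_transpose (\<lambda>z. p z * cutoff n 0 z) z
    = Delta_transpose p z * cutoff n 0 z
      + 4 * (rho z * z * wirtinger p z + wirtinger_bar (\<lambda>z. p z * (cnj z * rho z)) z)
        * (cutoff n 1 z + cutoff n 2 z)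
      + - 4 * (p z * (z * cnj z)) * (cutoff n 4 z - 2 * cutoff n 2 z - cutoff n 1 z)"
proof -
  note hw = has_wirtinger_mult has_wirtinger_add smooth_has_wirtinger[OF p] has_wirtinger_cutoff
  define q where "q = (\<lambda>z. (rho z)\<^sup>2 * wirtinger p z)"
  define r where "r = (\<lambda>z. p z * (cnj z * rho z))"
  have sq: "smooth q" and sr: "smooth r"
    unfolding q_def r_def by (intro smooth_mult smooth_power smooth_rho smooth_wirtinger smooth_cnj smooth_ident p)+
  have s: "cutoff n 1 z + cutoff n 2 z = of_nat n * rho z * cutoff n 2 z"
    "cutoff n 2 z + cutoff n 3 z = of_nat n * rho z * cutoff n 3 z"
    "cutoff n 3 z + cutoff n 4 z = of_nat n * rho z * cutoff n 4 z" for z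
    using rho_times_cutoff_Suc[of n z 1] rho_times_cutoff_Suc[of n z 2] rho_times_cutoff_Suc[of n z 3]
    by (simp_all add: numeral_eq_Suc)
  have w: "wirtinger (\<lambda>z. p z * cutoff n 0 z)
      = (\<lambda>z. wirtinger p z * cutoff n 0 z + p z * (cutoff n 2 z * (- (of_nat n * cnj z))))"
  proof
    fix z
    have "has_wirtinger (\<lambda>z. p z * cutoff n 0 z)
      (wirtinger p z * cutoff n 0 z + p z * ((cutoff n (0 + 2) z - of_nat 0 * cutoff n (0 + 1) z) * (- (of_nat n * cnj z))))
      (wirtinger_bar p z * cutoff n 0 z + p z * ((cutoff n (0 + 2) z - of_nat 0 * cutoff n (0 + 1) z) * (- (of_nat n * z)))) z"
      by (intro hw)
    from has_wirtinger_imp(3)[OF this]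
    show "wirtinger (\<lambda>z. p z * cutoff n 0 z) z
      = wirtinger p z * cutoff n 0 z + p z * (cutoff n 2 z * (- (of_nat n * cnj z)))" by (simp add: numeral_2_eq_2)
  qed
  \<comment> \<open>The n of the first derivative is absorbed by one of the two factors
    \<open>rho\<close>; the other is kept in r for the second derivative.\<close>
  have e: "(\<lambda>z. (rho z)\<^sup>2 * wirtinger (\<lambda>z. p z * cutoff n 0 z) z)
      = (\<lambda>z. q z * cutoff n 0 z + - 1 * (r z * (cutoff n 1 z + cutoff n 2 z)))"
    unfolding w s q_def r_def by (simp add: fun_eq_iff algebra_simps power2_eq_square)
  have "has_wirtinger (\<lambda>z. q z * cutoff n 0 z + - 1 * (r z * (cutoff n 1 z + cutoff n 2 z)))
      (wirtinger q z * cutoff n 0 z + q z * ((cutoff n (0 + 2) z - of_nat 0 * cutoff n (0 + 1) z) * (- (of_nat n * cnj z)))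
       + - 1 * (wirtinger r z * (cutoff n 1 z + cutoff n 2 z)
         + r z * ((cutoff n (1 + 2) z - of_nat 1 * cutoff n (1 + 1) z) * (- (of_nat n * cnj z))
                + (cutoff n (2 + 2) z - of_nat 2 * cutoff n (2 + 1) z) * (- (of_nat n * cnj z)))))
      (wirtinger_bar q z * cutoff n 0 z + q z * ((cutoff n (0 + 2) z - of_nat 0 * cutoff n (0 + 1) z) * (- (of_nat n * z)))
       + - 1 * (wirtinger_bar r z * (cutoff n 1 z + cutoff n 2 z)
         + r z * ((cutoff n (1 + 2) z - of_nat 1 * cutoff n (1 + 1) z) * (- (of_nat n * z))
                + (cutoff n (2 + 2) z - of_nat 2 * cutoff n (2 + 1) z) * (- (of_nat n * z))))) z"
    by (intro hw has_wirtinger_cmult smooth_has_wirtinger[OF sq] smooth_has_wirtinger[OF sr])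
  from has_wirtinger_imp(4)[OF this]
  have "wirtinger_bar (\<lambda>z. q z * cutoff n 0 z + - 1 * (r z * (cutoff n 1 z + cutoff n 2 z))) z
    = wirtinger_bar q z * cutoff n 0 z - q z * (cutoff n 2 z * (of_nat n * z))
       - wirtinger_bar r z * (cutoff n 1 z + cutoff n 2 z)
         + r z * ((cutoff n 3 z - cutoff n 2 z + (cutoff n 4 z - 2 * cutoff n 3 z)) * (of_nat n * z))"
    by (simp add: algebra_simps eval_nat_numeral)
  \<comment> \<open>Every remaining n is paired with one \<open>rho\<close>, taken from q or from r,
    so that the identities s apply.\<close>
  also have "\<dots> = wirtinger_bar q z * cutoff n 0 z - rho z * z * wirtinger p z * (of_nat n * rho z * cutoff n 2 z)
       - wirtinger_bar r z * (cutoff n 1 z + cutoff n 2 z)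
       + p z * (z * cnj z) * (of_nat n * rho z * cutoff n 4 z - of_nat n * rho z * cutoff n 3 z
            - of_nat n * rho z * cutoff n 2 z)"
    unfolding q_def r_def by (simp add: algebra_simps power2_eq_square)
  also have "\<dots> = wirtinger_bar q z * cutoff n 0 z
       - (rho z * z * wirtinger p z + wirtinger_bar r z) * (cutoff n 1 z + cutoff n 2 z)
       + p z * (z * cnj z) * (cutoff n 4 z - 2 * cutoff n 2 z - cutoff n 1 z)"
    unfolding s[symmetric] by (simp add: algebra_simps)
  finally have *: "wirtinger_bar (\<lambda>z. q z * cutoff n 0 z + - 1 * (r z * (cutoff n 1 z + cutoff n 2 z))) z = \<dots>" .
  show ?thesis
    unfolding Delta_transpose_def e * unfolding q_def[symmetric] r_def[symmetric] by (simp add: algebra_simps)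
qed

text \<open>The area is finite, so a square integrable function is integrable and multiplied by B it
  dominates the integrands.\<close>

lemma distr_of_tendsto:
  assumes \<phi>: "\<And>n. \<phi> n \<in> borel_measurable area" "\<psi> \<in> borel_measurable area"
    and lim: "\<And>z. z \<in> unit_disk \<Longrightarrow> (\<lambda>n. \<phi> n z) \<longlonglongrightarrow> \<psi> z"
    and bound: "\<And>n z. z \<in> unit_disk \<Longrightarrow> cmod (\<phi> n z) \<le> B"
  shows "(\<lambda>n. distr_of F (\<phi> n)) \<longlonglongrightarrow> distr_of F \<psi>"
proof -
  have [measurable]: "rep_L2 F \<in> borel_measurable area" "\<And>n. \<phi> n \<in> borel_measurable area" "\<psi> \<in> borel_measurable area"
    using square_integrable_rep \<phi> by (auto simp: square_integrable_def)
  have "integrable area (rep_L2 F)"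
    using square_integrable_mult_cnj[OF square_integrable_rep square_integrable_smooth[OF smooth_const[of 1]], of F]
    by simp
  then have "integrable area (\<lambda>z. cmod (rep_L2 F z) * B)"
    by simp
  then show ?thesis
    unfolding distr_of_def
  proof (rule integral_dominated_convergence[rotated 2])
    show "AE z in area. (\<lambda>n. rep_L2 F z * \<phi> n z) \<longlonglongrightarrow> rep_L2 F z * \<psi> z"
      using lim by (intro AE_I2 tendsto_intros) auto
    show "AE z in area. norm (rep_L2 F z * \<phi> n z) \<le> cmod (rep_L2 F z) * B" for n
      using bound by (intro AE_I2) (auto simp: norm_mult intro!: mult_left_mono)
  qed measurable
qed

lemma cutoff_tendsto:
  assumes "z \<in> unit_disk"
  shows "(\<lambda>n. cutoff n k z) \<longlonglongrightarrow> (if k = 0 then 1 else 0)"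
proof -
  have "1 - (cmod z)\<^sup>2 > 0"
    using assms by (simp add: abs_square_less_1)
  then have "filterlim (\<lambda>n. real n * (1 - (cmod z)\<^sup>2) - 1) at_top sequentially"
    by (subst diff_conv_add_uminus, subst add.commute)
       (intro filterlim_tendsto_add_at_top[OF tendsto_const]
          filterlim_at_top_mult_tendsto_pos[OF tendsto_const] filterlim_real_sequentially)
  from filterlim_compose[OF bump_tendsto this]
  have "(\<lambda>n. of_real (bump k (real n * (1 - (cmod z)\<^sup>2) - 1))) \<longlonglongrightarrow> complex_of_real (if k = 0 then 1 else 0)"
    by (rule tendsto_of_real)
  then show ?thesis
    by (simp add: cutoff_def split: if_splits)
qed

lemma norm_cutoff_le: "cmod (cutoff n k z) \<le> fact k"
  by (simp add: cutoff_def abs_bump_le_fact)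

text \<open>The equation is applied to the test functions p times cutoff. Cutoffs of positive index
  are bounded by factorials and tend to 0 pointwise, so in the limit only the term with no
  derivative on the cutoff survives.\<close>

lemma Delta_max_smooth:
  assumes FG: "(F, G) \<in> Delta_max" and p: "smooth p"
  shows "distr_of G p = distr_of F (Delta_transpose p)"
proof -
  define A0 where "A0 = Delta_transpose p"
  define A1 where "A1 = (\<lambda>z. 4 * (rho z * z * wirtinger p z + wirtinger_bar (\<lambda>z. p z * (cnj z * rho z)) z))"
  define A2 where "A2 = (\<lambda>z. - 4 * (p z * (z * cnj z)))"
  have s: "smooth A0" "smooth A1" "smooth A2"
    unfolding A0_def A1_def A2_def
    by (intro smooth_Delta_transpose smooth_cmult smooth_add smooth_mult smooth_wirtinger smooth_wirtinger_bar
        smooth_rho smooth_ident smooth_cnj p)+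
  have meas: "f \<in> borel_measurable area" if "smooth f" for f
    using that square_integrable_smooth by (auto simp: square_integrable_def)
  have bdd: "\<exists>B. \<forall>z\<in>unit_disk. cmod (f z) \<le> B" if "smooth f" for f
    using continuous_bounded_on_disk[OF smooth_continuous[OF that]] by metis
  obtain Bp where Bp: "\<forall>z\<in>unit_disk. cmod (p z) \<le> Bp" using bdd[OF p] by blast
  obtain B0 where B0: "\<forall>z\<in>unit_disk. cmod (A0 z) \<le> B0" using bdd[OF s(1)] by blast
  obtain B1 where B1: "\<forall>z\<in>unit_disk. cmod (A1 z) \<le> B1" using bdd[OF s(2)] by blast
  obtain B2 where B2: "\<forall>z\<in>unit_disk. cmod (A2 z) \<le> B2" using bdd[OF s(3)] by blast
  have "(\<lambda>n. distr_of G (\<lambda>z. p z * cutoff n 0 z)) \<longlonglongrightarrow> distr_of G p"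
  proof (rule distr_of_tendsto)
    fix z n assume z: "z \<in> unit_disk"
    show "(\<lambda>n. p z * cutoff n 0 z) \<longlonglongrightarrow> p z"
      using tendsto_mult[OF tendsto_const cutoff_tendsto[OF z, of 0], of "p z"] by simp
    show "cmod (p z * cutoff n 0 z) \<le> Bp * fact 0"
      unfolding norm_mult using Bp z norm_cutoff_le[of n 0 z]
      by (intro mult_mono) (auto intro: order_trans[OF norm_ge_zero])
  qed (intro meas smooth_mult p smooth_cutoff)+
  moreover have "(\<lambda>n. distr_of F (Delta_transpose (\<lambda>z. p z * cutoff n 0 z))) \<longlonglongrightarrow> distr_of F A0"
  proof (rule distr_of_tendsto)
    fix z n assume z: "z \<in> unit_disk"
    have "(\<lambda>n. A0 z * cutoff n 0 z + A1 z * (cutoff n 1 z + cutoff n 2 z)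
        + A2 z * (cutoff n 4 z - 2 * cutoff n 2 z - cutoff n 1 z))
      \<longlonglongrightarrow> A0 z * 1 + A1 z * (0 + 0) + A2 z * (0 - 2 * 0 - 0)"
      using cutoff_tendsto[OF z, of 0] cutoff_tendsto[OF z, of 1] cutoff_tendsto[OF z, of 2] cutoff_tendsto[OF z, of 4]
      by (intro tendsto_intros) auto
    then show "(\<lambda>n. Delta_transpose (\<lambda>z. p z * cutoff n 0 z) z) \<longlonglongrightarrow> A0 z"
      unfolding Delta_transpose_mult_cutoff[OF p] A0_def A1_def A2_def by simp
    have "cmod (A0 z * cutoff n 0 z + A1 z * (cutoff n 1 z + cutoff n 2 z)
        + A2 z * (cutoff n 4 z - 2 * cutoff n 2 z - cutoff n 1 z))
      \<le> cmod (A0 z) * cmod (cutoff n 0 z) + cmod (A1 z) * cmod (cutoff n 1 z + cutoff n 2 z)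
        + cmod (A2 z) * cmod (cutoff n 4 z - 2 * cutoff n 2 z - cutoff n 1 z)"
      unfolding norm_mult[symmetric] by (intro order_trans[OF norm_triangle_ineq] add_mono norm_triangle_ineq order_refl)
    also have "\<dots> \<le> B0 * fact 0 + B1 * (fact 1 + fact 2) + B2 * (fact 4 + 2 * fact 2 + fact 1)"
    proof (intro add_mono mult_mono)
      show "cmod (cutoff n 1 z + cutoff n 2 z) \<le> fact 1 + fact 2"
        by (intro order_trans[OF norm_triangle_ineq] add_mono norm_cutoff_le)
      have "cmod (2 * cutoff n 2 z) \<le> 2 * fact 2"
        using norm_cutoff_le[of n 2 z] by (simp add: norm_mult)
      then show "cmod (cutoff n 4 z - 2 * cutoff n 2 z - cutoff n 1 z) \<le> fact 4 + 2 * fact 2 + fact 1"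
        by (intro order_trans[OF norm_triangle_ineq4] add_mono norm_cutoff_le)
    qed (use B0 B1 B2 z norm_cutoff_le[of n 0 z] in \<open>auto intro: order_trans[OF norm_ge_zero]\<close>)
    finally show "cmod (Delta_transpose (\<lambda>z. p z * cutoff n 0 z) z)
        \<le> B0 * fact 0 + B1 * (fact 1 + fact 2) + B2 * (fact 4 + 2 * fact 2 + fact 1)"
      unfolding Delta_transpose_mult_cutoff[OF p] A0_def A1_def A2_def .
  qed (intro meas s(1) smooth_Delta_transpose smooth_mult p smooth_cutoff)+
  moreover have "distr_of G (\<lambda>z. p z * cutoff n 0 z) = distr_of F (Delta_transpose (\<lambda>z. p z * cutoff n 0 z))" for n
    using FG test_function_mult_cutoff[OF p, of n] by (auto simp: Delta_max_iff)
  ultimately show ?thesis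
    unfolding A0_def by (simp add: LIMSEQ_unique)
qed

section \<open>Density of weighted polynomials\<close>

text \<open>Radial truncation to modulus m. Being continuous, it preserves both continuous functions
  and pointwise limits while providing a bound.\<close>

definition clampc :: "real \<Rightarrow> complex \<Rightarrow> complex" where
  "clampc m w = (m / max m (cmod w)) *\<^sub>R w"

lemma continuous_clampc: "m > 0 \<Longrightarrow> continuous_on UNIV (clampc m)"
  unfolding clampc_def[abs_def] by (intro continuous_intros) (auto simp: max_def)

lemma clampc_measurable: "m > 0 \<Longrightarrow> clampc m \<in> borel_measurable borel"
  by (intro borel_measurable_continuous_onI continuous_clampc)

lemma norm_clampc_le:
  assumes "m > 0"
  shows "cmod (clampc m w) \<le> m" "cmod (clampc m w) \<le> cmod w"
proof -
  have p: "max m (cmod w) > 0" using assms by simp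
  have "m * cmod w \<le> m * max m (cmod w)" "m * cmod w \<le> max m (cmod w) * cmod w"
    using assms by (intro mult_left_mono mult_right_mono; simp)+
  then show "cmod (clampc m w) \<le> m" "cmod (clampc m w) \<le> cmod w"
    using p assms by (simp_all add: clampc_def divide_simps mult.commute)
qed

lemma clampc_eq: "m > 0 \<Longrightarrow> cmod w \<le> m \<Longrightarrow> clampc m w = w"
  by (simp add: clampc_def max_def)

text \<open>A measurable function is almost everywhere a limit of continuous ones, but without any
  domination. Truncating at a fixed level makes the first limit dominated by a constant; the
  truncations are then dominated by f itself as the level grows.\<close>

lemma continuous_dense: "F \<in> closure {abs_L2 g |g. continuous_on UNIV g}"
proof -
  define f where "f = rep_L2 F"
  have sf: "square_integrable f"
    by (simp add: f_def square_integrable_rep)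
  then have fm [measurable]: "f \<in> borel_measurable area"
    by (simp add: square_integrable_def)
  define f' where "f' = (\<lambda>z. indicator unit_disk z *\<^sub>R f z)"
  have "f' \<in> borel_measurable lborel"
    using fm unfolding area_def f'_def by (subst (asm) borel_measurable_restrict_space_iff[OF disk_in_sets])
  then have "f' \<in> borel_measurable lebesgue"
    by (rule measurable_completion)
  then have "f' measurable_on UNIV"
    by (intro lebesgue_measurable_imp_measurable_on) auto
  then obtain N g where N: "negligible N" and g: "\<And>n. continuous_on UNIV (g n)"
    and lim: "\<And>z. z \<notin> N \<Longrightarrow> (\<lambda>n. g n z) \<longlonglongrightarrow> f' z"
    unfolding measurable_on_def by auto
  have "AE z in lebesgue. z \<notin> N"
    using N by (intro AE_not_in) (simp add: negligible_iff_null_sets)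
  then have "AE z in lborel. z \<notin> N"
    by (simp add: AE_completion_iff)
  then have ae: "AE z in area. (\<lambda>n. g n z) \<longlonglongrightarrow> f z"
    unfolding AE_area_iff
  proof eventually_elim
    case (elim z)
    then show ?case using lim[of z] by (auto simp: f'_def)
  qed
  define t where "t m = (\<lambda>z. clampc (real (Suc m)) (f z))" for m
  have tm [measurable]: "t m \<in> borel_measurable area" for m
    unfolding t_def by (rule measurable_compose[OF fm clampc_measurable]) simp
  have "abs_L2 (t m) \<in> closure {abs_L2 g |g. continuous_on UNIV g}" for m
    unfolding closure_sequential
  proof (intro exI conjI allI)
    let ?k = "\<lambda>n z. clampc (real (Suc m)) (g n z)"
    have ck: "continuous_on UNIV (?k n)" for n
      using continuous_on_compose2[OF continuous_clampc[of "real (Suc m)"] g[of n]] by simp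
    then show "abs_L2 (?k n) \<in> {abs_L2 g |g. continuous_on UNIV g}" for n by blast
    show "(\<lambda>n. abs_L2 (?k n)) \<longlonglongrightarrow> abs_L2 (t m)"
    proof (rule abs_L2_tendsto(3))
      show "?k n \<in> borel_measurable area" for n
        using ck by (intro measurable_area borel_measurable_continuous_onI)
      show "square_integrable (\<lambda>z. of_real (real (Suc m)))"
        by (intro square_integrable_continuous continuous_intros)
      show "AE z in area. (\<lambda>n. ?k n z) \<longlonglongrightarrow> t m z"
        using ae
      proof eventually_elim
        case (elim z)
        have "isCont (clampc (real (Suc m))) (f z)"
          using continuous_clampc[of "real (Suc m)"] by (simp add: continuous_on_eq_continuous_at)
        from isCont_tendsto_compose[OF this elim] show ?case by (simp add: t_def)
      qed
      show "AE z in area. cmod (?k n z) \<le> cmod (of_real (real (Suc m)))" for n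
        using norm_clampc_le(1)[of "real (Suc m)"] by (simp del: of_nat_Suc)
    qed fact
  qed
  moreover have "(\<lambda>m. abs_L2 (t m)) \<longlonglongrightarrow> abs_L2 f"
  proof (rule abs_L2_tendsto(3)[OF tm fm sf])
    show "AE z in area. (\<lambda>m. t m z) \<longlonglongrightarrow> f z"
    proof (rule AE_I2)
      fix z
      obtain M where M: "cmod (f z) \<le> real M" using real_arch_simple by blast
      have "\<forall>\<^sub>F m in sequentially. t m z = f z"
        using eventually_ge_at_top[of M]
      proof eventually_elim
        case (elim m)
        then show ?case using M unfolding t_def by (intro clampc_eq) auto
      qed
      then show "(\<lambda>m. t m z) \<longlonglongrightarrow> f z" by (rule tendsto_eventually)
    qed
    show "AE z in area. cmod (t m z) \<le> cmod (f z)" for m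
      using norm_clampc_le(2)[of "real (Suc m)"] by (simp add: t_def del: of_nat_Suc)
  qed
  ultimately have "abs_L2 f \<in> closure (closure {abs_L2 g |g. continuous_on UNIV g})"
    unfolding closure_sequential[of _ "closure _"]
    by (intro exI[of _ "\<lambda>m. abs_L2 (t m)"]) blast
  then show ?thesis
    by (simp add: f_def abs_L2_rep)
qed

inductive bipoly :: "(complex \<Rightarrow> complex) \<Rightarrow> bool" where
  monom: "bipoly (\<lambda>z. z ^ a * cnj z ^ b)"
| cmult: "bipoly p \<Longrightarrow> bipoly (\<lambda>z. c * p z)"
| add: "bipoly p \<Longrightarrow> bipoly q \<Longrightarrow> bipoly (\<lambda>z. p z + q z)"

lemma bipoly_mult:
  assumes "bipoly p" "bipoly q"
  shows "bipoly (\<lambda>z. p z * q z)"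
  using assms
proof (induction arbitrary: q)
  case (monom a b)
  from monom.prems show ?case
  proof induction
    case (monom c d)
    have "bipoly (\<lambda>z. z ^ (a + c) * cnj z ^ (b + d))" by (rule bipoly.monom)
    then show ?case by (simp add: power_add mult_ac)
  next
    case (cmult p c)
    from bipoly.cmult[OF cmult.IH, of c] show ?case by (simp add: mult_ac)
  next
    case (add p q)
    from bipoly.add[OF add.IH] show ?case by (simp add: distrib_left)
  qed
next
  case (cmult p c)
  from bipoly.cmult[OF cmult.IH[OF cmult.prems], of c] show ?case by (simp add: mult_ac)
next
  case (add p1 p2)
  from bipoly.add[OF add.IH[OF add.prems]] show ?case by (simp add: distrib_right)
qed

lemma bipoly_of_real_polynomial:
  assumes "real_polynomial_function p"
  shows "bipoly (\<lambda>z. complex_of_real (p z))"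
  using assms
proof induction
  case (linear f)
  interpret f: bounded_linear f by fact
  \<comment> \<open>A real linear functional written through z and its conjugate, with coefficients
    read off from its values at 1 and \<i>.\<close>
  have 1: "complex_of_real (f z)
      = ((f 1 - \<i> * f \<i>) / 2) * (z ^ 1 * cnj z ^ 0) + ((f 1 + \<i> * f \<i>) / 2) * (z ^ 0 * cnj z ^ 1)" for z
  proof -
    have "z = Re z *\<^sub>R 1 + Im z *\<^sub>R \<i>" by (simp add: complex_eq_iff)
    then have "f z = Re z * f 1 + Im z * f \<i>"
      by (metis f.add f.scaleR real_scaleR_def)
    then show ?thesis by (simp add: complex_eq_iff field_simps)
  qed
  have "bipoly (\<lambda>z. ((f 1 - \<i> * f \<i>) / 2) * (z ^ 1 * cnj z ^ 0)
      + ((f 1 + \<i> * f \<i>) / 2) * (z ^ 0 * cnj z ^ 1))"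
    by (intro bipoly.intros)
  then show ?case by (simp only: 1[symmetric])
next
  case (const c)
  have "bipoly (\<lambda>z. complex_of_real c * (z ^ 0 * cnj z ^ 0))" by (intro bipoly.intros)
  then show ?case by simp
next
  case (add f g)
  from bipoly.add[OF add.IH] show ?case by simp
next
  case (mult f g)
  from bipoly_mult[OF mult.IH] show ?case by simp
qed

lemma bipoly_of_polynomial_function:
  fixes p :: "complex \<Rightarrow> complex"
  assumes "polynomial_function p"
  shows "bipoly p"
proof -
  have "real_polynomial_function (Re \<circ> p)" "real_polynomial_function (Im \<circ> p)"
    using assms bounded_linear_Re bounded_linear_Im unfolding polynomial_function_def by blast+
  then have "bipoly (\<lambda>z. complex_of_real ((Re \<circ> p) z) + \<i> * complex_of_real ((Im \<circ> p) z))"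
    by (intro bipoly.add bipoly.cmult bipoly_of_real_polynomial)
  moreover have "(\<lambda>z. complex_of_real ((Re \<circ> p) z) + \<i> * complex_of_real ((Im \<circ> p) z)) = p"
    by (auto simp: complex_eq_iff)
  ultimately show ?thesis by simp
qed

lemma bipoly_smooth: "bipoly p \<Longrightarrow> smooth p"
proof (induction rule: bipoly.induct)
  case (monom a b)
  show ?case by (intro smooth_mult smooth_power smooth_ident smooth_cnj)
next
  case (cmult p c)
  from cmult.IH show ?case by (rule smooth_cmult)
next
  case (add p q)
  from add.IH show ?case by (rule smooth_add)
qed

lemma cmod_rho_power2:
  assumes "z \<in> unit_disk"
  shows "cmod ((rho z)\<^sup>2) \<le> 1" "rho z \<noteq> 0"
proof -
  have "(cmod z)\<^sup>2 < 1"
    using assms by (simp add: abs_square_less_1)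
  then have *: "0 < 1 - (cmod z)\<^sup>2" "\<bar>1 - (cmod z)\<^sup>2\<bar> \<le> 1" by auto
  show "cmod ((rho z)\<^sup>2) \<le> 1"
    unfolding rho_of_real norm_power norm_of_real by (rule power_le_one[OF abs_ge_zero *(2)])
  show "rho z \<noteq> 0"
    using *(1) unfolding rho_of_real by (metis less_irrefl of_real_eq_0_iff)
qed

text \<open>The weight vanishes only on the circle, so a continuous g can be divided by rho^2 after
  a small regularization. The continuous quotient is approximated uniformly by polynomials on the
  closed disk.\<close>

lemma rho_power2_bipoly_dense: "F \<in> closure {abs_L2 (\<lambda>z. (rho z)\<^sup>2 * p z) |p. bipoly p}"
proof -
  let ?C = "closure {abs_L2 (\<lambda>z. (rho z)\<^sup>2 * p z) |p. bipoly p}"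
  have crho: "continuous_on UNIV (\<lambda>z. (rho z)\<^sup>2)"
    by (intro smooth_continuous smooth_power smooth_rho)
  have meas: "f \<in> borel_measurable area" if "continuous_on UNIV f" for f :: "complex \<Rightarrow> complex"
    using that by (intro measurable_area borel_measurable_continuous_onI)
  have 1: "abs_L2 (\<lambda>z. (rho z)\<^sup>2 * k z) \<in> ?C" if k: "continuous_on UNIV k" for k
  proof -
    have "\<exists>p. polynomial_function p \<and> (\<forall>z\<in>cball 0 1. norm (k z - p z) < 1 / real (Suc n))" for n
      by (intro Stone_Weierstrass_polynomial_function continuous_on_subset[OF k]) auto
    then obtain p where p: "\<And>n. bipoly (p n)"
      and pk: "\<And>n z. z \<in> unit_disk \<Longrightarrow> norm (k z - p n z) < 1 / real (Suc n)"
      using bipoly_of_polynomial_function by (metis ball_subset_cball subsetD)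
    obtain B where B: "\<And>z. z \<in> unit_disk \<Longrightarrow> cmod (k z) \<le> B"
      using continuous_bounded_on_disk[OF k] by blast
    have B0: "0 \<le> B" using B[of 0] by (auto intro: order_trans[OF norm_ge_zero])
    have "(\<lambda>n. abs_L2 (\<lambda>z. (rho z)\<^sup>2 * p n z)) \<longlonglongrightarrow> abs_L2 (\<lambda>z. (rho z)\<^sup>2 * k z)"
    proof (rule abs_L2_tendsto(3))
      show "(\<lambda>z. (rho z)\<^sup>2 * p n z) \<in> borel_measurable area" for n
        by (intro meas continuous_on_mult crho smooth_continuous bipoly_smooth p)
      show "(\<lambda>z. (rho z)\<^sup>2 * k z) \<in> borel_measurable area"
        by (intro meas continuous_on_mult crho k)
      show "square_integrable (\<lambda>z. of_real (B + 1))"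
        by (intro square_integrable_continuous continuous_intros)
      show "AE z in area. (\<lambda>n. (rho z)\<^sup>2 * p n z) \<longlonglongrightarrow> (rho z)\<^sup>2 * k z"
      proof (rule AE_I2, intro tendsto_mult tendsto_const)
        fix z assume z: "z \<in> space area"
        have "(\<lambda>n. k z - p n z) \<longlonglongrightarrow> 0"
        proof (rule Lim_null_comparison)
          show "(\<lambda>n. 1 / real (Suc n)) \<longlonglongrightarrow> 0"
            using LIMSEQ_inverse_real_of_nat by (simp add: inverse_eq_divide)
          show "\<forall>\<^sub>F n in sequentially. norm (k z - p n z) \<le> 1 / real (Suc n)"
            using pk[of z] z by (intro always_eventually) (simp add: less_imp_le)
        qed
        from tendsto_diff[OF tendsto_const[of "k z"] this] show "(\<lambda>n. p n z) \<longlonglongrightarrow> k z" by simp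
      qed
      show "AE z in area. cmod ((rho z)\<^sup>2 * p n z) \<le> cmod (of_real (B + 1))" for n
      proof (rule AE_I2)
        fix z assume "z \<in> space area"
        then have z: "z \<in> unit_disk" by simp
        have "1 / real (Suc n) \<le> 1" by simp
        then have "cmod (p n z) \<le> B + 1"
          using B[OF z] pk[OF z, of n] norm_triangle_ineq2[of "p n z" "k z"]
          unfolding norm_minus_commute[of "k z"] by linarith
        then have "cmod ((rho z)\<^sup>2) * cmod (p n z) \<le> 1 * (B + 1)"
          using cmod_rho_power2[OF z] by (intro mult_mono) auto
        then show "cmod ((rho z)\<^sup>2 * p n z) \<le> cmod (of_real (B + 1))"
          using B0 by (simp only: norm_mult norm_of_real) simp
      qed
    qed
    then show ?thesis
      unfolding closure_sequential using p by (intro exI[of _ "\<lambda>n. abs_L2 (\<lambda>z. (rho z)\<^sup>2 * p n z)"]) blast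
  qed
  have 2: "abs_L2 g \<in> ?C" if g: "continuous_on UNIV g" for g
  proof -
    \<comment> \<open>Adding 1/(n+1) keeps the denominator positive on the whole plane, and rho^2 /
      d stays in [0, 1], so that g itself dominates.\<close>
    define d where "d n z = (1 - (cmod z)\<^sup>2)\<^sup>2 + 1 / real (Suc n)" for n z
    have dpos: "d n z > 0" for n z
      unfolding d_def by (intro add_nonneg_pos) auto
    have cont: "continuous_on UNIV (\<lambda>z. g z / of_real (d n z))" for n
      using dpos[of n] unfolding d_def
      by (intro continuous_intros g) (metis less_irrefl of_real_eq_0_iff)
    have r2: "(rho z)\<^sup>2 = of_real ((1 - (cmod z)\<^sup>2)\<^sup>2)" for z
      by (simp add: rho_of_real)
    have "(\<lambda>n. abs_L2 (\<lambda>z. (rho z)\<^sup>2 * (g z / of_real (d n z)))) \<longlonglongrightarrow> abs_L2 g"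
    proof (rule abs_L2_tendsto(3)[where h = g])
      show "(\<lambda>z. (rho z)\<^sup>2 * (g z / of_real (d n z))) \<in> borel_measurable area" for n
        by (intro meas continuous_on_mult crho cont)
      show "AE z in area. (\<lambda>n. (rho z)\<^sup>2 * (g z / of_real (d n z))) \<longlonglongrightarrow> g z"
      proof (rule AE_I2)
        fix z assume "z \<in> space area"
        then have z: "rho z \<noteq> 0" by (intro cmod_rho_power2(2)) simp
        have "(\<lambda>n. d n z) \<longlonglongrightarrow> (1 - (cmod z)\<^sup>2)\<^sup>2 + 0"
          unfolding d_def using LIMSEQ_inverse_real_of_nat
          by (intro tendsto_intros) (simp add: inverse_eq_divide)
        then have "(\<lambda>n. (rho z)\<^sup>2 * (g z / of_real (d n z))) \<longlonglongrightarrow> (rho z)\<^sup>2 * (g z / (rho z)\<^sup>2)"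
          using z unfolding r2 by (intro tendsto_intros) (auto simp: rho_of_real simp flip: of_real_power)
        then show "(\<lambda>n. (rho z)\<^sup>2 * (g z / of_real (d n z))) \<longlonglongrightarrow> g z"
          using z by simp
      qed
      show "AE z in area. cmod ((rho z)\<^sup>2 * (g z / of_real (d n z))) \<le> cmod (g z)" for n
      proof (rule AE_I2)
        fix z
        have "(1 - (cmod z)\<^sup>2)\<^sup>2 \<le> d n z" by (simp add: d_def)
        then have "(1 - (cmod z)\<^sup>2)\<^sup>2 * cmod (g z) \<le> d n z * cmod (g z)"
          by (intro mult_right_mono) auto
        then show "cmod ((rho z)\<^sup>2 * (g z / of_real (d n z))) \<le> cmod (g z)"
          using dpos[of n z] unfolding r2 norm_mult norm_divide norm_of_real
          by (simp add: divide_simps mult.commute)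
      qed
    qed (use g in \<open>auto intro: meas square_integrable_continuous\<close>)
    then have "abs_L2 g \<in> closure ?C"
      unfolding closure_sequential[of _ ?C] using 1[OF cont]
      by (intro exI[of _ "\<lambda>n. abs_L2 (\<lambda>z. (rho z)\<^sup>2 * (g z / of_real (d n z)))"]) simp
    then show ?thesis by simp
  qed
  have "closure {abs_L2 g |g. continuous_on UNIV g} \<subseteq> ?C"
    using 2 by (intro closure_minimal) auto
  with continuous_dense[of F] show ?thesis by blast
qed

section \<open>Self-adjointness of the maximal operator\<close>

definition weighted_monom :: "nat \<Rightarrow> nat \<Rightarrow> nat \<Rightarrow> complex \<Rightarrow> complex" where
  "weighted_monom a b s z = z ^ a * cnj z ^ b * rho z ^ s"

lemma smooth_weighted_monom: "smooth (weighted_monom a b s)"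
  unfolding weighted_monom_def[abs_def]
  by (intro smooth_mult smooth_power smooth_ident smooth_cnj smooth_rho)

lemma has_wirtinger_weighted_monom:
  "has_wirtinger (weighted_monom a b s)
    (of_nat a * weighted_monom (a - 1) b s z - of_nat s * weighted_monom a (b + 1) (s - 1) z)
    (of_nat b * weighted_monom a (b - 1) s z - of_nat s * weighted_monom (a + 1) b (s - 1) z) z"
proof -
  have "has_wirtinger (\<lambda>z. z ^ a * cnj z ^ b * rho z ^ s)
    ((of_nat a * z ^ (a - 1) * 1 * cnj z ^ b + z ^ a * (of_nat b * cnj z ^ (b - 1) * cnj 0)) * rho z ^ s
      + z ^ a * cnj z ^ b * (of_nat s * rho z ^ (s - 1) * (- cnj z)))
    ((of_nat a * z ^ (a - 1) * 0 * cnj z ^ b + z ^ a * (of_nat b * cnj z ^ (b - 1) * cnj 1)) * rho z ^ s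
      + z ^ a * cnj z ^ b * (of_nat s * rho z ^ (s - 1) * (- z))) z"
    by (intro has_wirtinger_mult has_wirtinger_power has_wirtinger_rho has_wirtinger_cnj has_wirtinger_ident)
  then show ?thesis
    unfolding weighted_monom_def[abs_def] by (rule has_wirtinger_eq) (simp_all add: algebra_simps)
qed

text \<open>The product z cnj z is replaced by 1 - rho, which turns the one monomial of higher
  degree into the first two terms. Exponents reduced by truncated subtraction are harmless: a factor
  a, b or s vanishes exactly where they would be wrong.\<close>

lemma Delta_weighted_monom:
  "Delta (weighted_monom a b s) z
    = - 4 * of_nat (s * (s + 1)) * weighted_monom a b s z
      + 4 * of_nat (b * (s + 2) + s * (a + 1) + s * (s + 1)) * weighted_monom a b (s + 1) z
      - 4 * of_nat (a * b) * weighted_monom (a - 1) (b - 1) (s + 2) z"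
proof -
  note hw = has_wirtinger_weighted_monom
  have bar: "wirtinger_bar (weighted_monom a b s)
      = (\<lambda>z. of_nat b * weighted_monom a (b - 1) s z - of_nat s * weighted_monom (a + 1) b (s - 1) z)"
    using has_wirtinger_imp(4)[OF hw] by blast
  have e: "(rho z)\<^sup>2 * wirtinger_bar (weighted_monom a b s) z
      = of_nat b * weighted_monom a (b - 1) (s + 2) z - of_nat s * weighted_monom (a + 1) b (s + 1) z" for z
    unfolding bar weighted_monom_def by (cases s) (simp_all add: algebra_simps power2_eq_square)
  have w: "wirtinger (\<lambda>z. of_nat b * weighted_monom a (b - 1) (s + 2) z - of_nat s * weighted_monom (a + 1) b (s + 1) z) z
    = of_nat b * (of_nat a * weighted_monom (a - 1) (b - 1) (s + 2) z
         - of_nat (s + 2) * weighted_monom a (b - 1 + 1) (s + 2 - 1) z)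
      - of_nat s * (of_nat (a + 1) * weighted_monom (a + 1 - 1) b (s + 1) z
         - of_nat (s + 1) * weighted_monom (a + 1) (b + 1) (s + 1 - 1) z)"
    by (rule has_wirtinger_imp(3)[OF has_wirtinger_diff[OF has_wirtinger_cmult[OF hw] has_wirtinger_cmult[OF hw]]])
  have P: "weighted_monom (a + 1) (b + 1) s z = weighted_monom a b s z - weighted_monom a b (s + 1) z"
    by (simp add: weighted_monom_def rho_def algebra_simps)
  have Q: "of_nat b * weighted_monom a (b - 1 + 1) (s + 1) z = of_nat b * weighted_monom a b (s + 1) z"
    by (cases b) auto
  have R: "of_nat b * (of_nat a * weighted_monom (a - 1) (b - 1) (s + 2) z
         - of_nat (s + 2) * weighted_monom a (b - 1 + 1) (s + 2 - 1) z)
      = of_nat b * (of_nat a * weighted_monom (a - 1) (b - 1) (s + 2) z)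
         - of_nat (s + 2) * (of_nat b * weighted_monom a b (s + 1) z)"
    unfolding Q[symmetric] by (simp add: right_diff_distrib mult.left_commute)
  then show ?thesis
    unfolding Delta_def e w R by (simp add: P[simplified] algebra_simps)
qed

definition in_range :: "(complex \<Rightarrow> complex) \<Rightarrow> bool" where
  "in_range f \<longleftrightarrow> (\<exists>q. smooth q \<and> f = (\<lambda>z. Delta q z + 8 * q z))"

lemma in_range_cmult:
  assumes "in_range f"
  shows "in_range (\<lambda>z. c * f z)"
proof -
  obtain q where q: "smooth q" "f = (\<lambda>z. Delta q z + 8 * q z)"
    using assms by (auto simp: in_range_def)
  then show ?thesis
    unfolding in_range_def using smooth_cmult[OF q(1), of c]
    by (intro exI[of _ "\<lambda>z. c * q z"]) (simp add: Delta_cmult algebra_simps)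
qed

lemma in_range_add:
  assumes "in_range f" "in_range g"
  shows "in_range (\<lambda>z. f z + g z)"
proof -
  obtain p q where q: "smooth p" "f = (\<lambda>z. Delta p z + 8 * p z)" "smooth q" "g = (\<lambda>z. Delta q z + 8 * q z)"
    using assms by (auto simp: in_range_def)
  then show ?thesis
    unfolding in_range_def using smooth_add[OF q(1,3)]
    by (intro exI[of _ "\<lambda>z. p z + q z"]) (simp add: Delta_add algebra_simps)
qed

text \<open>The formula for \<open>Delta_weighted_monom\<close> is solved for the term with one more
  \<open>rho\<close>; its coefficient k is nonzero because s \<ge> 1. The other two monomials must
  be in the range already or carry the coefficient zero.\<close>

lemma in_range_weighted_monom_step:
  assumes "s = 1 \<or> in_range (weighted_monom a b s)" "1 \<le> s"
    and "a * b = 0 \<or> in_range (weighted_monom (a - 1) (b - 1) (s + 2))"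
  shows "in_range (weighted_monom a b (s + 1))"
proof -
  define k where "k = (of_nat (4 * (b * (s + 2) + s * (a + 1) + s * (s + 1))) :: complex)"
  have "4 * (b * (s + 2) + s * (a + 1) + s * (s + 1)) \<noteq> 0" using assms(2) by simp
  then have k: "k \<noteq> 0" unfolding k_def of_nat_eq_0_iff .
  have zero: "in_range (\<lambda>z. 0 * f z)" for f
  proof -
    have "in_range (\<lambda>z. Delta (\<lambda>z. 1) z + 8 * 1)"
      unfolding in_range_def using smooth_const[of 1] by blast
    from in_range_cmult[OF this, of 0] show ?thesis by simp
  qed
  have 1: "in_range (\<lambda>z. (4 * of_nat (s * (s + 1)) - 8) * weighted_monom a b s z)"
    using assms(1)
  proof
    \<comment> \<open>Here 4 s (s + 1) - 8 = 0.\<close>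
    assume "s = 1"
    then show ?thesis using zero[of "weighted_monom a b s"] by simp
  qed (rule in_range_cmult)
  have 2: "in_range (\<lambda>z. 4 * of_nat (a * b) * weighted_monom (a - 1) (b - 1) (s + 2) z)"
    using assms(3)
  proof
    assume ab: "a * b = 0"
    show ?thesis unfolding ab using zero[of "weighted_monom (a - 1) (b - 1) (s + 2)"] by simp
  qed (rule in_range_cmult)
  have 3: "in_range (\<lambda>z. Delta (weighted_monom a b s) z + 8 * weighted_monom a b s z)"
    unfolding in_range_def using smooth_weighted_monom by blast
  have eq: "(1 / k) * (((4 * of_nat (s * (s + 1)) - 8) * weighted_monom a b s z
       + 4 * of_nat (a * b) * weighted_monom (a - 1) (b - 1) (s + 2) z)
      + (Delta (weighted_monom a b s) z + 8 * weighted_monom a b s z)) = weighted_monom a b (s + 1) z" for z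
  proof -
    have "((4 * of_nat (s * (s + 1)) - 8) * weighted_monom a b s z
       + 4 * of_nat (a * b) * weighted_monom (a - 1) (b - 1) (s + 2) z)
      + (Delta (weighted_monom a b s) z + 8 * weighted_monom a b s z) = k * weighted_monom a b (s + 1) z"
      unfolding Delta_weighted_monom k_def by (simp add: algebra_simps)
    then show ?thesis using k by simp
  qed
  from in_range_cmult[OF in_range_add[OF in_range_add[OF 1 2] 3], of "1 / k"]
  show ?thesis unfolding eq .
qed

text \<open>
  The shift 8 is chosen so that the coefficient of \<open>z\<^sup>a cnj z\<^sup>b \<rho>\<close> in its own image vanishes, which starts
  the induction on the power of \<open>\<rho>\<close>.
\<close>

lemma in_range_weighted_monom: "in_range (weighted_monom a b (s + 2))"
\<comment> \<open>The outer induction supplies the monomial with a - 1, b - 1 and a higher power of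
  \<open>rho\<close>, hence b and s are arbitrary; for a = 0 this term is absent. The inner
  induction raises the power of \<open>rho\<close>.\<close>
proof (induction a arbitrary: b s)
  case 0
  show ?case
  proof (induction s)
    case 0
    show ?case using in_range_weighted_monom_step[of 1 0 b] by (simp add: numeral_2_eq_2)
  next
    case (Suc s)
    then show ?case using in_range_weighted_monom_step[of "s + 2" 0 b] by simp
  qed
next
  case (Suc a)
  note IH = Suc.IH
  show ?case
  proof (induction s)
    case 0
    show ?case
      using in_range_weighted_monom_step[of 1 "Suc a" b] IH[of "b - 1" 1] by (simp add: numeral_2_eq_2)
  next
    case (Suc s)
    then show ?case
      using in_range_weighted_monom_step[of "s + 2" "Suc a" b] IH[of "b - 1" "s + 2"] by simp
  qed
qed

lemma in_range_rho_power2_bipoly: "bipoly p \<Longrightarrow> in_range (\<lambda>z. (rho z)\<^sup>2 * p z)"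
proof (induction rule: bipoly.induct)
  case (monom a b)
  show ?case
    using in_range_weighted_monom[of a b 0] by (simp add: weighted_monom_def[abs_def] mult.commute power2_eq_square)
next
  case (cmult p c)
  from in_range_cmult[OF cmult.IH, of c] show ?case by (simp add: mult.left_commute)
next
  case (add p q)
  from in_range_add[OF add.IH] show ?case by (simp add: distrib_left)
qed

lemma range_dense:
  "F \<in> closure {abs_L2 (\<lambda>z. Delta q z + 8 * q z) |q. smooth q}"
proof -
  have "{abs_L2 (\<lambda>z. (rho z)\<^sup>2 * p z) |p. bipoly p} \<subseteq> {abs_L2 (\<lambda>z. Delta q z + 8 * q z) |q. smooth q}"
    using in_range_rho_power2_bipoly unfolding in_range_def by fastforce
  from closure_mono[OF this] rho_power2_bipoly_dense[of F] show ?thesis by blast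
qed

lemma smooth_dense: "F \<in> closure {abs_L2 q |q. smooth q}"
proof -
  have "{abs_L2 (\<lambda>z. Delta q z + 8 * q z) |q. smooth q} \<subseteq> {abs_L2 q |q. smooth q}"
    using smooth_add[OF smooth_Delta smooth_cmult] by blast
  from closure_mono[OF this] range_dense[of F] show ?thesis by blast
qed

text \<open>The extension of \<open>\<rho>\<^sup>2\<close> by zero is continuously differentiable, so there is no boundary term.\<close>

lemma integral_wirtinger_rho_power2:
  assumes g: "smooth g"
  shows "(LINT z|area. wirtinger (\<lambda>z. (rho z)\<^sup>2 * g z) z) = 0"
proof -
  \<comment> \<open>Outside the closed disk \<open>rho\<close> is negative rather than zero, so its
    positive part is used; the two agree on the disk.\<close>
  define r where "r z = max 0 (1 - (cmod z)\<^sup>2)" for z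
  have d: "((\<lambda>x. (max 0 x)\<^sup>2) has_real_derivative 2 * max 0 x) (at x)" for x :: real
  proof -
    consider "x > 0" | "x < 0" | "x = 0" by linarith
    then show ?thesis
    proof cases
      case 1
      have "((\<lambda>x. x\<^sup>2) has_real_derivative 2 * max 0 x) (at x)"
        using 1 by (auto intro!: derivative_eq_intros)
      then show ?thesis
        by (rule has_field_derivative_transform_within_open[where S = "{0<..}"]) (use 1 in auto)
    next
      case 2
      have "((\<lambda>x. 0) has_real_derivative 2 * max 0 x) (at x)"
        using 2 by auto
      then show ?thesis
        by (rule has_field_derivative_transform_within_open[where S = "{..<0}"]) (use 2 in auto)
    next
      case 3
      have "((\<lambda>h::real. max 0 h) \<longlongrightarrow> max 0 0) (at 0)" by (intro tendsto_intros)
      moreover have "\<forall>\<^sub>F h::real in at 0. max 0 h = ((max 0 (0 + h))\<^sup>2 - (max 0 0)\<^sup>2) / h"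
        by (auto simp: eventually_at_filter max_def power2_eq_square)
      ultimately have "((\<lambda>h::real. ((max 0 (0 + h))\<^sup>2 - (max 0 0)\<^sup>2) / h) \<longlongrightarrow> max 0 0) (at 0)"
        by (rule Lim_transform_eventually)
      then show ?thesis using 3 by (simp add: DERIV_def)
    qed
  qed
  have "has_wirtinger (\<lambda>z. complex_of_real (1 - (cmod z)\<^sup>2)) (- cnj z) (- z) z" for z
    using has_wirtinger_rho[of z] by (simp add: rho_of_real[abs_def])
  from has_wirtinger_mult[OF has_wirtinger_real_chain[OF d this] smooth_has_wirtinger[OF g]]
  have w: "has_wirtinger (\<lambda>z. of_real ((r z)\<^sup>2) * g z)
    (of_real (2 * r z) * (- cnj z) * g z + of_real ((r z)\<^sup>2) * wirtinger g z)
    (of_real (2 * r z) * (- z) * g z + of_real ((r z)\<^sup>2) * wirtinger_bar g z) z" for z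
    unfolding r_def .
  have "(LINT z|area. of_real (2 * r z) * (- cnj z) * g z + of_real ((r z)\<^sup>2) * wirtinger g z) = 0"
  proof (rule integral_wirtinger_eq_0(1)[OF w])
    have cr: "continuous_on UNIV r"
      unfolding r_def by (intro continuous_intros)
    note c = cr smooth_continuous[OF g] smooth_continuous[OF smooth_wirtinger[OF g]]
      smooth_continuous[OF smooth_wirtinger_bar[OF g]]
    show "continuous_on UNIV (\<lambda>z. of_real (2 * r z) * (- cnj z) * g z + of_real ((r z)\<^sup>2) * wirtinger g z)"
      "continuous_on UNIV (\<lambda>z. of_real (2 * r z) * (- z) * g z + of_real ((r z)\<^sup>2) * wirtinger_bar g z)"
      by (intro continuous_intros c)+
    show "of_real ((r z)\<^sup>2) * g z = 0" if "z \<notin> unit_disk" for z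
    proof -
      have "1 \<le> (cmod z)\<^sup>2" using that by simp
      then show ?thesis by (simp add: r_def)
    qed
  qed
  moreover have "wirtinger (\<lambda>z. (rho z)\<^sup>2 * g z) z
      = of_real (2 * r z) * (- cnj z) * g z + of_real ((r z)\<^sup>2) * wirtinger g z" if "z \<in> unit_disk" for z
  proof -
    have "(cmod z)\<^sup>2 < 1" using that by (simp add: abs_square_less_1)
    then have "complex_of_real (r z) = rho z" by (simp add: r_def rho_of_real)
    with has_wirtinger_imp(3)[OF has_wirtinger_mult[OF has_wirtinger_rho_power2 smooth_has_wirtinger[OF g]], of z]
    show ?thesis by simp
  qed
  ultimately show ?thesis
    by (subst Bochner_Integration.integral_cong[OF refl]) auto
qed

text \<open>With u = rho^2 dbar p, the z derivative of u cnj p has integral zero. The product rule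
  then moves the derivative to cnj p and leaves a square.\<close>

lemma inner_Delta_self:
  assumes p: "smooth p"
  shows "inner_L2 (abs_L2 (Delta p)) (abs_L2 p)
    = of_real (4 * (LINT z|area. (cmod (rho z * wirtinger_bar p z))\<^sup>2))"
proof -
  define u where "u = (\<lambda>z. (rho z)\<^sup>2 * wirtinger_bar p z)"
  have su: "smooth u"
    unfolding u_def by (intro smooth_mult smooth_power smooth_rho smooth_wirtinger_bar p)
  have e: "(rho z)\<^sup>2 * (wirtinger_bar p z * cnj (p z)) = u z * cnj (p z)" for z
    by (simp add: u_def)
  have sq: "u z * cnj (wirtinger_bar p z) = of_real ((cmod (rho z * wirtinger_bar p z))\<^sup>2)" for z
    unfolding complex_norm_square u_def by (simp add: power2_eq_square mult_ac)
  have "(LINT z|area. wirtinger (\<lambda>z. u z * cnj (p z)) z) = 0"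
    using integral_wirtinger_rho_power2[of "\<lambda>z. wirtinger_bar p z * cnj (p z)"] p
    unfolding e by (simp add: smooth_mult smooth_cnj smooth_wirtinger_bar)
  moreover have "wirtinger (\<lambda>z. u z * cnj (p z)) z = wirtinger u z * cnj (p z) + u z * cnj (wirtinger_bar p z)" for z
    using has_wirtinger_imp(3)[OF has_wirtinger_mult[OF smooth_has_wirtinger[OF su]
          has_wirtinger_cnj[OF smooth_has_wirtinger[OF p]]], of z] .
  ultimately have "(LINT z|area. wirtinger u z * cnj (p z) + u z * cnj (wirtinger_bar p z)) = 0"
    by simp
  then have "(LINT z|area. wirtinger u z * cnj (p z)) = - (LINT z|area. u z * cnj (wirtinger_bar p z))"
    by (subst (asm) Bochner_Integration.integral_add)
       (auto intro!: integrable_area_continuous smooth_continuous smooth_mult smooth_wirtinger smooth_wirtinger_bar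
          smooth_cnj su p simp: eq_neg_iff_add_eq_0)
  moreover have "inner_L2 (abs_L2 (Delta p)) (abs_L2 p) = - 4 * (LINT z|area. wirtinger u z * cnj (p z))"
    unfolding inner_L2_abs[OF square_integrable_smooth[OF smooth_Delta[OF p]] square_integrable_smooth[OF p]]
    unfolding Delta_def u_def mult.assoc by (rule integral_mult_right_zero)
  ultimately show ?thesis
    unfolding sq by (simp del: of_real_power)
qed

lemma norm_le_norm_Delta_plus:
  assumes p: "smooth p"
  shows "8 * norm (abs_L2 p) \<le> norm (abs_L2 (\<lambda>z. Delta p z + 8 * p z))"
proof -
  have "8 * (norm (abs_L2 p))\<^sup>2 \<le> inner (abs_L2 (\<lambda>z. Delta p z + 8 * p z)) (abs_L2 p)"
  proof -
    have "abs_L2 (\<lambda>z. Delta p z + 8 * p z) = abs_L2 (Delta p) + 8 *\<^sub>R abs_L2 p"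
      by (simp add: scaleR_eq_scaleC scaleC_abs plus_abs square_integrable_smooth smooth_cmult smooth_Delta p)
    moreover have "inner (abs_L2 (Delta p)) (abs_L2 p) \<ge> 0"
      by (simp add: inner_disk_L2_def inner_Delta_self p)
    ultimately show ?thesis
      by (simp add: inner_add_left power2_norm_eq_inner)
  qed
  also have "\<dots> \<le> norm (abs_L2 (\<lambda>z. Delta p z + 8 * p z)) * norm (abs_L2 p)"
    by (rule norm_cauchy_schwarz)
  finally have "(8 * norm (abs_L2 p)) * norm (abs_L2 p) \<le> norm (abs_L2 (\<lambda>z. Delta p z + 8 * p z)) * norm (abs_L2 p)"
    by (simp add: power2_eq_square)
  then show ?thesis
    by (cases "norm (abs_L2 p) = 0") (auto simp: mult_le_cancel_right)
qed

text \<open>This says that the maximal operator is contained in the adjoint of \<open>Delta\<close>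
  on functions smooth up to the boundary. For this, testing with compact support would not be
  enough.\<close>

lemma inner_Delta_max_smooth:
  assumes "(F, G) \<in> Delta_max" "smooth p"
  shows "inner_L2 G (abs_L2 p) = inner_L2 F (abs_L2 (Delta p))"
proof -
  have s: "smooth (\<lambda>z. cnj (p z))" by (rule smooth_cnj) fact
  have "distr_of G (\<lambda>z. cnj (p z)) = distr_of F (\<lambda>z. cnj (Delta p z))"
    using Delta_max_smooth[OF assms(1) s] Delta_transpose_cnj[OF assms(2)] by presburger
  then show ?thesis
    by (simp add: distr_of_eq_inner square_integrable_smooth smooth_cnj smooth_Delta assms(2))
qed

lemma Delta_max_add:
  assumes "(F, G) \<in> Delta_max" "(F', G') \<in> Delta_max"
  shows "(F + F', G + G') \<in> Delta_max"
  using assms unfolding Delta_max_iff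
  by (simp add: distr_of_eq_inner inner_L2_add_left square_integrable_smooth test_functionD(1) smooth_Delta_transpose)

lemma Delta_max_scaleC:
  assumes "(F, G) \<in> Delta_max"
  shows "(scaleC_L2 c F, scaleC_L2 c G) \<in> Delta_max"
  using assms unfolding Delta_max_iff
  by (simp add: distr_of_eq_inner inner_L2_scaleC_left square_integrable_smooth test_functionD(1) smooth_Delta_transpose)

lemma Delta_max_diff:
  assumes "(F, G) \<in> Delta_max" "(F', G') \<in> Delta_max"
  shows "(F - F', G - G') \<in> Delta_max"
  using Delta_max_add[OF assms(1) Delta_max_scaleC[OF assms(2), of "-1"]]
  by (simp add: minus_disk_L2_def minus_eq_scaleC)

text \<open>The bound passes to the limit along elements of S converging to U itself, giving |U|^2
  \<le> c |U|.\<close>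

lemma norm_le_of_inner_le_dense:
  fixes U :: "'a::real_inner"
  assumes "U \<in> closure S" "\<And>V. V \<in> S \<Longrightarrow> inner U V \<le> c * norm V" "0 \<le> c"
  shows "norm U \<le> c"
proof -
  obtain f where f: "\<And>n. f n \<in> S" "f \<longlonglongrightarrow> U"
    using assms(1) unfolding closure_sequential by blast
  have "inner U U \<le> c * norm U"
  proof (rule LIMSEQ_le)
    show "(\<lambda>n. inner U (f n)) \<longlonglongrightarrow> inner U U" "(\<lambda>n. c * norm (f n)) \<longlonglongrightarrow> c * norm U"
      by (intro tendsto_intros f(2))+
  qed (use assms(2) f(1) in blast)
  then have "norm U * norm U \<le> c * norm U"
    by (simp add: power2_norm_eq_inner flip: power2_eq_square)
  then show ?thesis
    using assms(3) by (cases "U = 0") (auto simp: mult_le_cancel_right)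
qed

text \<open>F is paired with V = (\<Delta> + 8) q from the dense range. The operator moves onto F,
  and |q| \<le> |V| / 8 from the smooth case turns the pairing into a bound on F.\<close>

lemma norm_le_norm_Delta_max_plus:
  assumes "(F, G) \<in> Delta_max"
  shows "8 * norm F \<le> norm (G + 8 *\<^sub>R F)"
proof -
  have "norm F \<le> norm (G + 8 *\<^sub>R F) / 8"
  proof (rule norm_le_of_inner_le_dense[OF range_dense])
    fix V assume "V \<in> {abs_L2 (\<lambda>z. Delta q z + 8 * q z) |q. smooth q}"
    then obtain q where q: "smooth q" and V: "V = abs_L2 (\<lambda>z. Delta q z + 8 * q z)" by auto
    have V': "V = abs_L2 (Delta q) + 8 *\<^sub>R abs_L2 q"
      unfolding V by (simp add: scaleR_eq_scaleC scaleC_abs plus_abs square_integrable_smooth smooth_cmult smooth_Delta q)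
    have "inner F (abs_L2 (Delta q)) = inner G (abs_L2 q)"
      using inner_Delta_max_smooth[OF assms q] by (simp add: inner_disk_L2_def)
    then have "inner F V = inner (G + 8 *\<^sub>R F) (abs_L2 q)"
      by (simp add: V' inner_add_left inner_add_right)
    also have "\<dots> \<le> norm (G + 8 *\<^sub>R F) * norm (abs_L2 q)"
      by (rule norm_cauchy_schwarz)
    also have "\<dots> \<le> norm (G + 8 *\<^sub>R F) * (norm V / 8)"
      using norm_le_norm_Delta_plus[OF q] unfolding V by (intro mult_left_mono) auto
    finally show "inner F V \<le> norm (G + 8 *\<^sub>R F) / 8 * norm V" by simp
  qed auto
  then show ?thesis by simp
qed

text \<open>G is orthogonal to all smooth functions. Besides single valuedness, this serves as the
  statement that an L^2 function vanishing as a distribution is zero.\<close>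

lemma Delta_max_zero_left: "(0, G) \<in> Delta_max \<Longrightarrow> G = 0"
proof -
  assume G: "(0, G) \<in> Delta_max"
  have "norm G \<le> 0"
  proof (rule norm_le_of_inner_le_dense[OF smooth_dense])
    fix V assume "V \<in> {abs_L2 q |q. smooth q}"
    moreover have "inner_L2 0 X = 0" for X
      using inner_L2_add_left[of 0 0 X] by simp
    ultimately show "inner G V \<le> 0 * norm V"
      using inner_Delta_max_smooth[OF G] by (auto simp: inner_disk_L2_def)
  qed auto
  then show "G = 0" by simp
qed

text \<open>Smooth functions form a core because \<open>\<Delta> + 8\<close> is bounded below and has dense range on them.\<close>

lemma Delta_max_approx:
  assumes FG: "(F, G) \<in> Delta_max"
  obtains p where "\<And>n. smooth (p n)" "(\<lambda>n. abs_L2 (p n)) \<longlonglongrightarrow> F" "(\<lambda>n. abs_L2 (Delta (p n))) \<longlonglongrightarrow> G"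
proof -
  obtain Y where "\<And>n. Y n \<in> {abs_L2 (\<lambda>z. Delta q z + 8 * q z) |q. smooth q}" and Y: "Y \<longlonglongrightarrow> G + 8 *\<^sub>R F"
    using range_dense[of "G + 8 *\<^sub>R F"] unfolding closure_sequential by blast
  then have "\<forall>n. \<exists>q. smooth q \<and> Y n = abs_L2 (\<lambda>z. Delta q z + 8 * q z)" by blast
  then obtain p where p: "\<And>n. smooth (p n)" and Yp: "\<And>n. Y n = abs_L2 (\<lambda>z. Delta (p n) z + 8 * p n z)"
    by metis
  have Yp': "Y n = abs_L2 (Delta (p n)) + 8 *\<^sub>R abs_L2 (p n)" for n
    unfolding Yp by (simp add: scaleR_eq_scaleC scaleC_abs plus_abs square_integrable_smooth smooth_cmult smooth_Delta p)
  \<comment> \<open>The bound is applied to the difference of two pairs of the maximal operator;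
    adding 8 times its first component to the second gives Y n - (G + 8 F).\<close>
  have bd: "norm (abs_L2 (p n) - F) \<le> norm (Y n - (G + 8 *\<^sub>R F)) / 8" for n
    using norm_le_norm_Delta_max_plus[OF Delta_max_diff[OF smooth_in_Delta_max[OF p[of n]] FG]]
    unfolding Yp' by (simp add: algebra_simps)
  have "(\<lambda>n. norm (Y n - (G + 8 *\<^sub>R F)) / 8) \<longlonglongrightarrow> 0"
    using Y by (intro tendsto_divide_zero tendsto_norm_zero LIM_zero)
  then have "(\<lambda>n. abs_L2 (p n) - F) \<longlonglongrightarrow> 0"
    by (rule Lim_null_comparison[OF always_eventually, rotated]) (rule allI, rule bd)
  then have 1: "(\<lambda>n. abs_L2 (p n)) \<longlonglongrightarrow> F"
    by (rule LIM_zero_cancel)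
  have "(\<lambda>n. Y n - 8 *\<^sub>R abs_L2 (p n)) \<longlonglongrightarrow> G + 8 *\<^sub>R F - 8 *\<^sub>R F"
    by (intro tendsto_intros Y 1)
  then have "(\<lambda>n. abs_L2 (Delta (p n))) \<longlonglongrightarrow> G"
    by (simp add: Yp')
  with p 1 that show thesis by blast
qed

text \<open>One pair is approximated by smooth functions in the graph norm, and the other needs to
  be tested against smooth functions only.\<close>

lemma Delta_max_symmetric:
  assumes FG: "(F, G) \<in> Delta_max" and HK: "(H, K) \<in> Delta_max"
  shows "inner_L2 G H = inner_L2 F K"
proof -
  obtain p where p: "\<And>n. smooth (p n)" "(\<lambda>n. abs_L2 (p n)) \<longlonglongrightarrow> F" "(\<lambda>n. abs_L2 (Delta (p n))) \<longlonglongrightarrow> G"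
    using Delta_max_approx[OF FG] by blast
  have "inner_L2 (abs_L2 (Delta (p n))) H = inner_L2 (abs_L2 (p n)) K" for n
    using inner_Delta_max_smooth[OF HK p(1), of n] by (metis cnj_inner_L2)
  then show ?thesis
    using LIMSEQ_unique[OF tendsto_inner_L2_left[OF p(3), of H]] tendsto_inner_L2_left[OF p(2), of K] by simp
qed

text \<open>One inclusion is symmetry. For the other, conjugates of test functions lie in the
  domain, and the adjoint relation on them is the defining distributional equation.\<close>

lemma adjoint_Delta_max: "adjoint_graph Delta_max = Delta_max"
proof
  show "Delta_max \<subseteq> adjoint_graph Delta_max"
    using Delta_max_symmetric by (auto simp: adjoint_graph_def)
  show "adjoint_graph Delta_max \<subseteq> Delta_max"
  proof (rule subrelI)
    fix H K assume HK: "(H, K) \<in> adjoint_graph Delta_max"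
    show "(H, K) \<in> Delta_max"
      unfolding Delta_max_iff
    proof (intro allI impI)
      fix \<phi> assume "test_function \<phi>"
      then have s: "smooth \<phi>" by (rule test_functionD)
      note sc = smooth_cnj[OF s]
      have d: "Delta_transpose \<phi> z = cnj (Delta (\<lambda>z. cnj (\<phi> z)) z)" for z
        using Delta_transpose_cnj[OF sc, of z] by simp
      have "inner_L2 (abs_L2 (Delta (\<lambda>z. cnj (\<phi> z)))) H = inner_L2 (abs_L2 (\<lambda>z. cnj (\<phi> z))) K"
        using HK smooth_in_Delta_max[OF sc] by (auto simp: adjoint_graph_def)
      then have "inner_L2 H (abs_L2 (Delta (\<lambda>z. cnj (\<phi> z)))) = inner_L2 K (abs_L2 (\<lambda>z. cnj (\<phi> z)))"
        by (metis cnj_inner_L2)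
      then show "distr_of K \<phi> = distr_of H (Delta_transpose \<phi>)"
        by (simp add: distr_of_eq_inner square_integrable_smooth s smooth_Delta_transpose d)
    qed
  qed
qed

lemma zero_in_Delta_max: "(0, 0) \<in> Delta_max"
  using smooth_in_Delta_max[OF smooth_const[of 0]] Delta_max_scaleC[of _ _ 0]
  by (metis norm_eq_zero norm_scaleC_L2 mult_zero_left norm_zero)

lemma linear_operator_Delta_max: "linear_operator Delta_max"
proof -
  have "single_valued Delta_max"
  proof (rule single_valuedI)
    fix F G G' assume "(F, G) \<in> Delta_max" "(F, G') \<in> Delta_max"
    from Delta_max_zero_left[of "G - G'"] Delta_max_diff[OF this] show "G = G'" by simp
  qed
  then show ?thesis
    using zero_in_Delta_max Delta_max_add Delta_max_scaleC by (auto simp: linear_operator_def)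
qed

lemma densely_defined_Delta_tilde: "densely_defined Delta_tilde"
proof -
  have "{abs_L2 q |q. smooth q} \<subseteq> Domain Delta_tilde"
    using smooth_in_Delta_tilde by blast
  from closure_mono[OF this] show ?thesis
    using smooth_dense unfolding densely_defined_def by blast
qed

lemma Delta_tilde_subset: "Delta_tilde \<subseteq> Delta_max"
  by (auto simp: Delta_tilde_iff)

lemma self_adjoint_Delta_max: "self_adjoint Delta_max"
proof -
  have "closure (Domain Delta_tilde) \<subseteq> closure (Domain Delta_max)"
    using Delta_tilde_subset by (intro closure_mono) blast
  then have "densely_defined Delta_max"
    using densely_defined_Delta_tilde by (auto simp: densely_defined_def)
  then show ?thesis
    by (simp add: self_adjoint_def linear_operator_Delta_max adjoint_Delta_max)
qed

text \<open>Each pair of T imposes one condition continuous in the graph point. As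
  \<open>Delta_max\<close> is its own adjoint, it is a closed extension.\<close>

lemma closed_adjoint_graph: "closed (adjoint_graph T)"
proof -
  have "adjoint_graph T = (\<Inter>(F, G)\<in>T. {x. inner_L2 (fst x) G = inner_L2 (snd x) F})"
  proof -
    have "inner_L2 G H = inner_L2 F K \<longleftrightarrow> inner_L2 H G = inner_L2 K F" for F G H K
      by (metis cnj_inner_L2)
    then show ?thesis
      unfolding adjoint_graph_def by auto
  qed
  moreover have "closed {x. inner_L2 (fst x) G = inner_L2 (snd x) F}" for F G
    by (intro closed_Collect_eq continuous_on_compose2[OF continuous_on_inner_L2_left[of UNIV]] continuous_intros) auto
  ultimately show ?thesis
    by (auto intro!: closed_INT)
qed

lemma closable_Delta_tilde: "closable Delta_tilde"
  unfolding closable_def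
  using Delta_tilde_subset linear_operator_Delta_max closed_adjoint_graph[of Delta_max]
  by (auto simp: adjoint_Delta_max)

lemma linear_operator_Delta_tilde: "linear_operator Delta_tilde"
proof -
  have rep_iff: "represents H (distr_dz (distr_of F)) \<longleftrightarrow>
      (\<forall>\<phi>. test_function \<phi> \<longrightarrow> inner_L2 H (abs_L2 (\<lambda>z. cnj (\<phi> z))) = - inner_L2 F (abs_L2 (\<lambda>z. cnj (wirtinger \<phi> z))))" for F H
    by (auto simp: represents_def distr_dz_def distr_of_eq_inner square_integrable_smooth smooth_wirtinger test_functionD(1))
  have add: "represents (H + H') (distr_dz (distr_of (F + F')))"
    if "represents H (distr_dz (distr_of F))" "represents H' (distr_dz (distr_of F'))" for F F' H H'
    using that by (auto simp: rep_iff inner_L2_add_left)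
  have scale: "represents (scaleC_L2 c H) (distr_dz (distr_of (scaleC_L2 c F)))"
    if "represents H (distr_dz (distr_of F))" for c F H
    using that by (auto simp: rep_iff inner_L2_scaleC_left)
  have zero: "represents 0 (distr_dz (distr_of 0))"
  proof -
    have "inner_L2 0 G = 0" for G
      using inner_L2_add_left[of 0 0 G] by simp
    then show ?thesis by (simp add: rep_iff)
  qed
  have "single_valued Delta_tilde"
    using linear_operator_Delta_max Delta_tilde_subset by (auto simp: linear_operator_def intro: single_valued_subset)
  moreover have "(0, 0) \<in> Delta_tilde"
    using zero zero_in_Delta_max by (auto simp: Delta_tilde_iff)
  moreover have "(F + F', G + G') \<in> Delta_tilde" if "(F, G) \<in> Delta_tilde" "(F', G') \<in> Delta_tilde" for F G F' G'
    using that Delta_max_add add unfolding Delta_tilde_iff by blast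
  moreover have "(scaleC_L2 c F, scaleC_L2 c G) \<in> Delta_tilde" if "(F, G) \<in> Delta_tilde" for c F G
    using that Delta_max_scaleC scale unfolding Delta_tilde_iff by blast
  ultimately show ?thesis
    unfolding linear_operator_def by blast
qed

section \<open>The restricted operator\<close>

lemma not_AE_area_False: "\<not> (AE z in area. False)"
proof
  assume "AE z in area. False"
  then have "AE z in lborel. z \<notin> unit_disk"
    by (simp add: AE_area_iff)
  then have "unit_disk \<in> null_sets lborel"
    by (subst (asm) AE_iff_null_sets[symmetric]) auto
  then have "negligible unit_disk"
    by (simp add: negligible_iff_null_sets null_sets_completionI)
  then show False
    using open_not_negligible[of unit_disk] by simp
qed

lemma abs_L2_neq_0:
  assumes "square_integrable f" "\<And>z. z \<in> unit_disk \<Longrightarrow> f z \<noteq> 0"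
  shows "abs_L2 f \<noteq> 0"
proof
  assume "abs_L2 f = 0"
  then have "AE z in area. f z = 0"
    by (simp add: zero_abs abs_L2_eq_iff assms(1) square_integrable_zero)
  moreover have "AE z in area. f z \<noteq> 0"
    using assms(2) by (intro AE_I2) simp
  ultimately have "AE z in area. False" by eventually_elim simp
  then show False using not_AE_area_False by blast
qed

text \<open>The z derivative of z rho^(k+2) is (k+3) rho^(k+2) - (k+2) rho^(k+1), and its integral
  is zero. The recursion makes explicit moments and polar coordinates unnecessary.\<close>

lemma integral_rho_power_Suc:
  "of_nat (k + 3) * (LINT z|area. rho z ^ (k + 2)) = of_nat (k + 2) * (LINT z|area. rho z ^ (k + 1))"
proof -
  have i: "integrable area (\<lambda>z. rho z ^ n)" for n
    by (intro integrable_area_continuous smooth_continuous smooth_power smooth_rho)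
  have "(\<lambda>z. (rho z)\<^sup>2 * weighted_monom 1 0 k z) = weighted_monom 1 0 (k + 2)"
    by (simp add: weighted_monom_def[abs_def] fun_eq_iff power_add power2_eq_square mult_ac)
  with integral_wirtinger_rho_power2[OF smooth_weighted_monom[of 1 0 k]]
  have "(LINT z|area. wirtinger (weighted_monom 1 0 (k + 2)) z) = 0" by simp
  moreover have "wirtinger (weighted_monom 1 0 (k + 2)) z = of_nat (k + 3) * rho z ^ (k + 2) - of_nat (k + 2) * rho z ^ (k + 1)" for z
    unfolding has_wirtinger_imp(3)[OF has_wirtinger_weighted_monom]
    by (simp add: weighted_monom_def) (simp add: rho_def algebra_simps)
  ultimately have "(LINT z|area. of_nat (k + 3) * rho z ^ (k + 2) - of_nat (k + 2) * rho z ^ (k + 1)) = 0"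
    by simp
  then have "of_nat (k + 3) * (LINT z|area. rho z ^ (k + 2)) - of_nat (k + 2) * (LINT z|area. rho z ^ (k + 1)) = 0"
    by (simp only: Bochner_Integration.integral_diff[OF integrable_mult_right[OF i] integrable_mult_right[OF i]]
        integral_mult_right_zero)
  then show ?thesis by simp
qed

text \<open>The Rayleigh quotient of rho^s is 2 s^2 / (s + 1), which is at least s for s \<ge> 1, so
  no constant C bounds the operator.\<close>

lemma not_bounded_Delta_tilde: "\<not> bounded_operator Delta_tilde"
proof
  assume "bounded_operator Delta_tilde"
  then obtain C where C: "\<And>F G. (F, G) \<in> Delta_tilde \<Longrightarrow> norm G \<le> C * norm F"
    unfolding bounded_operator_def by blast
  have le: "real s \<le> C" if s: "s \<ge> 1" for s
  proof -
    let ?f = "weighted_monom 0 0 s"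
    define J where "J k = (LINT z|area. rho z ^ k)" for k
    note sf = smooth_weighted_monom[of 0 0 s]
    have i: "integrable area (\<lambda>z. rho z ^ n)" for n
      by (intro integrable_area_continuous smooth_continuous smooth_power smooth_rho)
    have fz: "?f z = rho z ^ s" for z by (simp add: weighted_monom_def)
    have n: "inner_L2 (abs_L2 ?f) (abs_L2 ?f) = J (2 * s)"
      by (simp add: inner_L2_abs square_integrable_smooth sf fz J_def power_mult power2_eq_square power_mult_distrib mult_2 power_add)
    have E: "Delta ?f z * cnj (?f z) = 4 * of_nat (s * (s + 2)) * rho z ^ (2 * s + 1) - 4 * of_nat (s * (s + 1)) * rho z ^ (2 * s)" for z
    proof -
      have "rho z ^ (2 * s) = rho z ^ s * rho z ^ s" "rho z ^ (2 * s + 1) = rho z ^ (s + 1) * rho z ^ s"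
        by (simp_all add: mult_2 power_add)
      then show ?thesis
        unfolding Delta_weighted_monom by (simp add: weighted_monom_def algebra_simps)
    qed
    have "inner_L2 (abs_L2 (Delta ?f)) (abs_L2 ?f)
        = 4 * of_nat (s * (s + 2)) * J (2 * s + 1) - 4 * of_nat (s * (s + 1)) * J (2 * s)"
      unfolding inner_L2_abs[OF square_integrable_smooth[OF smooth_Delta[OF sf]] square_integrable_smooth[OF sf]] J_def E
        Bochner_Integration.integral_diff[OF integrable_mult_right[OF i] integrable_mult_right[OF i]]
        integral_mult_right_zero ..
    moreover have "of_nat (2 * s + 2) * J (2 * s + 1) = of_nat (2 * s + 1) * J (2 * s)"
      using integral_rho_power_Suc[of "2 * s - 1"] s by (simp add: J_def Suc_diff_le)
    \<comment> \<open>Eliminating the moment of order 2s + 1 leaves 2s(s+2)(2s+1) - 4s(s+1)^2 =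
      2s^2.\<close>
    ultimately have "of_nat (s + 1) * inner_L2 (abs_L2 (Delta ?f)) (abs_L2 ?f) = of_nat (2 * s ^ 2) * J (2 * s)"
      by (simp add: algebra_simps power2_eq_square) algebra
    then have "of_nat (s + 1) * inner_L2 (abs_L2 (Delta ?f)) (abs_L2 ?f)
        = of_nat (2 * s ^ 2) * inner_L2 (abs_L2 ?f) (abs_L2 ?f)"
      by (simp only: n)
    from arg_cong[OF this, of Re]
    have "real (s + 1) * inner (abs_L2 (Delta ?f)) (abs_L2 ?f) = real (2 * s ^ 2) * (norm (abs_L2 ?f))\<^sup>2"
      unfolding power2_norm_eq_inner inner_disk_L2_def by (simp del: of_nat_add of_nat_mult of_nat_power of_nat_Suc)
    moreover have "inner (abs_L2 (Delta ?f)) (abs_L2 ?f) \<le> C * (norm (abs_L2 ?f))\<^sup>2"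
    proof -
      have "inner (abs_L2 (Delta ?f)) (abs_L2 ?f) \<le> norm (abs_L2 (Delta ?f)) * norm (abs_L2 ?f)"
        by (rule norm_cauchy_schwarz)
      also have "\<dots> \<le> (C * norm (abs_L2 ?f)) * norm (abs_L2 ?f)"
        by (intro mult_right_mono C smooth_in_Delta_tilde sf) auto
      finally show ?thesis by (simp add: power2_eq_square mult.assoc)
    qed
    moreover have pos: "(norm (abs_L2 ?f))\<^sup>2 > 0"
      using abs_L2_neq_0[OF square_integrable_smooth[OF sf]] cmod_rho_power2(2) by (simp add: fz)
    ultimately have "real (2 * s ^ 2) * (norm (abs_L2 ?f))\<^sup>2 \<le> real (s + 1) * (C * (norm (abs_L2 ?f))\<^sup>2)"
      by (metis mult_left_mono of_nat_0_le_iff)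
    then have "real (2 * s ^ 2) \<le> real (s + 1) * C"
      using pos by (metis mult.assoc mult_le_cancel_right not_less_iff_gr_or_eq)
    moreover have "real (s + 1) * real s \<le> real (2 * s ^ 2)"
    proof -
      have "s + s ^ 2 \<le> 2 * s ^ 2" using s by (simp add: power2_eq_square)
      then have "(s + 1) * s \<le> 2 * s ^ 2" by (simp add: power2_eq_square)
      then show ?thesis by (metis of_nat_le_iff of_nat_mult)
    qed
    ultimately have "real (s + 1) * real s \<le> real (s + 1) * C" by linarith
    then show ?thesis by (subst (asm) mult_le_cancel_left_pos) auto
  qed
  obtain N where "C < real N" using reals_Archimedean2 by blast
  with le[of "Suc N"] show False by simp
qed

lemma zero_in_point_spectrum: "0 \<in> point_spectrum Delta_tilde"
proof -
  have 1: "(\<lambda>z. 1) = weighted_monom 0 0 0"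
    by (simp add: weighted_monom_def[abs_def])
  have "Delta (\<lambda>z. 1) = (\<lambda>z. 0)"
    unfolding 1 by (rule ext) (simp add: Delta_weighted_monom)
  with smooth_in_Delta_tilde[OF smooth_const[of 1]] have "(abs_L2 (\<lambda>z. 1), 0) \<in> Delta_tilde"
    by (simp add: zero_abs)
  moreover have "scaleC_L2 0 F = 0" for F
    using norm_scaleC_L2[of 0 F] by simp
  moreover have "abs_L2 (\<lambda>z. 1) \<noteq> 0"
    by (rule abs_L2_neq_0[OF square_integrable_smooth[OF smooth_const]]) simp
  ultimately show ?thesis
    unfolding point_spectrum_def by (intro CollectI exI[of _ "abs_L2 (\<lambda>z. 1)"]) simp
qed

text \<open>
  The square of this function is a multiple of the singular inner function \<open>exp ((z + 1) / (z - 1))\<close>.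
  On a horocycle at 1 its modulus is constant while its derivative grows like \<open>1 / |z - 1|\<^sup>2\<close>.
\<close>

definition inner_fun :: "complex \<Rightarrow> complex" where
  "inner_fun z = exp (1 / (z - 1))"

definition inner_fun_deriv :: "complex \<Rightarrow> complex" where
  "inner_fun_deriv z = - inner_fun z / (z - 1)\<^sup>2"

lemma has_wirtinger_inner_fun:
  assumes "z \<noteq> 1"
  shows "has_wirtinger inner_fun (inner_fun_deriv z) 0 z"
proof -
  have "(inner_fun has_field_derivative inner_fun_deriv z) (at z)"
    unfolding inner_fun_deriv_def inner_fun_def[abs_def]
    using assms by (auto intro!: derivative_eq_intros simp: power2_eq_square)
  then show ?thesis
    by (simp add: has_field_derivative_def has_wirtinger_def)
qed

lemma continuous_inner_fun: "continuous_on (- {1}) inner_fun" "continuous_on (- {1}) inner_fun_deriv"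
proof -
  show "continuous_on (- {1}) inner_fun"
    unfolding inner_fun_def[abs_def] by (intro continuous_intros) auto
  then show "continuous_on (- {1}) inner_fun_deriv"
    unfolding inner_fun_deriv_def[abs_def] by (intro continuous_intros) auto
qed

section \<open>The singular function: size, derivative and pairing with test functions\<close>

lemma continuous_on_disk_measurable:
  assumes "continuous_on (- {1}) f"
  shows "f \<in> borel_measurable area"
proof -
  have "f \<in> borel_measurable (restrict_space borel unit_disk)"
    by (intro borel_measurable_continuous_on_restrict continuous_on_subset[OF assms]) auto
  moreover have "sets (restrict_space borel unit_disk) = sets area"
    unfolding area_def by (intro sets_restrict_space_cong) simp
  ultimately show ?thesis
    using measurable_cong_sets by blast
qed

lemma norm_inner_fun:
  "cmod (inner_fun z) = exp (- (1 - Re z) / (cmod (z - 1))\<^sup>2)"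
  by (simp add: inner_fun_def Re_divide cmod_power2)

lemma norm_inner_fun_le: "z \<in> unit_disk \<Longrightarrow> cmod (inner_fun z) \<le> 1"
  using complex_Re_le_cmod[of z] by (auto simp: norm_inner_fun divide_le_0_iff)

lemma square_integrable_inner_fun: "square_integrable inner_fun"
  by (rule square_integrable_bounded[OF continuous_on_disk_measurable[OF continuous_inner_fun(1)] norm_inner_fun_le])

text \<open>On the disk rho \<le> 2 |z - 1|, so rho^2 cancels the double pole of the derivative at
  1. The weighted derivative is thus square integrable.\<close>

lemma rho_power2_inner_fun_deriv_le:
  assumes "z \<in> unit_disk"
  shows "cmod ((rho z)\<^sup>2 * inner_fun_deriv z) \<le> 4"
proof -
  have z: "cmod z < 1" using assms by simp
  then have nz: "z \<noteq> 1" by auto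
  have d: "1 - cmod z \<le> cmod (z - 1)"
    using norm_triangle_ineq2[of 1 z] by (simp add: norm_minus_commute)
  have "1 - (cmod z)\<^sup>2 = (1 - cmod z) * (1 + cmod z)"
    by (simp add: power2_eq_square algebra_simps)
  also have "\<dots> \<le> (1 - cmod z) * 2"
    using z by (intro mult_left_mono) auto
  also have "\<dots> \<le> 2 * cmod (z - 1)"
    using d by simp
  finally have le: "1 - (cmod z)\<^sup>2 \<le> 2 * cmod (z - 1)" .
  have "0 \<le> 1 - (cmod z)\<^sup>2"
    using z by (simp add: abs_square_le_1)
  then have "cmod (rho z) \<le> 2 * cmod (z - 1)"
    using le unfolding rho_of_real norm_of_real by simp
  then have "(cmod (rho z))\<^sup>2 \<le> (2 * cmod (z - 1))\<^sup>2"
    by (intro power_mono) auto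
  then have "(cmod (rho z))\<^sup>2 * cmod (inner_fun z) \<le> (2 * cmod (z - 1))\<^sup>2 * 1"
    using norm_inner_fun_le[OF assms] by (intro mult_mono) auto
  then show ?thesis
    using nz by (simp add: inner_fun_deriv_def norm_mult norm_divide norm_power divide_simps power_mult_distrib)
qed

lemma smooth_zero_on_open:
  assumes "smooth \<psi>" "open U" "\<And>z. z \<in> U \<Longrightarrow> \<psi> z = 0" "z \<in> U"
  shows "wirtinger \<psi> z = 0" "wirtinger_bar \<psi> z = 0"
proof -
  have "has_wirtinger \<psi> 0 0 z"
    unfolding has_wirtinger_def
  proof (rule has_derivative_transform_within_open[where s = U])
    show "((\<lambda>z. 0) has_derivative (\<lambda>h. 0 * h + 0 * cnj h)) (at z)" by simp
  qed (use assms in auto)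
  from has_wirtinger_imp(3,4)[OF this] show "wirtinger \<psi> z = 0" "wirtinger_bar \<psi> z = 0" .
qed

lemma continuous_on_mult_vanishing:
  fixes f g :: "complex \<Rightarrow> complex"
  assumes "continuous_on (- {1}) f" "continuous_on UNIV g" "open U" "1 \<in> U" "\<And>z. z \<in> U \<Longrightarrow> g z = 0"
  shows "continuous_on UNIV (\<lambda>z. f z * g z)"
proof -
  have "continuous_on (- {1} \<union> U) (\<lambda>z. f z * g z)"
  proof (rule continuous_on_open_Un)
    show "continuous_on (- {1}) (\<lambda>z. f z * g z)"
      by (intro continuous_on_mult assms(1) continuous_on_subset[OF assms(2)]) auto
    show "continuous_on U (\<lambda>z. f z * g z)"
      using assms(5) by (subst continuous_on_cong[OF refl, of _ _ "\<lambda>z. 0"]) auto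
  qed (use assms(3) in auto)
  moreover have "- {1} \<union> U = UNIV" using assms(4) by auto
  ultimately show ?thesis by simp
qed

text \<open>\<psi> vanishes near the complement of the disk, in particular near the singularity 1,
  so the product with \<open>inner_fun\<close> is C^1 on the whole plane. Holomorphy removes the
  term with the conjugate derivative of \<open>inner_fun\<close>.\<close>

lemma integral_inner_fun_parts:
  assumes \<psi>: "smooth \<psi>" and U: "open U" "- unit_disk \<subseteq> U" and z0: "\<And>z. z \<in> U \<Longrightarrow> \<psi> z = 0"
  shows "integrable area (\<lambda>z. inner_fun_deriv z * \<psi> z)"
    "(LINT z|area. inner_fun z * wirtinger \<psi> z) = - (LINT z|area. inner_fun_deriv z * \<psi> z)"
    "(LINT z|area. inner_fun z * wirtinger_bar \<psi> z) = 0"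
proof -
  have 1: "1 \<in> U" using U(2) by auto
  note v = smooth_zero_on_open[OF \<psi> U(1) z0]
  note c = continuous_on_mult_vanishing[OF continuous_inner_fun(1) _ U(1) 1]
    continuous_on_mult_vanishing[OF continuous_inner_fun(2) _ U(1) 1]
  have c1: "continuous_on UNIV (\<lambda>z. inner_fun z * wirtinger \<psi> z)"
    by (rule c(1)[OF smooth_continuous[OF smooth_wirtinger[OF \<psi>]]]) (rule v)
  have c2: "continuous_on UNIV (\<lambda>z. inner_fun z * wirtinger_bar \<psi> z)"
    by (rule c(1)[OF smooth_continuous[OF smooth_wirtinger_bar[OF \<psi>]]]) (rule v)
  have c3: "continuous_on UNIV (\<lambda>z. inner_fun_deriv z * \<psi> z)"
    by (rule c(2)[OF smooth_continuous[OF \<psi>]]) (rule z0)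
  show i: "integrable area (\<lambda>z. inner_fun_deriv z * \<psi> z)"
    by (rule integrable_area_continuous[OF c3])
  have hw: "has_wirtinger (\<lambda>z. inner_fun z * \<psi> z) (inner_fun_deriv z * \<psi> z + inner_fun z * wirtinger \<psi> z)
      (inner_fun z * wirtinger_bar \<psi> z) z" for z
  proof (cases "z = 1")
    case False
    show ?thesis
      using has_wirtinger_mult[OF has_wirtinger_inner_fun[OF False] smooth_has_wirtinger[OF \<psi>]] by simp
  next
    case True
    then have z: "z \<in> U" using 1 by simp
    have "has_wirtinger (\<lambda>z. inner_fun z * \<psi> z) 0 0 z"
      unfolding has_wirtinger_def
    proof (rule has_derivative_transform_within_open[where s = U])
      show "((\<lambda>z. 0) has_derivative (\<lambda>h. 0 * h + 0 * cnj h)) (at z)" by simp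
    qed (use z U z0 in auto)
    then show ?thesis using v[OF _ z] z0[OF z] by simp
  qed
  have out: "inner_fun z * \<psi> z = 0" if "z \<notin> unit_disk" for z
    using that U(2) z0 by auto
  note I = integral_wirtinger_eq_0[OF hw continuous_on_add[OF c3 c1] c2]
  show "(LINT z|area. inner_fun z * wirtinger_bar \<psi> z) = 0"
    by (rule I(2)) (rule out)
  have "(LINT z|area. inner_fun_deriv z * \<psi> z + inner_fun z * wirtinger \<psi> z) = 0"
    by (rule I(1)) (rule out)
  then show "(LINT z|area. inner_fun z * wirtinger \<psi> z) = - (LINT z|area. inner_fun_deriv z * \<psi> z)"
    unfolding Bochner_Integration.integral_add[OF i integrable_area_continuous[OF c1]]
    by (simp add: eq_neg_iff_add_eq_0 add.commute)
qed

lemma test_function_support: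
  assumes "test_function \<phi>"
  shows "open (- closure {z. \<phi> z \<noteq> 0})" "- unit_disk \<subseteq> - closure {z. \<phi> z \<noteq> 0}"
    "\<And>z. z \<in> - closure {z. \<phi> z \<noteq> 0} \<Longrightarrow> \<phi> z = 0"
  using assms closure_subset[of "{z. \<phi> z \<noteq> 0}"] by (auto simp: test_function_def open_Compl)

text \<open>The transpose is a conjugate derivative of a function vanishing near the circle, and a
  holomorphic factor pairs to zero with such a derivative.\<close>

lemma inner_fun_in_kernel: "(abs_L2 inner_fun, 0) \<in> Delta_max"
  unfolding Delta_max_iff
proof (intro allI impI)
  fix \<phi> assume \<phi>: "test_function \<phi>"
  note s = test_functionD(1)[OF \<phi>] and U = test_function_support[OF \<phi>]
  define w where "w = (\<lambda>z. (rho z)\<^sup>2 * wirtinger \<phi> z)"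
  have sw: "smooth w"
    unfolding w_def by (intro smooth_mult smooth_power smooth_rho smooth_wirtinger s)
  have "(LINT z|area. inner_fun z * wirtinger_bar w z) = 0"
  proof (rule integral_inner_fun_parts(3)[OF sw U(1,2)])
    fix z assume "z \<in> - closure {z. \<phi> z \<noteq> 0}"
    from smooth_zero_on_open(1)[OF s U(1) U(3) this] show "w z = 0" by (simp add: w_def)
  qed
  then have "(LINT z|area. inner_fun z * Delta_transpose \<phi> z) = 0"
    unfolding Delta_transpose_def w_def mult.left_commute[of _ "- 4"] by simp
  moreover have "distr_of 0 \<phi> = 0"
    by (simp add: zero_abs distr_of_abs square_integrable_zero square_integrable_smooth s)
  ultimately show "distr_of 0 \<phi> = distr_of (abs_L2 inner_fun) (Delta_transpose \<phi>)"
    by (simp add: distr_of_abs square_integrable_inner_fun square_integrable_smooth smooth_Delta_transpose s)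
qed

text \<open>For small h a rectangle of size h^2 by h along a horocycle at 1 has area h^3, while the
  squared derivative there is at least a constant over h^4. The integral would then exceed a
  constant over h for every small h.\<close>

lemma inner_fun_deriv_not_L2: "\<not> integrable area (\<lambda>z. (cmod (inner_fun_deriv z))\<^sup>2)"
proof
  assume int: "integrable area (\<lambda>z. (cmod (inner_fun_deriv z))\<^sup>2)"
  define K where "K = (LINT z|area. (cmod (inner_fun_deriv z))\<^sup>2)"
  have bound: "exp (- 8) / 25 \<le> K * h" if h: "0 < h" "h \<le> 1 / 4" for h
  proof -
    \<comment> \<open>With x = 1 - Re z and y = Im z, the squared distance d to 1 satisfies h^2
      \<le> d \<le> 5 h^2. The lower limit 3 h^2 for x gives |z|^2 = 1 - 2x + d < 1, and the upper
      limit 4 h^2 gives x / d \<le> 4.\<close>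
    define B where "B = cbox (Complex (1 - 4 * h\<^sup>2) h) (Complex (1 - 3 * h\<^sup>2) (2 * h))"
    \<comment> \<open>The modulus of \<open>inner_fun\<close> is at least exp (- 4) on B, and d^2
      \<le> 25 h^4.\<close>
    define c where "c = exp (- 8) / (25 * h ^ 4)"
    have h2: "h\<^sup>2 \<le> 1 / 16" using power_mono[OF h(2), of 2] h by (simp add: power2_eq_square)
    have pt: "z \<in> unit_disk \<and> c \<le> (cmod (inner_fun_deriv z))\<^sup>2" if "z \<in> B" for z
    proof -
      define x where "x = 1 - Re z"
      define y where "y = Im z"
      define d where "d = (cmod (z - 1))\<^sup>2"
      have xy: "3 * h\<^sup>2 \<le> x" "x \<le> 4 * h\<^sup>2" "h \<le> y" "y \<le> 2 * h"
        using that by (auto simp: B_def x_def y_def in_cbox_complex_iff)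
      have d: "d = x\<^sup>2 + y\<^sup>2"
        by (simp add: d_def x_def y_def cmod_power2 power2_commute)
      have "x\<^sup>2 \<le> (4 * h\<^sup>2)\<^sup>2" "y\<^sup>2 \<le> (2 * h)\<^sup>2" "h\<^sup>2 \<le> y\<^sup>2"
        using xy h by (intro power_mono; auto intro: order_trans[of _ "3 * h\<^sup>2"])+
      moreover have "(4 * h\<^sup>2)\<^sup>2 \<le> h\<^sup>2"
        using mult_right_mono[OF h2, of "h\<^sup>2"] by (simp add: power2_eq_square)
      ultimately have dl: "d \<le> 5 * h\<^sup>2" and dg: "h\<^sup>2 \<le> d"
        unfolding d by (simp_all add: power_mult_distrib add_increasing)
      have hp: "0 < h\<^sup>2" using h by simp
      have "(cmod z)\<^sup>2 = 1 - 2 * x + d"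
        unfolding d_def x_def cmod_power2 by (simp add: power2_eq_square algebra_simps)
      also have "\<dots> < 1" using xy(1) dl hp by linarith
      finally have "z \<in> unit_disk" by (simp add: abs_square_less_1)
      moreover have "c \<le> (cmod (inner_fun_deriv z))\<^sup>2"
      proof -
        have "x / d \<le> 4"
          using xy(2) dg hp by (subst pos_divide_le_eq) linarith+
        then have "exp (- 4) \<le> cmod (inner_fun z)"
          by (simp add: norm_inner_fun d_def x_def minus_divide_left[symmetric] del: minus_diff_eq)
        then have "(exp (- 4))\<^sup>2 \<le> (cmod (inner_fun z))\<^sup>2"
          by (intro power_mono) auto
        then have e: "exp (- 8) \<le> (cmod (inner_fun z))\<^sup>2"
          by (simp add: power2_eq_square flip: exp_add)
        have "d\<^sup>2 \<le> (5 * h\<^sup>2)\<^sup>2"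
          using dl dg hp by (intro power_mono) auto
        then have d2: "d\<^sup>2 \<le> 25 * h ^ 4" by (simp add: power_mult_distrib flip: power_mult)
        have "(cmod (inner_fun_deriv z))\<^sup>2 = (cmod (inner_fun z))\<^sup>2 / d\<^sup>2"
          by (simp add: inner_fun_deriv_def norm_divide norm_power power_divide d_def)
        moreover have "exp (- 8) / (25 * h ^ 4) \<le> (cmod (inner_fun z))\<^sup>2 / d\<^sup>2"
          using e d2 dg hp by (intro frac_le) auto
        ultimately show ?thesis by (simp add: c_def)
      qed
      ultimately show ?thesis by blast
    qed
    have Bs: "B \<in> sets area" "B \<subseteq> unit_disk"
      using pt by (auto simp: area_def sets_restrict_space B_def intro!: image_eqI[of _ _ B])
    have "measure area B = measure lborel B"
      unfolding area_def using Bs(2) by (intro measure_restrict_space) auto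
    also have "\<dots> = h\<^sup>2 * h"
      using h unfolding B_def by (simp add: measure_lborel_cbox_eq Basis_complex_def)
    finally have mB: "measure area B = h ^ 3" by (simp add: power2_eq_square power3_eq_cube)
    have "(LINT z|area. c * indicator B z) \<le> K"
      unfolding K_def
    proof (rule integral_mono[OF _ int])
      show "integrable area (\<lambda>z. c * indicator B z)"
        using Bs(1) by (intro integrable_mult_right integrable_real_indicator) (simp_all add: area.emeasure_finite less_top[symmetric])
      show "c * indicator B z \<le> (cmod (inner_fun_deriv z))\<^sup>2" for z
        using pt[of z] by (cases "z \<in> B") auto
    qed
    then have "c * h ^ 3 \<le> K"
      using Bs mB by (simp add: Int_absorb2)
    then have "c * h ^ 3 * h \<le> K * h"
      using h by (intro mult_right_mono) auto
    moreover have "c * h ^ 3 * h = exp (- 8) / 25"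
      using h by (simp add: c_def eval_nat_numeral)
    ultimately show ?thesis by simp
  qed
  define e :: real where "e = exp (- 8) / 25"
  have e: "e > 0" by (simp add: e_def)
  have "K * (1/4) > 0" using bound[of "1/4"] e unfolding e_def by linarith
  then have K: "K > 0" by simp
  \<comment> \<open>Chosen so that K h \<le> e / 2, against the bound e \<le> K h.\<close>
  define h where "h = min (1 / 4) (e / (2 * K))"
  have "0 < h" "h \<le> 1 / 4" using K e by (auto simp: h_def)
  from bound[OF this] have "e \<le> K * h" by (simp add: e_def)
  also have "\<dots> \<le> K * (e / (2 * K))"
    using K by (intro mult_left_mono) (auto simp: h_def)
  also have "\<dots> = e / 2" using K by simp
  finally show False using e by simp
qed

lemma test_function_rho_power2_mult:
  assumes "test_function \<psi>"
  shows "test_function (\<lambda>z. (rho z)\<^sup>2 * \<psi> z)"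
proof -
  have "closure {z. (rho z)\<^sup>2 * \<psi> z \<noteq> 0} \<subseteq> closure {z. \<psi> z \<noteq> 0}"
    by (intro closure_mono) auto
  moreover have "smooth (\<lambda>z. (rho z)\<^sup>2 * \<psi> z)"
    by (intro smooth_mult smooth_power smooth_rho test_functionD(1) assms)
  ultimately show ?thesis
    using assms unfolding test_function_def smooth_def by blast
qed

text \<open>A representing H must equal the classical derivative almost everywhere, which is not
  square integrable. The identification is made after multiplication by rho^2, which does not vanish
  on the disk.\<close>

lemma inner_fun_not_in_domain: "\<not> represents H (distr_dz (distr_of (abs_L2 inner_fun)))"
proof
  assume H: "represents H (distr_dz (distr_of (abs_L2 inner_fun)))"
  define f where "f = rep_L2 H"
  have sf: "square_integrable f" by (simp add: f_def square_integrable_rep)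
  then have fm: "f \<in> borel_measurable area" by (simp add: square_integrable_def)
  note dm = continuous_on_disk_measurable[OF continuous_inner_fun(2)]
  have rm: "(\<lambda>z. (rho z)\<^sup>2) \<in> borel_measurable area"
    by (intro measurable_area borel_measurable_continuous_onI smooth_continuous smooth_power smooth_rho)
  have s1: "square_integrable (\<lambda>z. (rho z)\<^sup>2 * f z)"
  \<comment> \<open>Applied to a constant sequence, this is just square integrability by
    domination.\<close>
  proof (rule abs_L2_tendsto(2))
    show "AE z in area. cmod ((rho z)\<^sup>2 * f z) \<le> cmod (f z)" for n :: nat
    proof (rule AE_I2)
      fix z assume "z \<in> space area"
      then have "cmod ((rho z)\<^sup>2) \<le> 1" by (intro cmod_rho_power2(1)) simp
      from mult_right_mono[OF this, of "cmod (f z)"] show "cmod ((rho z)\<^sup>2 * f z) \<le> cmod (f z)"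
        by (simp add: norm_mult)
    qed
    show "AE z in area. (\<lambda>n::nat. (rho z)\<^sup>2 * f z) \<longlonglongrightarrow> (rho z)\<^sup>2 * f z" by simp
  qed (use rm fm sf in auto)
  have s2: "square_integrable (\<lambda>z. (rho z)\<^sup>2 * inner_fun_deriv z)"
    by (rule square_integrable_bounded[OF _ rho_power2_inner_fun_deriv_le]) (use rm dm in auto)
  let ?G = "\<lambda>z. (rho z)\<^sup>2 * f z - (rho z)\<^sup>2 * inner_fun_deriv z"
  note sG = square_integrable_diff[OF s1 s2]
  \<comment> \<open>Pairing G with \<psi> is pairing the unweighted difference with the test
    function rho^2 \<psi>, where the definition of H and integration by parts agree.\<close>
  have "(0, abs_L2 ?G) \<in> Delta_max"
    unfolding Delta_max_iff
  proof (intro allI impI)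
    fix \<psi> assume \<psi>: "test_function \<psi>"
    note s\<psi> = test_functionD(1)[OF \<psi>]
    define \<phi> where "\<phi> = (\<lambda>z. (rho z)\<^sup>2 * \<psi> z)"
    have \<phi>: "test_function \<phi>" unfolding \<phi>_def by (rule test_function_rho_power2_mult[OF \<psi>])
    note s = test_functionD(1)[OF \<phi>] and U = test_function_support[OF \<phi>]
    note P = integral_inner_fun_parts[OF s U]
    have i: "integrable area (\<lambda>z. f z * \<phi> z)"
      using square_integrable_mult_cnj[OF sf square_integrable_cnj[OF square_integrable_smooth[OF s]]] by simp
    have "distr_of H \<phi> = - distr_of (abs_L2 inner_fun) (wirtinger \<phi>)"
      using H \<phi> by (auto simp: represents_def distr_dz_def)
    then have "(LINT z|area. f z * \<phi> z) = (LINT z|area. inner_fun_deriv z * \<phi> z)"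
      using P(2) by (simp add: distr_of_def[of H] f_def distr_of_abs square_integrable_inner_fun
          square_integrable_smooth smooth_wirtinger s)
    then have "(LINT z|area. f z * \<phi> z - inner_fun_deriv z * \<phi> z) = 0"
      using i P(1) by simp
    moreover have "?G z * \<psi> z = f z * \<phi> z - inner_fun_deriv z * \<phi> z" for z
      by (simp add: \<phi>_def algebra_simps)
    ultimately have "distr_of (abs_L2 ?G) \<psi> = 0"
      by (simp only: distr_of_abs[OF sG square_integrable_smooth[OF s\<psi>]])
    then show "distr_of (abs_L2 ?G) \<psi> = distr_of 0 (Delta_transpose \<psi>)"
      by (simp add: zero_abs distr_of_abs square_integrable_zero square_integrable_smooth smooth_Delta_transpose s\<psi>)
  qed
  then have "abs_L2 ?G = 0" by (rule Delta_max_zero_left)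
  then have "AE z in area. ?G z = 0"
    by (simp add: zero_abs abs_L2_eq_iff sG square_integrable_zero)
  moreover have "AE z in area. rho z \<noteq> 0"
    using cmod_rho_power2(2) by (intro AE_I2) simp
  ultimately have "AE z in area. (cmod (f z))\<^sup>2 = (cmod (inner_fun_deriv z))\<^sup>2"
    by eventually_elim (simp flip: right_diff_distrib)
  then have "integrable area (\<lambda>z. (cmod (f z))\<^sup>2) \<longleftrightarrow> integrable area (\<lambda>z. (cmod (inner_fun_deriv z))\<^sup>2)"
    using fm dm by (intro integrable_cong_AE) auto
  then show False
    using sf inner_fun_deriv_not_L2 by (simp add: square_integrable_def)
qed

lemma not_self_adjoint_Delta_tilde: "\<not> self_adjoint Delta_tilde"
proof
  assume "self_adjoint Delta_tilde"
  then have "adjoint_graph Delta_tilde = Delta_tilde"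
    by (simp add: self_adjoint_def)
  \<comment> \<open>Taking adjoints reverses inclusions, so a self-adjoint
    \<open>Delta_tilde\<close> would contain \<open>Delta_max\<close> and with it the kernel element
    \<open>inner_fun\<close>.\<close>
  moreover have "adjoint_graph Delta_max \<subseteq> adjoint_graph Delta_tilde"
    using Delta_tilde_subset unfolding adjoint_graph_def by blast
  ultimately have "(abs_L2 inner_fun, 0) \<in> Delta_tilde"
    using inner_fun_in_kernel by (auto simp: adjoint_Delta_max)
  then show False
    using inner_fun_not_in_domain by (auto simp: Delta_tilde_iff)
qed

theorem proposition3p2:
  shows "(linear_operator Delta_tilde \<and> densely_defined Delta_tilde) \<and>
    (closable Delta_tilde \<and> (\<exists>S. self_adjoint S \<and> Delta_tilde \<subseteq> S)) \<and>
    (\<not> bounded_operator Delta_tilde \<and> \<not> self_adjoint Delta_tilde) \<and>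
    0 \<in> point_spectrum Delta_tilde"
  using linear_operator_Delta_tilde densely_defined_Delta_tilde closable_Delta_tilde
    self_adjoint_Delta_max Delta_tilde_subset not_bounded_Delta_tilde not_self_adjoint_Delta_tilde
    zero_in_point_spectrum by blast

end
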